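(* Let $\mathcal G_\infty=(V_\infty,E_\infty)$ be an infinite, locally finite, connected, undirected graph without self-loops, with positive symmetric edge weights $W$, approximated by finite subgraphs with vertex sets $V_n\uparrow V_\infty$, and let $(\boldsymbol\beta_i)_{i\in V_\infty}$, $\mathcal F_n$, $u^{(n)}$, $\hat G^{(n)}$ be as defined in the context. For any $j,k,l\in V_\infty$, the processes $$M_j^{(n)}=e^{u_j^{(n)}},\quad n\in\mathbb{N},$$ $$M_{j,k}^{(n)}=e^{u_j^{(n)}+u_k^{(n)}}-\hat G^{(n)}_{jk},\quad n\in\mathbb{N},$$ $$M_{j,k,l}^{(n)}=e^{u_j^{(n)}+u_k^{(n)}+u_l^{(n)}}-e^{u_j^{(n)}}\hat G^{(n)}_{kl}-e^{u_k^{(n)}}\hat G^{(n)}_{jl}-e^{u_l^{(n)}}\hat G^{(n)}_{jk},\quad n\in\mathbb{N},$$ are martingales with respect to the filtration $(\mathcal F_n)_{n\in\mathbb{N}}$ on $(\Omega_\infty,\mathcal F_\infty,\mu^W_\infty)$. More generally, for any $m\in\mathbb{N}$ and any $i_1,\ldots,i_m\in V_\infty$, $$M_{i_1,\ldots,i_m}^{(n)}=\sum_{\substack{I\subseteq\{1,\ldots,m\}\\ |I|\text{ even}}}\ \sum_{\mathcal I\in\mathcal P_2(I)}(-1)^{|I|/2}\prod_{k\in\{1,\ldots,m\}\setminus I}e^{u^{(n)}_{i_k}}\prod_{\{k,l\}\in\mathcal I}\hat G^{(n)}_{i_ki_l},\quad n\in\mathbb{N},$$ is a martingale with respect to the same filtration,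 where $\mathcal P_2(I)$ denotes the set of all partitions of $I$ into sets of size $2$ (the case $I=\emptyset$ contributes the term $\prod_{k=1}^m e^{u^{(n)}_{i_k}}$).
   Context: **Finite graphs.** Let $(\tilde V,\tilde E)$ be a finite, undirected, connected graph without self-loops, $\delta\in\tilde V$, $V=\tilde V\setminus\{\delta\}$, with weights $W_{ij}=W_{ji}>0$ for $(i\sim j)\in\tilde E$, $W_{ij}=0$ if $i\not\sim j$. Let $U_V=\{u\in\mathbb{R}^{\tilde V}:u_\delta=0\}$, $\Omega_V=U_V\times U_V\ni(u,s)$. The matrix $A^W(u)\in\mathbb{R}^{\tilde V\times\tilde V}$ has entries $-W_{ij}e^{u_i+u_j}$ for $i\neq j$ and $\sum_{k\in\tilde V}W_{ik}e^{u_i+u_k}$ for $i=j$; $A^W_{VV}(u)$ is the submatrix with row and column $\delta$ deleted (positive definite). The $H^{2|2}$ measure is the probability measure on $\Omega_V$ $$\mu^W(du\,ds)=e^{-\frac12 s^tA^W(u)s}\det A^W_{VV}(u)\prod_{(i\sim j)\in\tilde E}e^{-W_{ij}[\cosh(u_i-u_j)-1]}\prod_{i\in V}e^{-u_i}\frac{du_ids_i}{2\pi}$$ (known to have total mass 1). Put $\hat G^V_{ij}(u)=e^{u_i}(A^W_{VV}(u)^{-1})_{ij}e^{u_j}$ for $i,j\in V$, and $\hat G^V_{ij}(u)=0$ if $i=\delta$ or $j=\delta$. Put $\beta^V(u)=(\beta_i(u))_{i\in V}$, $\beta_i(u)=\frac12\sum_{j\in\tilde V:j\sim i}W_{ij}e^{u_j-u_i}$.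 It is known that $u\in U_V$ is a measurable function of $\beta^V(u)$: there is a measurable $f_V^W:\mathbb{R}^V\to\mathbb{R}^{\tilde V}$ with $u=f_V^W(\beta^V(u))$ for all $u\in U_V$ (namely, on the range of $\beta^V$, $u_\delta=0$ and $(e^{u_i})_{i\in V}=H_\beta^{-1}(W_{i\delta})_{i\in V}$ with $(H_\beta)_{ij}=2\beta_i\delta_{ij}-W_{ij}$, $i,j\in V$; extended arbitrarily measurably elsewhere). **Infinite graph.** $W_{ij}=W_{ji}>0$ for $(i\sim j)\in E_\infty$, $W_{ij}=0$ otherwise. $V_n\uparrow V_\infty$ are finite vertex sets (increasing with union $V_\infty$), $E_n=\{(i\sim j)\in E_\infty:i,j\in V_n\}$. The wired graph $\tilde{\mathcal G}_n=(\tilde V_n,\tilde E_n)$ is obtained by collapsing $V_\infty\setminus V_n$ to one vertex $\delta_n$: $\tilde V_n=V_n\cup\{\delta_n\}$, $\tilde E_n=E_n\cup\{(i\sim\delta_n):i\in V_n,\ \exists j\in V_\infty\setminus V_n,\ (i\sim j)\in E_\infty\}$, with weights $W^{(n)}_{ij}=W_{ij}$ for $i,j\in V_n$, $W^{(n)}_{i\delta_n}=W^{(n)}_{\delta_ni}=\sum_{j\in V_\infty\setminus V_n}W_{ij}$ for $i\in V_n$, $W^{(n)}_{\delta_n\delta_n}=0$. Let $\mu_n^W$ be the $H^{2|2}$ measure on $\tilde{\mathcal G}_n$ with weights $W^{(n)}$ and reference vertex $\delta_n$. It is known that the laws of $\beta^{V_n}$ under $\mu_n^W$ are consistent (the law of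 $\beta^{V_{n+1}}|_{V_n}$ under $\mu^W_{n+1}$ equals the law of $\beta^{V_n}$ under $\mu^W_n$), so by Kolmogorov's extension theorem there are random variables $(\boldsymbol\beta_i)_{i\in V_\infty}$ on a probability space $(\Omega_\infty,\mathcal F_\infty,\mu_\infty^W)$ such that for every $n$ the law of $\boldsymbol\beta^{(n)}=(\boldsymbol\beta_i)_{i\in V_n}$ under $\mu_\infty^W$ equals the law of $\beta^{V_n}$ under $\mu_n^W$. Define $\mathcal F_n=\sigma(\boldsymbol\beta^{(n)})$, $u^{(n)}=(u^{(n)}_i)_{i\in\tilde V_n}=f_{V_n}(\boldsymbol\beta^{(n)})$ (the function $f$ above for the graph $\tilde{\mathcal G}_n$ with weights $W^{(n)}$), extended by $u^{(n)}_i=u^{(n)}_{\delta_n}=0$ for $i\in V_\infty\setminus V_n$. Let $\hat G^{(n)}=\hat G^{V_n}(u^{(n)})$, the Green's function of $\tilde{\mathcal G}_n$ with weights $W^{(n)}$ evaluated at $u^{(n)}$, extended by $\hat G^{(n)}_{kl}=\hat G^{(n)}_{lk}=0$ for $k\in V_\infty\setminus V_n$, $l\in V_\infty$. *)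

theory Defs
  imports "HOL-Probability.Probability" "HOL-Combinatorics.Permutations"
begin

section \<open>Weighted graphs\<close>

text \<open>An undirected edge joining \<open>i\<close> and \<open>j\<close> is the set \<open>{i, j}\<close>.\<close>

record 'a wgraph =
  verts :: "'a set"
  edges :: "'a set set"
  weight :: "'a \<Rightarrow> 'a \<Rightarrow> real"

definition adj :: "'a wgraph \<Rightarrow> 'a \<Rightarrow> 'a \<Rightarrow> bool" where
  "adj G i j \<longleftrightarrow> {i, j} \<in> edges G"

definition simple_graph :: "'a wgraph \<Rightarrow> bool" where
  "simple_graph G \<longleftrightarrow> edges G \<subseteq> {{i, j} | i j. i \<in> verts G \<and> j \<in> verts G \<and> i \<noteq> j}"

definition connected_graph :: "'a wgraph \<Rightarrow> bool" where
  "connected_graph G \<longleftrightarrow> (\<forall>i\<in>verts G. \<forall>j\<in>verts G. (i, j) \<in> {(x, y). adj G x y}\<^sup>*)"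

definition locally_finite_graph :: "'a wgraph \<Rightarrow> bool" where
  "locally_finite_graph G \<longleftrightarrow> (\<forall>i\<in>verts G. finite {j \<in> verts G. adj G i j})"

definition symmetric_positive_weights :: "'a wgraph \<Rightarrow> bool" where
  "symmetric_positive_weights G \<longleftrightarrow>
     (\<forall>i\<in>verts G. \<forall>j\<in>verts G.
        weight G i j = weight G j i \<and>
        (if adj G i j then weight G i j > 0 else weight G i j = 0))"


section \<open>Determinant and inverse of a matrix indexed by a finite set\<close>

text \<open>The row and column index set of the matrices below is a varying finite set, so the
  type-indexed matrices of the library do not apply; the determinant is the same Leibniz sum.\<close>

definition det_on :: "'a set \<Rightarrow> ('a \<Rightarrow> 'a \<Rightarrow> real) \<Rightarrow> real" where
  "det_on I A = (\<Sum>p | p permutes I. of_int (sign p) * (\<Prod>i\<in>I. A i (p i)))"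

definition inverse_on :: "'a set \<Rightarrow> ('a \<Rightarrow> 'a \<Rightarrow> real) \<Rightarrow> 'a \<Rightarrow> 'a \<Rightarrow> real" where
  "inverse_on I A = (THE B.
     (\<forall>i j. i \<notin> I \<or> j \<notin> I \<longrightarrow> B i j = 0) \<and>
     (\<forall>i\<in>I. \<forall>j\<in>I. (\<Sum>k\<in>I. A i k * B k j) = of_bool (i = j) \<and>
                   (\<Sum>k\<in>I. B i k * A k j) = of_bool (i = j)))"


section \<open>The \<open>H\<^sup>2\<^sup>|\<^sup>2\<close> measure of a finite graph with reference vertex \<open>\<delta>\<close>\<close>

text \<open>The space \<open>U\<^sub>V\<close>; its elements are represented as functions that are
  \<^const>\<open>undefined\<close> outside the vertex set.\<close>

definition pinned :: "'a wgraph \<Rightarrow> 'a \<Rightarrow> ('a \<Rightarrow> real) set" where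
  "pinned G \<delta> = {u \<in> verts G \<rightarrow>\<^sub>E UNIV. u \<delta> = 0}"

text \<open>Lebesgue measure \<open>\<Prod>\<^sub>i du\<^sub>i\<close> (over \<open>i \<noteq> \<delta>\<close>), carried over to \<open>U\<^sub>V\<close> by setting the
  \<open>\<delta>\<close>-coordinate to 0.\<close>

definition pinned_lebesgue :: "'a wgraph \<Rightarrow> 'a \<Rightarrow> ('a \<Rightarrow> real) measure" where
  "pinned_lebesgue G \<delta> =
     distr (Pi\<^sub>M (verts G - {\<delta>}) (\<lambda>_. lborel))
           (restrict_space (Pi\<^sub>M (verts G) (\<lambda>_. borel)) (pinned G \<delta>))
           (\<lambda>u. u(\<delta> := 0))"

definition A_matrix :: "'a wgraph \<Rightarrow> ('a \<Rightarrow> real) \<Rightarrow> 'a \<Rightarrow> 'a \<Rightarrow> real" where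
  "A_matrix G u i j =
     (if i = j then (\<Sum>k\<in>verts G. weight G i k * exp (u i + u k))
      else - weight G i j * exp (u i + u j))"

text \<open>The factor attached to an undirected edge is symmetric in its two endpoints, hence
  uniquely determined by the edge; this is what \<open>THE\<close> selects.\<close>

definition edge_factor :: "'a wgraph \<Rightarrow> ('a \<Rightarrow> real) \<Rightarrow> 'a set \<Rightarrow> real" where
  "edge_factor G u e =
     (THE c. \<exists>i j. e = {i, j} \<and> c = exp (- weight G i j * (cosh (u i - u j) - 1)))"

definition h22_density :: "'a wgraph \<Rightarrow> 'a \<Rightarrow> ('a \<Rightarrow> real) \<Rightarrow> ('a \<Rightarrow> real) \<Rightarrow> real" where
  "h22_density G \<delta> u s =
     exp (- 1/2 * (\<Sum>i\<in>verts G. \<Sum>j\<in>verts G. s i * A_matrix G u i j * s j))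
     * det_on (verts G - {\<delta>}) (A_matrix G u)
     * (\<Prod>e\<in>edges G. edge_factor G u e)
     * (\<Prod>i\<in>verts G - {\<delta>}. exp (- u i) / (2 * pi))"

definition h22_measure :: "'a wgraph \<Rightarrow> 'a \<Rightarrow> (('a \<Rightarrow> real) \<times> ('a \<Rightarrow> real)) measure" where
  "h22_measure G \<delta> =
     density (pinned_lebesgue G \<delta> \<Otimes>\<^sub>M pinned_lebesgue G \<delta>)
             (\<lambda>(u, s). ennreal (h22_density G \<delta> u s))"

definition green :: "'a wgraph \<Rightarrow> 'a \<Rightarrow> ('a \<Rightarrow> real) \<Rightarrow> 'a \<Rightarrow> 'a \<Rightarrow> real" where
  "green G \<delta> u i j =
     (if i \<in> verts G - {\<delta>} \<and> j \<in> verts G - {\<delta>}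
      then exp (u i) * inverse_on (verts G - {\<delta>}) (A_matrix G u) i j * exp (u j)
      else 0)"

definition beta_of :: "'a wgraph \<Rightarrow> 'a \<Rightarrow> ('a \<Rightarrow> real) \<Rightarrow> 'a \<Rightarrow> real" where
  "beta_of G \<delta> u = (\<lambda>i\<in>verts G - {\<delta>}.
     1/2 * (\<Sum>j | j \<in> verts G \<and> adj G i j. weight G i j * exp (u j - u i)))"

text \<open>The map \<open>f\<close> is a measurable left inverse of \<open>u \<mapsto> \<beta>(u)\<close> on \<open>U\<^sub>V\<close>. This fixes \<open>f\<close> on the range
  of \<open>\<beta>\<close>; off the range it is arbitrary.\<close>

definition recovers_u :: "'a wgraph \<Rightarrow> 'a \<Rightarrow> (('a \<Rightarrow> real) \<Rightarrow> ('a \<Rightarrow> real)) \<Rightarrow> bool" where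
  "recovers_u G \<delta> f \<longleftrightarrow>
     f \<in> Pi\<^sub>M (verts G - {\<delta>}) (\<lambda>_. borel) \<rightarrow>\<^sub>M Pi\<^sub>M (verts G) (\<lambda>_. borel) \<and>
     (\<forall>u\<in>pinned G \<delta>. f (beta_of G \<delta> u) = u)"


section \<open>Wired finite approximations\<close>

text \<open>\<open>wired G V\<close> collapses \<open>verts G - V\<close> to the single vertex \<^const>\<open>None\<close>. The weight towards it is
  summed over neighbours only: the remaining terms vanish, and \<^const>\<open>sum\<close> over the infinite set
  \<open>verts G - V\<close> would be 0 by convention.\<close>

definition wired :: "'a wgraph \<Rightarrow> 'a set \<Rightarrow> 'a option wgraph" where
  "wired G V = \<lparr>
     verts = Some ` V \<union> {None},
     edges = {{Some i, Some j} | i j. i \<in> V \<and> j \<in> V \<and> adj G i j}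
           \<union> {{Some i, None} | i. i \<in> V \<and> (\<exists>j\<in>verts G - V. adj G i j)},
     weight = (\<lambda>x y. case (x, y) of
         (Some i, Some j) \<Rightarrow> weight G i j
       | (Some i, None) \<Rightarrow> (\<Sum>j | j \<in> verts G - V \<and> adj G i j. weight G i j)
       | (None, Some i) \<Rightarrow> (\<Sum>j | j \<in> verts G - V \<and> adj G i j. weight G i j)
       | (None, None) \<Rightarrow> 0) \<rparr>"

text \<open>In the remaining definitions \<open>\<beta>\<close> is the random field on the infinite graph, \<open>V\<close> one of the
  finite vertex sets, and \<open>f\<close> the map recovering \<open>u\<close> on \<open>wired G V\<close>. The restriction of \<open>\<beta>\<close> to \<open>V\<close> is
  indexed by the non-reference vertices \<open>Some ` V\<close> of the wired graph.\<close>

definition beta_restr :: "'a set \<Rightarrow> ('a \<Rightarrow> 'w \<Rightarrow> real) \<Rightarrow> 'w \<Rightarrow> 'a option \<Rightarrow> real" where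
  "beta_restr V \<beta> \<omega> = (\<lambda>x\<in>Some ` V. \<beta> (the x) \<omega>)"

definition beta_algebra :: "'w measure \<Rightarrow> 'a set \<Rightarrow> ('a \<Rightarrow> 'w \<Rightarrow> real) \<Rightarrow> 'w measure" where
  "beta_algebra M V \<beta> =
     vimage_algebra (space M) (beta_restr V \<beta>) (Pi\<^sub>M (Some ` V) (\<lambda>_. borel))"

definition u_field ::
  "'a set \<Rightarrow> (('a option \<Rightarrow> real) \<Rightarrow> ('a option \<Rightarrow> real)) \<Rightarrow> ('a \<Rightarrow> 'w \<Rightarrow> real) \<Rightarrow> 'w \<Rightarrow> 'a \<Rightarrow> real" where
  "u_field V f \<beta> \<omega> i = (if i \<in> V then f (beta_restr V \<beta> \<omega>) (Some i) else 0)"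

definition green_field ::
  "'a wgraph \<Rightarrow> 'a set \<Rightarrow> (('a option \<Rightarrow> real) \<Rightarrow> ('a option \<Rightarrow> real)) \<Rightarrow> ('a \<Rightarrow> 'w \<Rightarrow> real)
     \<Rightarrow> 'w \<Rightarrow> 'a \<Rightarrow> 'a \<Rightarrow> real" where
  "green_field G V f \<beta> \<omega> k l =
     (if k \<in> V \<and> l \<in> V
      then green (wired G V) None (f (beta_restr V \<beta> \<omega>)) (Some k) (Some l)
      else 0)"


section \<open>Pairings and martingales\<close>

text \<open>For index sets \<open>I\<close> of natural numbers, the two elements of a block \<open>p\<close> of a pairing are
  \<open>Min p\<close> and \<open>Max p\<close>; their order is irrelevant for products of Green's functions, which
  are symmetric.\<close>

definition pairings :: "'a set \<Rightarrow> 'a set set set" where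
  "pairings I = {P. partition_on I P \<and> (\<forall>p\<in>P. card p = 2)}"

definition martingale :: "'w measure \<Rightarrow> (nat \<Rightarrow> 'w measure) \<Rightarrow> (nat \<Rightarrow> 'w \<Rightarrow> real) \<Rightarrow> bool" where
  "martingale M F X \<longleftrightarrow>
     filtration (space M) F \<and>
     (\<forall>n. subalgebra M (F n)) \<and>
     (\<forall>n. X n \<in> borel_measurable (F n)) \<and>
     (\<forall>n. integrable M (X n)) \<and>
     (\<forall>m n. m \<le> n \<longrightarrow> (AE \<omega> in M. real_cond_exp M (F m) (X n) \<omega> = X m \<omega>))"

end

theory Submission
  imports Defs
begin

text \<open>Let \<open>H = 2\<beta> - W\<close> on a finite vertex set with weights \<open>\<eta>\<close> towards the reference vertex. The field of
  the \<open>H\<^sup>2\<^sup>|\<^sup>2\<close> measure satisfies \<open>H e\<^sup>u = \<eta>\<close>, the matrix \<open>H\<^sup>-\<^sup>1\<close> is the Green's function \<open>G\<close>, and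
  after integration over \<open>s\<close> the law of \<open>\<beta>\<close> has a density proportional to
  \<open>exp (- \<langle>1, H 1\<rangle>/2 - \<langle>\<eta>, H\<^sup>-\<^sup>1 \<eta>\<rangle>/2 + \<langle>1, \<eta>\<rangle>) / sqrt (det H)\<close> where \<open>H\<close> is positive definite. In
  this form the following two facts can be read off.

  \<^item> Tilting: for \<open>\<theta> \<ge> 0\<close>, multiplication by \<open>exp (- \<langle>\<theta>, e\<^sup>u\<rangle> - \<langle>\<theta>, G \<theta>\<rangle>/2)\<close> gives \<open>exp (- \<langle>1, \<theta>\<rangle>)\<close>
    times the law of \<open>\<beta>\<close> with \<open>\<eta> + \<theta>\<close> in place of \<open>\<eta>\<close> (\<open>field_integral_tilt\<close>).
  \<^item> Marginals: the restriction of \<open>\<beta>\<close> to a subset of the vertices has again a law of this form, with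
    the weights towards the removed vertices added to \<open>\<eta>\<close> (\<open>field_integral_marginal\<close>).

  Together they show that the integral of \<open>exp (- \<langle>\<theta>, e\<^sup>u\<rangle> - \<langle>\<theta>, G \<theta>\<rangle>/2)\<close> at level \<open>n\<close>, over an event
  that depends on \<open>\<beta>\<close> restricted to \<open>V m\<close> only, is the same for all \<open>n \<ge> m\<close>: tilting commutes with the
  passage from the wired graph of \<open>V n\<close> to that of \<open>V m\<close> (\<open>generating_function_eq\<close>). For
  \<open>\<theta> = \<Sum>\<^sub>k t\<^sub>k 1\<^bsub>i\<^sub>k\<^esub>\<close>, a sum of \<open>p\<close> terms, the coefficient of \<open>t\<^sub>1 \<cdots> t\<^sub>p\<close> of this exponential is, up
  to sign, the Wick polynomial in \<open>corollary2p7\<close>. Differentiating once in every \<open>t\<^sub>k\<close> at \<open>0\<close> turns the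
  equality of the integrals into the martingale property (\<open>wick_integral_eq\<close>, \<open>martingale_wick\<close>).

  The passage from \<open>u\<close> to \<open>\<beta>\<close> is made for one vertex \<open>k\<close> at a time, replacing \<open>u k\<close> by
  \<open>h = 2 \<beta> k - W k k\<close>. By completing the square, \<open>h\<close> has an explicit one-dimensional law, and the
  other vertices carry the same kind of field for the network obtained by the star-mesh transformation
  (\<open>field_integral_elim\<close>). Total mass, tilting and marginals then follow by induction on the number of
  vertices.

  Differentiation under the integral needs moments of \<open>e\<^sup>u\<close> and \<open>G\<close>. The total mass is \<open>1\<close> for all
  weights, so comparing \<open>W\<close> with \<open>W/2\<close> shows that \<open>\<Sum>\<beta> + \<langle>\<eta>, e\<^sup>u\<rangle>/2\<close> has an exponential moment. The
  equations \<open>H e\<^sup>u = \<eta>\<close> and \<open>H G = 1\<close> spread the resulting bounds along the edges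
  (\<open>all_moments_superharmonic\<close>).\<close>

section \<open>Schur complements of matrices indexed by a finite set\<close>

definition schur :: "'a \<Rightarrow> ('a \<Rightarrow> 'a \<Rightarrow> real) \<Rightarrow> 'a \<Rightarrow> 'a \<Rightarrow> real" where
  "schur k A i j = A i j - A i k * A k j / A k k"

definition pos_def_on :: "'a set \<Rightarrow> ('a \<Rightarrow> 'a \<Rightarrow> real) \<Rightarrow> bool" where
  "pos_def_on I A \<longleftrightarrow>
     (\<forall>x. (\<exists>i\<in>I. x i \<noteq> 0) \<longrightarrow> (\<Sum>i\<in>I. \<Sum>j\<in>I. x i * A i j * x j) > 0)"

lemma sum_of_bool_mult:
  fixes f :: "'a \<Rightarrow> real"
  assumes "finite I" "i \<in> I"
  shows "(\<Sum>j\<in>I. of_bool (i = j) * f j) = f i" "(\<Sum>j\<in>I. of_bool (j = i) * f j) = f i"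
    "(\<Sum>j\<in>I. f j * of_bool (i = j)) = f i" "(\<Sum>j\<in>I. f j * of_bool (j = i)) = f i"
proof -
  have *: "(\<Sum>j\<in>I. if j = i then f j else 0) = f i"
    using assms by (simp add: sum.delta)
  show "(\<Sum>j\<in>I. of_bool (i = j) * f j) = f i" "(\<Sum>j\<in>I. of_bool (j = i) * f j) = f i"
    "(\<Sum>j\<in>I. f j * of_bool (i = j)) = f i" "(\<Sum>j\<in>I. f j * of_bool (j = i)) = f i"
    by (rule trans[OF sum.cong[OF refl] *], simp)+
qed

lemma det_on_empty [simp]: "det_on {} A = 1"
proof -
  have "{p. p permutes {}} = {id :: 'a \<Rightarrow> 'a}" by auto
  then show ?thesis by (simp add: det_on_def)
qed

lemma det_on_cong:
  assumes "\<And>i j. i \<in> I \<Longrightarrow> j \<in> I \<Longrightarrow> A i j = B i j"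
  shows "det_on I A = det_on I B"
proof -
  have "(\<Prod>i\<in>I. A i (p i)) = (\<Prod>i\<in>I. B i (p i))" if "p permutes I" for p
    using that by (intro prod.cong refl assms) (simp_all add: permutes_in_image)
  then show ?thesis by (simp add: det_on_def)
qed

lemma det_on_repeated_row:
  assumes I: "finite I" "i \<in> I" "k \<in> I" "i \<noteq> k" and eq: "A i = A k"
  shows "det_on I A = 0"
proof -
  let ?t = "Transposition.transpose i k"
  let ?f = "\<lambda>p. of_int (sign p) * (\<Prod>j\<in>I. A j (p j))"
  have At: "A (?t j) = A j" for j
    unfolding Transposition.transpose_def using eq by presburger
  have t: "?t permutes I" using I by (simp add: permutes_swap_id)
  have "det_on I A = (\<Sum>p | p permutes I. ?f (p \<circ> ?t))"
    unfolding det_on_def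
    by (rule sum.reindex_bij_witness[of _ "\<lambda>p. p \<circ> ?t" "\<lambda>p. p \<circ> ?t"])
       (use t in \<open>auto simp: o_assoc[symmetric] permutes_compose\<close>)
  also have "\<dots> = (\<Sum>p | p permutes I. - ?f p)"
  proof (rule sum.cong[OF refl])
    fix p assume "p \<in> {p. p permutes I}"
    then have p: "p permutes I" by simp
    have "sign (p \<circ> ?t) = - sign p"
      using sign_compose[of p ?t] p I permutation_permutes[of p] permutation_swap_id[of i k]
        sign_swap_id[of i k] by auto
    moreover have "(\<Prod>j\<in>I. A j ((p \<circ> ?t) j)) = (\<Prod>j\<in>I. A j (p j))"
    proof -
      have "(\<Prod>j\<in>I. A j ((p \<circ> ?t) j)) = (\<Prod>j\<in>I. A (?t j) ((p \<circ> ?t) (?t j)))"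
        by (rule prod.permute[OF t, unfolded comp_def, THEN trans]) (simp add: comp_def)
      also have "\<dots> = (\<Prod>j\<in>I. A j (p j))"
        by (simp add: At)
      finally show ?thesis .
    qed
    ultimately show "?f (p \<circ> ?t) = - ?f p" by simp
  qed
  also have "\<dots> = - det_on I A" by (simp add: det_on_def sum_negf)
  finally show ?thesis by simp
qed

lemma det_on_add_row:
  assumes I: "finite I" "i \<in> I" "k \<in> I" "i \<noteq> k"
  shows "det_on I (A(i := \<lambda>j. A i j + c * A k j)) = det_on I A"
proof -
  have row: "(\<Prod>l\<in>I. (A(i := r)) l (p l)) = r (p i) * (\<Prod>l\<in>I-{i}. A l (p l))" for r and p :: "'a \<Rightarrow> 'a"
  proof -
    have "(\<Prod>l\<in>I. (A(i := r)) l (p l)) = r (p i) * (\<Prod>l\<in>I-{i}. (A(i := r)) l (p l))"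
      using I by (subst prod.remove[of I i]) auto
    also have "(\<Prod>l\<in>I-{i}. (A(i := r)) l (p l)) = (\<Prod>l\<in>I-{i}. A l (p l))"
      by (rule prod.cong) auto
    finally show ?thesis .
  qed
  have "det_on I (A(i := \<lambda>j. A i j + c * A k j))
      = det_on I (A(i := A i)) + c * det_on I (A(i := A k))"
    unfolding det_on_def row by (simp add: sum.distrib[symmetric] sum_distrib_left algebra_simps)
  also have "det_on I (A(i := A k)) = 0"
    by (rule det_on_repeated_row[OF I]) (use I in auto)
  finally show ?thesis by (simp only: fun_upd_triv mult_zero_right add_0_right)
qed

text \<open>Row operations clear column \<open>k\<close> outside the diagonal; the permutations that survive fix \<open>k\<close>.\<close>

lemma det_on_schur:
  assumes I: "finite I" "k \<notin> I" and nz: "A k k \<noteq> 0"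
  shows "det_on (insert k I) A = A k k * det_on I (schur k A)"
proof -
  define B where "B S = (\<lambda>i j. if i \<in> S then schur k A i j else A i j)" for S
  have "det_on (insert k I) (B S) = det_on (insert k I) A" if "S \<subseteq> I" for S
    using finite_subset[OF that I(1)] that
  proof (induction S)
    case empty
    then show ?case by (simp add: B_def)
  next
    case (insert i S)
    have "B (insert i S) = (B S)(i := \<lambda>j. B S i j + (- A i k / A k k) * B S k j)"
      using insert I by (auto simp: B_def fun_eq_iff schur_def)
    then have "det_on (insert k I) (B (insert i S)) = det_on (insert k I) (B S)"
      using insert I by (simp only:, intro det_on_add_row) auto
    then show ?case using insert by simp
  qed
  then have "det_on (insert k I) A = det_on (insert k I) (B I)" by simp
  also have "\<dots> = (\<Sum>p | p permutes insert k I \<and> p k = k. of_int (sign p) * (\<Prod>i\<in>insert k I. B I i (p i)))"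
    unfolding det_on_def
  proof (rule sum.mono_neutral_right)
    show "\<forall>p\<in>{p. p permutes insert k I} - {p. p permutes insert k I \<and> p k = k}.
        of_int (sign p) * (\<Prod>i\<in>insert k I. B I i (p i)) = 0"
    proof
      fix p assume "p \<in> {p. p permutes insert k I} - {p. p permutes insert k I \<and> p k = k}"
      then have p: "p permutes insert k I" "p k \<noteq> k" by auto
      then obtain i where i: "p i = k" by (meson permutes_def)
      with p have "i \<in> I" by (metis insertE insertI1 permutes_in_image)
      then have "B I i (p i) = 0" using nz i by (simp add: B_def schur_def)
      then have "(\<Prod>i\<in>insert k I. B I i (p i)) = 0"
        using I \<open>i \<in> I\<close> by (intro prod_zero) auto
      then show "of_int (sign p) * (\<Prod>i\<in>insert k I. B I i (p i)) = 0" by simp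
    qed
  qed (use I in \<open>auto intro: finite_permutations\<close>)
  also have "{p. p permutes insert k I \<and> p k = k} = {p. p permutes I}"
    using I by (auto intro: permutes_subset permutes_superset simp: permutes_not_in)
  also have "(\<Sum>p | p permutes I. of_int (sign p) * (\<Prod>i\<in>insert k I. B I i (p i)))
      = (\<Sum>p | p permutes I. A k k * (of_int (sign p) * (\<Prod>i\<in>I. schur k A i (p i))))"
    using I by (intro sum.cong) (auto simp: permutes_not_in B_def)
  also have "\<dots> = A k k * det_on I (schur k A)"
    by (simp add: det_on_def sum_distrib_left)
  finally show ?thesis .
qed

lemma pos_def_on_diag:
  assumes "finite I" "k \<in> I" "pos_def_on I A"
  shows "A k k > 0"
proof -
  have "(\<Sum>i\<in>I. \<Sum>j\<in>I. of_bool (i = k) * A i j * of_bool (j = k)) > 0"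
    using assms(3)[unfolded pos_def_on_def, rule_format, of "\<lambda>i. of_bool (i = k)"] assms(2) by auto
  also have "(\<Sum>i\<in>I. \<Sum>j\<in>I. of_bool (i = k) * A i j * of_bool (j = k)) = A k k"
    using assms by (simp only: sum_of_bool_mult sum_distrib_left[symmetric] mult.assoc)
  finally show ?thesis .
qed

text \<open>The variable \<open>x k\<close> enters only through the square of \<open>r\<close>.\<close>

lemma schur_quadratic_form:
  assumes I: "finite I" "k \<notin> I" and nz: "A k k \<noteq> 0"
    and z: "A k k * x k + (\<Sum>j\<in>I. A k j * x j) = r"
    and sym: "\<And>i. i \<in> I \<Longrightarrow> A i k = A k i"
  shows "(\<Sum>i\<in>insert k I. \<Sum>j\<in>insert k I. x i * A i j * x j)
    = (\<Sum>i\<in>I. \<Sum>j\<in>I. x i * schur k A i j * x j) + r\<^sup>2 / A k k"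
proof -
  let ?s = "\<Sum>j\<in>I. A k j * x j"
  have "(\<Sum>i\<in>insert k I. \<Sum>j\<in>insert k I. x i * A i j * x j)
     = x k * A k k * x k + x k * ?s + (\<Sum>i\<in>I. x i * A i k * x k) + (\<Sum>i\<in>I. \<Sum>j\<in>I. x i * A i j * x j)"
    using I by (simp add: sum.distrib sum_distrib_left mult.assoc)
  also have "(\<Sum>i\<in>I. x i * A i k * x k) = ?s * x k"
    unfolding sum_distrib_right by (intro sum.cong refl) (simp add: sym)
  finally have 1: "(\<Sum>i\<in>insert k I. \<Sum>j\<in>insert k I. x i * A i j * x j)
     = A k k * (x k)\<^sup>2 + 2 * ?s * x k + (\<Sum>i\<in>I. \<Sum>j\<in>I. x i * A i j * x j)"
    by (simp add: power2_eq_square algebra_simps)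
  have "(\<Sum>i\<in>I. \<Sum>j\<in>I. x i * schur k A i j * x j)
     = (\<Sum>i\<in>I. \<Sum>j\<in>I. x i * A i j * x j) - (\<Sum>i\<in>I. \<Sum>j\<in>I. (A k i * x i) * (A k j * x j) / A k k)"
    unfolding sum_subtractf[symmetric]
    by (intro sum.cong refl) (auto simp: schur_def sym algebra_simps)
  also have "(\<Sum>i\<in>I. \<Sum>j\<in>I. (A k i * x i) * (A k j * x j) / A k k) = ?s\<^sup>2 / A k k"
    by (simp add: power2_eq_square sum_product sum_divide_distrib)
  finally have 2: "(\<Sum>i\<in>I. \<Sum>j\<in>I. x i * schur k A i j * x j)
     = (\<Sum>i\<in>I. \<Sum>j\<in>I. x i * A i j * x j) - ?s\<^sup>2 / A k k" .
  show ?thesis unfolding 1 2 z[symmetric] using nz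
    by (simp add: field_simps power2_eq_square)
qed

text \<open>Every test vector of the Schur complement extends to one of \<open>A\<close> for which the square above vanishes.\<close>

lemma pos_def_on_schur:
  assumes I: "finite I" "k \<notin> I" and pd: "pos_def_on (insert k I) A"
    and sym: "\<And>i j. i \<in> insert k I \<Longrightarrow> j \<in> insert k I \<Longrightarrow> A i j = A j i"
  shows "pos_def_on I (schur k A)"
  unfolding pos_def_on_def
proof (intro allI impI)
  fix x :: "'a \<Rightarrow> real" assume x: "\<exists>i\<in>I. x i \<noteq> 0"
  have akk: "A k k > 0" using pos_def_on_diag[OF _ _ pd, of k] I by auto
  define y where "y = x(k := - (\<Sum>j\<in>I. A k j * x j) / A k k)"
  have yI: "\<And>i. i \<in> I \<Longrightarrow> y i = x i" using I by (auto simp: y_def)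
  have "0 < (\<Sum>i\<in>insert k I. \<Sum>j\<in>insert k I. y i * A i j * y j)"
    by (rule pd[unfolded pos_def_on_def, rule_format]) (use x yI in auto)
  also have "\<dots> = (\<Sum>i\<in>I. \<Sum>j\<in>I. y i * schur k A i j * y j) + 0\<^sup>2 / A k k"
  proof (rule schur_quadratic_form[OF I])
    have "(\<Sum>j\<in>I. A k j * y j) = (\<Sum>j\<in>I. A k j * x j)" by (intro sum.cong refl) (simp add: yI)
    then show "A k k * y k + (\<Sum>j\<in>I. A k j * y j) = 0" using akk by (simp add: y_def)
  qed (use akk sym in auto)
  also have "\<dots> = (\<Sum>i\<in>I. \<Sum>j\<in>I. x i * schur k A i j * x j)"
    by (simp add: yI cong: sum.cong)
  finally show "0 < (\<Sum>i\<in>I. \<Sum>j\<in>I. x i * schur k A i j * x j)" .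
qed

definition spd_on :: "'a set \<Rightarrow> ('a \<Rightarrow> 'a \<Rightarrow> real) \<Rightarrow> bool" where
  "spd_on I A \<longleftrightarrow> pos_def_on I A \<and> (\<forall>i\<in>I. \<forall>j\<in>I. A i j = A j i)"

lemma spd_on_diag: "finite I \<Longrightarrow> k \<in> I \<Longrightarrow> spd_on I A \<Longrightarrow> A k k > 0"
  using pos_def_on_diag[of I k A] unfolding spd_on_def by blast

lemma spd_on_schur:
  assumes "finite I" "k \<notin> I" "spd_on (insert k I) A"
  shows "spd_on I (schur k A)"
proof -
  have sym: "A i j = A j i" if "i \<in> insert k I" "j \<in> insert k I" for i j
    using assms(3) that unfolding spd_on_def by blast
  have "schur k A i j = schur k A j i" if "i \<in> I" "j \<in> I" for i j
    using sym[of i j] sym[of i k] sym[of k j] that by (simp add: schur_def)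
  moreover have "pos_def_on I (schur k A)"
    using assms(3) sym by (intro pos_def_on_schur[OF assms(1,2)]) (simp_all add: spd_on_def)
  ultimately show ?thesis unfolding spd_on_def by blast
qed

lemma det_on_pos:
  assumes "finite I" "spd_on I A"
  shows "det_on I A > 0"
  using assms
proof (induction I arbitrary: A)
  case (insert k I)
  have "A k k > 0" using spd_on_diag[OF _ _ insert.prems, of k] insert.hyps by auto
  then show ?case
    using insert.IH[OF spd_on_schur[OF insert.hyps insert.prems]] insert.hyps
    by (simp add: det_on_schur)
qed simp

section \<open>Inverses and Gaussian integrals\<close>

text \<open>One step of Gaussian elimination.\<close>

lemma schur_solution:
  assumes I: "finite I" "k \<notin> I" and nz: "A k k \<noteq> 0"
  shows "(\<forall>i\<in>insert k I. (\<Sum>j\<in>insert k I. A i j * x j) = b i) \<longleftrightarrow>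
    A k k * x k = b k - (\<Sum>j\<in>I. A k j * x j) \<and>
    (\<forall>i\<in>I. (\<Sum>j\<in>I. schur k A i j * x j) = b i - A i k * b k / A k k)" (is "?L \<longleftrightarrow> ?R")
proof -
  have "(\<Sum>j\<in>I. schur k A i j * x j) = (\<Sum>j\<in>I. A i j * x j) - A i k / A k k * (\<Sum>j\<in>I. A k j * x j)" for i
    by (simp add: schur_def algebra_simps sum_subtractf sum_distrib_left)
  note eq = this
  have *: "A k k * x k = b k - (\<Sum>j\<in>I. A k j * x j) \<Longrightarrow>
     ((\<Sum>j\<in>insert k I. A i j * x j) = b i) = ((\<Sum>j\<in>I. schur k A i j * x j) = b i - A i k * b k / A k k)" for i
  proof -
    assume z: "A k k * x k = b k - (\<Sum>j\<in>I. A k j * x j)"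
    have "(\<Sum>j\<in>I. schur k A i j * x j) = (\<Sum>j\<in>I. A i j * x j) - A i k / A k k * (b k - A k k * x k)"
      unfolding eq z by simp
    also have "\<dots> = (\<Sum>j\<in>insert k I. A i j * x j) - A i k * b k / A k k"
      using nz I by (simp add: field_simps)
    finally show ?thesis by auto
  qed
  show ?thesis using * I by (auto simp: algebra_simps)
qed

lemma spd_on_solvable:
  assumes "finite I" "spd_on I A"
  shows "\<exists>x. \<forall>i\<in>I. (\<Sum>j\<in>I. A i j * x j) = b i"
  using assms
proof (induction I arbitrary: A b)
  case (insert k I)
  have akk: "A k k > 0" using spd_on_diag[OF _ _ insert.prems, of k] insert.hyps by auto
  obtain x where x: "\<forall>i\<in>I. (\<Sum>j\<in>I. schur k A i j * x j) = b i - A i k * b k / A k k"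
    using insert.IH[OF spd_on_schur[OF insert.hyps insert.prems], where b="\<lambda>i. b i - A i k * b k / A k k"]
        by auto
  define y where "y = x(k := (b k - (\<Sum>j\<in>I. A k j * x j)) / A k k)"
  have yI: "\<And>i. i \<in> I \<Longrightarrow> y i = x i" using insert.hyps by (auto simp: y_def)
  have "\<forall>i\<in>insert k I. (\<Sum>j\<in>insert k I. A i j * y j) = b i"
    using x akk insert.hyps
    by (subst schur_solution) (auto simp: yI cong: sum.cong, auto simp: y_def)
  then show ?case by blast
qed simp

text \<open>Solvability gives a right inverse \<open>B\<close>. Since \<open>A\<close> is symmetric, \<open>B\<^sup>T = B\<^sup>T (A B) = (A B)\<^sup>T B = B\<close>, so
  \<open>B\<close> is symmetric and therefore also a left inverse. This makes \<open>inverse_on\<close> well defined.\<close>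

lemma inverse_on_spec:
  assumes I: "finite I" and A: "spd_on I A"
  shows "\<And>i j. i \<notin> I \<or> j \<notin> I \<Longrightarrow> inverse_on I A i j = 0"
    and "\<And>i j. i \<in> I \<Longrightarrow> j \<in> I \<Longrightarrow> (\<Sum>k\<in>I. A i k * inverse_on I A k j) = of_bool (i = j)"
    and "\<And>i j. i \<in> I \<Longrightarrow> j \<in> I \<Longrightarrow> (\<Sum>k\<in>I. inverse_on I A i k * A k j) = of_bool (i = j)"
    and "\<And>i j. inverse_on I A i j = inverse_on I A j i"
proof -
  have sym: "A i j = A j i" if "i \<in> I" "j \<in> I" for i j
    using A that unfolding spd_on_def by blast
  have "\<forall>j. \<exists>x. \<forall>i\<in>I. (\<Sum>k\<in>I. A i k * x k) = of_bool (i = j)"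
    by (intro allI spd_on_solvable[OF I A])
  then obtain C where C: "\<And>i j. i \<in> I \<Longrightarrow> (\<Sum>k\<in>I. A i k * C j k) = of_bool (i = j)"
    by metis
  define B where "B i j = (if i \<in> I \<and> j \<in> I then C j i else 0)" for i j
  have BR: "(\<Sum>k\<in>I. A i k * B k j) = of_bool (i = j)" if "i \<in> I" "j \<in> I" for i j
    using C[of i j] that by (simp add: B_def cong: sum.cong)
  have Bsym: "B i j = B j i" for i j
  proof (cases "i \<in> I \<and> j \<in> I")
    case True
    have "(\<Sum>k\<in>I. \<Sum>l\<in>I. B k i * A k l * B l j) = (\<Sum>k\<in>I. B k i * (\<Sum>l\<in>I. A k l * B l j))"
      by (simp add: sum_distrib_left mult.assoc)
    also have "\<dots> = B j i" using I True by (simp add: BR sum_of_bool_mult cong: sum.cong)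
    finally have 1: "(\<Sum>k\<in>I. \<Sum>l\<in>I. B k i * A k l * B l j) = B j i" .
    have "(\<Sum>k\<in>I. \<Sum>l\<in>I. B k i * A k l * B l j) = (\<Sum>l\<in>I. (\<Sum>k\<in>I. A l k * B k i) * B l j)"
      by (subst sum.swap) (auto simp: sum_distrib_right sum_distrib_left sym mult_ac intro!: sum.cong)
    also have "\<dots> = B i j" using I True by (simp add: BR sum_of_bool_mult cong: sum.cong)
    finally show ?thesis using 1 by simp
  qed (auto simp: B_def)
  have BL: "(\<Sum>k\<in>I. B i k * A k j) = of_bool (i = j)" if "i \<in> I" "j \<in> I" for i j
  proof -
    have "(\<Sum>k\<in>I. B i k * A k j) = (\<Sum>k\<in>I. A j k * B k i)"
      by (intro sum.cong refl) (metis Bsym mult.commute sym that(2))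
    then show ?thesis using BR[of j i] that by auto
  qed
  let ?P = "\<lambda>B. (\<forall>i j. i \<notin> I \<or> j \<notin> I \<longrightarrow> B i j = 0) \<and>
     (\<forall>i\<in>I. \<forall>j\<in>I. (\<Sum>k\<in>I. A i k * B k j) = of_bool (i = j) \<and>
                   (\<Sum>k\<in>I. B i k * A k j) = of_bool (i = j))"
  have PB: "?P B" using BR BL by (auto simp: B_def)
  have "inverse_on I A = B"
    unfolding inverse_on_def
  proof (rule the_equality)
    fix D assume D: "?P D"
    have "D i j = B i j" for i j
    proof (cases "i \<in> I \<and> j \<in> I")
      case True
      have "D i j = (\<Sum>k\<in>I. D i k * (\<Sum>l\<in>I. A k l * B l j))"
        using I True by (simp add: BR sum_of_bool_mult cong: sum.cong)
      also have "\<dots> = (\<Sum>l\<in>I. (\<Sum>k\<in>I. D i k * A k l) * B l j)"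
        unfolding sum_distrib_left sum_distrib_right by (subst sum.swap) (simp add: mult.assoc)
      also have "\<dots> = (\<Sum>l\<in>I. of_bool (i = l) * B l j)"
        using D True by (intro sum.cong refl) auto
      also have "\<dots> = B i j" using I True by (simp add: sum_of_bool_mult)
      finally show ?thesis .
    qed (use D in \<open>auto simp: B_def\<close>)
    then show "D = B" by (intro ext)
  qed (rule PB)
  then show "\<And>i j. i \<notin> I \<or> j \<notin> I \<Longrightarrow> inverse_on I A i j = 0"
    and "\<And>i j. i \<in> I \<Longrightarrow> j \<in> I \<Longrightarrow> (\<Sum>k\<in>I. A i k * inverse_on I A k j) = of_bool (i = j)"
    and "\<And>i j. i \<in> I \<Longrightarrow> j \<in> I \<Longrightarrow> (\<Sum>k\<in>I. inverse_on I A i k * A k j) = of_bool (i = j)"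
    and "\<And>i j. inverse_on I A i j = inverse_on I A j i"
    using PB Bsym by auto
qed

lemma inverse_on_solution:
  assumes I: "finite I" and A: "spd_on I A"
    and x: "\<And>i. i \<in> I \<Longrightarrow> (\<Sum>j\<in>I. A i j * x j) = b i" and i: "i \<in> I"
  shows "x i = (\<Sum>j\<in>I. inverse_on I A i j * b j)"
proof -
  have "(\<Sum>j\<in>I. inverse_on I A i j * b j) = (\<Sum>j\<in>I. \<Sum>l\<in>I. inverse_on I A i j * A j l * x l)"
    by (intro sum.cong refl) (simp add: x[symmetric] sum_distrib_left mult.assoc)
  also have "\<dots> = (\<Sum>l\<in>I. (\<Sum>j\<in>I. inverse_on I A i j * A j l) * x l)"
    by (subst sum.swap) (simp add: sum_distrib_right)
  also have "\<dots> = (\<Sum>l\<in>I. of_bool (i = l) * x l)"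
    using inverse_on_spec(3)[OF I A i] by (intro sum.cong refl) auto
  also have "\<dots> = x i" using I i by (simp add: sum_of_bool_mult)
  finally show ?thesis by simp
qed

lemma inverse_on_solves:
  assumes I: "finite I" and A: "spd_on I A" and i: "i \<in> I"
  shows "(\<Sum>j\<in>I. A i j * (\<Sum>l\<in>I. inverse_on I A j l * b l)) = b i"
proof -
  have "(\<Sum>j\<in>I. A i j * (\<Sum>l\<in>I. inverse_on I A j l * b l))
     = (\<Sum>l\<in>I. (\<Sum>j\<in>I. A i j * inverse_on I A j l) * b l)"
    unfolding sum_distrib_left sum_distrib_right by (subst sum.swap) (simp add: mult.assoc)
  also have "\<dots> = (\<Sum>l\<in>I. of_bool (i = l) * b l)"
    using inverse_on_spec(2)[OF I A i] by (intro sum.cong refl) auto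
  also have "\<dots> = b i" using I i by (simp add: sum_of_bool_mult)
  finally show ?thesis .
qed

lemma inverse_on_inverse_form:
  assumes I: "finite I" and A: "spd_on I A"
    and x: "\<And>i. i \<in> I \<Longrightarrow> (\<Sum>j\<in>I. A i j * x j) = b i"
  shows "(\<Sum>i\<in>I. \<Sum>j\<in>I. b i * inverse_on I A i j * b j) = (\<Sum>i\<in>I. b i * x i)"
proof (rule sum.cong[OF refl])
  fix i assume "i \<in> I"
  then show "(\<Sum>j\<in>I. b i * inverse_on I A i j * b j) = b i * x i"
    by (simp add: inverse_on_solution[OF I A x] sum_distrib_left mult.assoc)
qed

text \<open>The quadratic form of the inverse matrix.\<close>

definition inverse_form :: "'a set \<Rightarrow> ('a \<Rightarrow> 'a \<Rightarrow> real) \<Rightarrow> ('a \<Rightarrow> real) \<Rightarrow> real" where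
  "inverse_form I A b = (\<Sum>i\<in>I. \<Sum>j\<in>I. b i * inverse_on I A i j * b j)"

lemma inverse_on_schur:
  fixes b :: "'a \<Rightarrow> real"
  assumes I: "finite I" "k \<notin> I" and A: "spd_on (insert k I) A"
  defines "x \<equiv> \<lambda>i. \<Sum>j\<in>insert k I. inverse_on (insert k I) A i j * b j"
  shows "A k k * x k = b k - (\<Sum>j\<in>I. A k j * x j)"
    and "\<And>i. i \<in> I \<Longrightarrow> (\<Sum>j\<in>I. schur k A i j * x j) = b i - A i k * b k / A k k"
    and "\<And>i. i \<in> I \<Longrightarrow> x i = (\<Sum>j\<in>I. inverse_on I (schur k A) i j * (b j - A j k * b k / A k k))"
proof -
  have akk: "A k k > 0" using spd_on_diag[OF _ _ A, of k] I by auto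
  have "\<forall>i\<in>insert k I. (\<Sum>j\<in>insert k I. A i j * x j) = b i"
    unfolding x_def using inverse_on_solves[OF _ A] I by blast
  then have *: "A k k * x k = b k - (\<Sum>j\<in>I. A k j * x j) \<and>
    (\<forall>i\<in>I. (\<Sum>j\<in>I. schur k A i j * x j) = b i - A i k * b k / A k k)"
    using schur_solution[OF I, of A x b] akk by simp
  then show "A k k * x k = b k - (\<Sum>j\<in>I. A k j * x j)"
    and 1: "\<And>i. i \<in> I \<Longrightarrow> (\<Sum>j\<in>I. schur k A i j * x j) = b i - A i k * b k / A k k"
    by auto
  show "\<And>i. i \<in> I \<Longrightarrow> x i = (\<Sum>j\<in>I. inverse_on I (schur k A) i j * (b j - A j k * b k / A k k))"
    by (rule inverse_on_solution[OF I(1) spd_on_schur[OF I A] 1])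
qed

lemma inverse_form_insert:
  assumes I: "finite I" "k \<notin> I" and A: "spd_on (insert k I) A"
  shows "inverse_form (insert k I) A b
    = (b k)\<^sup>2 / A k k + inverse_form I (schur k A) (\<lambda>i. b i - A i k * b k / A k k)"
proof -
  define x where "x i = (\<Sum>j\<in>insert k I. inverse_on (insert k I) A i j * b j)" for i
  note x = inverse_on_schur[OF I A, where b=b, folded x_def]
  have akk: "A k k > 0" using spd_on_diag[OF _ _ A, of k] I by auto
  have "A i k = A k i" if "i \<in> I" for i
    using A that unfolding spd_on_def by blast
  then have s: "(\<Sum>i\<in>I. A i k * x i) = (\<Sum>i\<in>I. A k i * x i)" by simp
  have "inverse_form (insert k I) A b = (\<Sum>i\<in>insert k I. b i * x i)"
    unfolding inverse_form_def
    by (rule inverse_on_inverse_form[OF _ A]) (use I inverse_on_solves[OF _ A] in \<open>auto simp: x_def\<close>)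
  also have "\<dots> = b k * x k + (\<Sum>i\<in>I. b i * x i)" using I by simp
  also have "x k = (b k - (\<Sum>j\<in>I. A k j * x j)) / A k k"
    using x(1) akk by (simp add: field_simps)
  also have "b k * \<dots> + (\<Sum>i\<in>I. b i * x i)
      = (b k)\<^sup>2 / A k k + ((\<Sum>i\<in>I. b i * x i) - b k / A k k * (\<Sum>i\<in>I. A i k * x i))"
    unfolding s using akk by (simp add: field_simps power2_eq_square)
  also have "(\<Sum>i\<in>I. b i * x i) - b k / A k k * (\<Sum>i\<in>I. A i k * x i)
      = (\<Sum>i\<in>I. (b i - A i k * b k / A k k) * x i)"
    unfolding sum_distrib_left sum_subtractf[symmetric]
    by (intro sum.cong refl) (simp add: algebra_simps)
  also have "(\<Sum>i\<in>I. (b i - A i k * b k / A k k) * x i) = inverse_form I (schur k A) (\<lambda>i. b i - A i k * b k /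
      A k k)"
    unfolding inverse_form_def by (rule inverse_on_inverse_form[OF I(1) spd_on_schur[OF I A] x(2), symmetric])
  finally show ?thesis .
qed

text \<open>The definite description in \<open>inverse_on\<close> says nothing about measurability; eliminating one index at
  a time expresses the solution of a linear system by arithmetic operations on its coefficients.\<close>

lemma borel_measurable_inverse_on_apply:
  assumes "finite I"
    and "\<And>\<omega>. \<omega> \<in> space N \<Longrightarrow> spd_on I (A \<omega>)"
    and "\<And>i j. i \<in> I \<Longrightarrow> j \<in> I \<Longrightarrow> (\<lambda>\<omega>. A \<omega> i j) \<in> borel_measurable N"
    and "\<And>i. i \<in> I \<Longrightarrow> (\<lambda>\<omega>. b \<omega> i) \<in> borel_measurable N"
    and "i \<in> I"
  shows "(\<lambda>\<omega>. \<Sum>j\<in>I. inverse_on I (A \<omega>) i j * b \<omega> j) \<in> borel_measurable N"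
  using assms
proof (induction I arbitrary: A b i)
  case (insert k I)
  define x where "x \<omega> i = (\<Sum>j\<in>insert k I. inverse_on (insert k I) (A \<omega>) i j * b \<omega> j)" for \<omega> i
  note spd = insert.prems(1)
  note [measurable] = insert.prems(2,3)
  have xI: "(\<lambda>\<omega>. x \<omega> i) \<in> borel_measurable N" if i: "i \<in> I" for i
  proof -
    have "(\<lambda>\<omega>. \<Sum>j\<in>I. inverse_on I (schur k (A \<omega>)) i j * (b \<omega> j - A \<omega> j k * b \<omega> k / A \<omega> k k))
       \<in> borel_measurable N"
    proof (rule insert.IH[OF _ _ _ i])
      fix i j assume [simp]: "i \<in> I" "j \<in> I"
      show "(\<lambda>\<omega>. schur k (A \<omega>) i j) \<in> borel_measurable N" unfolding schur_def by measurable
      show "(\<lambda>\<omega>. b \<omega> i - A \<omega> i k * b \<omega> k / A \<omega> k k) \<in> borel_measurable N" by measurable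
    qed (use spd_on_schur[OF insert.hyps] spd in auto)
    then show ?thesis
      by (rule measurable_cong[THEN iffD2, rotated])
        (simp add: x_def, rule inverse_on_schur(3)[OF insert.hyps spd i, simplified], assumption)
  qed
  have "(\<lambda>\<omega>. (b \<omega> k - (\<Sum>j\<in>I. A \<omega> k j * x \<omega> j)) / A \<omega> k k) \<in> borel_measurable N"
    using xI by measurable
  then have xk: "(\<lambda>\<omega>. x \<omega> k) \<in> borel_measurable N"
  proof (rule measurable_cong[THEN iffD2, rotated])
    fix \<omega> assume w: "\<omega> \<in> space N"
    have "A \<omega> k k > 0" using spd_on_diag[OF _ _ spd[OF w], of k] insert.hyps by auto
    then show "x \<omega> k = (b \<omega> k - (\<Sum>j\<in>I. A \<omega> k j * x \<omega> j)) / A \<omega> k k"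
      using inverse_on_schur(1)[OF insert.hyps spd[OF w], where b="b \<omega>"] unfolding x_def
      by (simp add: field_simps)
  qed
  show ?case using insert.prems(4) xI xk unfolding x_def by auto
qed simp

lemma borel_measurable_inverse_on:
  assumes "finite I"
    and spd: "\<And>\<omega>. \<omega> \<in> space N \<Longrightarrow> spd_on I (A \<omega>)"
    and "\<And>i j. i \<in> I \<Longrightarrow> j \<in> I \<Longrightarrow> (\<lambda>\<omega>. A \<omega> i j) \<in> borel_measurable N"
  shows "(\<lambda>\<omega>. inverse_on I (A \<omega>) i j) \<in> borel_measurable N"
proof (cases "i \<in> I \<and> j \<in> I")
  case True
  have "(\<lambda>\<omega>. \<Sum>l\<in>I. inverse_on I (A \<omega>) i l * of_bool (l = j)) \<in> borel_measurable N"
    by (rule borel_measurable_inverse_on_apply[OF assms]) (use True in auto)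
  then show ?thesis using assms(1) True by (simp add: sum_of_bool_mult)
next
  case False
  then have "inverse_on I (A \<omega>) i j = 0" if "\<omega> \<in> space N" for \<omega>
    using inverse_on_spec(1)[OF assms(1) spd[OF that]] by auto
  then show ?thesis by (rule measurable_cong[THEN iffD2]) simp_all
qed

lemma borel_measurable_det_on:
  assumes "\<And>i j. i \<in> I \<Longrightarrow> j \<in> I \<Longrightarrow> (\<lambda>\<omega>. A \<omega> i j) \<in> borel_measurable N"
  shows "(\<lambda>\<omega>. det_on I (A \<omega>)) \<in> borel_measurable N"
proof -
  have "(\<lambda>\<omega>. \<Prod>i\<in>I. A \<omega> i (p i)) \<in> borel_measurable N" if "p permutes I" for p
    using that by (intro borel_measurable_prod assms) (simp_all add: permutes_in_image)
  then show ?thesis unfolding det_on_def by measurable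
qed

lemma nn_integral_gaussian:
  assumes a: "a > 0"
  shows "(\<integral>\<^sup>+s. ennreal (exp (- (a * s + c)\<^sup>2 / (2 * a))) \<partial>lborel) = ennreal (sqrt (2 * pi) / sqrt a)"
proof -
  have "(\<integral>\<^sup>+s. ennreal (normal_density (- c / a) (1 / sqrt a) s) \<partial>lborel) = 1"
    using prob_space.emeasure_space_1[OF prob_space_normal_density[of "1 / sqrt a" "- c / a"]] a
    by (simp add: emeasure_density)
  moreover have "normal_density (- c / a) (1 / sqrt a) s
     = sqrt a / sqrt (2 * pi) * exp (- (a * s + c)\<^sup>2 / (2 * a))" for s
    using a by (simp add: normal_density_def real_sqrt_divide real_sqrt_mult power_divide)
      (simp add: field_simps power2_eq_square)
  ultimately have "ennreal (sqrt a / sqrt (2 * pi)) * (\<integral>\<^sup>+s. ennreal (exp (- (a * s + c)\<^sup>2 / (2 * a)))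
      \<partial>lborel) = 1"
    using a by (subst nn_integral_cmult[symmetric]) (auto simp: ennreal_mult'[symmetric])
  then have "ennreal (sqrt (2 * pi) / sqrt a) * (ennreal (sqrt a / sqrt (2 * pi)) * (\<integral>\<^sup>+s. ennreal (exp (-
      (a * s + c)\<^sup>2 / (2 * a))) \<partial>lborel))
     = ennreal (sqrt (2 * pi) / sqrt a)" by simp
  moreover have "ennreal (sqrt (2 * pi) / sqrt a) * ennreal (sqrt a / sqrt (2 * pi)) = 1"
    using a by (subst ennreal_mult'[symmetric]) auto
  ultimately show ?thesis by (simp add: mult.assoc[symmetric])
qed

abbreviation field_space :: "'a set \<Rightarrow> ('a \<Rightarrow> real) measure" where
  "field_space V \<equiv> Pi\<^sub>M V (\<lambda>_. lborel)"

text \<open>Eliminating one variable completes the square, so the Gaussian integral satisfies the same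
  recursion along Schur complements as the determinant.\<close>

lemma nn_integral_gaussian_PiM:
  assumes "finite I" "spd_on I A"
  shows "(\<integral>\<^sup>+s. ennreal (exp (- 1/2 * (\<Sum>i\<in>I. \<Sum>j\<in>I. s i * A i j * s j))) \<partial>field_space I)
    = ennreal (sqrt (2 * pi) ^ card I / sqrt (det_on I A))"
  using assms
proof (induction I arbitrary: A)
  case empty
  interpret product_sigma_finite "\<lambda>_::'a. lborel :: real measure" ..
  show ?case by (simp add: nn_integral_empty del: nn_integral_const)
next
  case (insert k I)
  interpret product_sigma_finite "\<lambda>_::'a. lborel :: real measure" ..
  have akk: "A k k > 0" using spd_on_diag[OF _ _ insert.prems, of k] insert.hyps by auto
  have sym: "A i k = A k i" if "i \<in> I" for i
    using insert.prems that unfolding spd_on_def by blast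
  have det: "det_on I (schur k A) > 0"
    using det_on_pos[OF insert.hyps(1) spd_on_schur[OF insert.hyps insert.prems]] .
  have "(\<integral>\<^sup>+s. ennreal (exp (- 1/2 * (\<Sum>i\<in>insert k I. \<Sum>j\<in>insert k I. s i * A i j * s j))) \<partial>field_space
      (insert k I))
    = (\<integral>\<^sup>+s. (\<integral>\<^sup>+r. ennreal (exp (- 1/2 * (\<Sum>i\<in>I. \<Sum>j\<in>I. s i * schur k A i j * s j))) *
           ennreal (exp (- (A k k * r + (\<Sum>j\<in>I. A k j * s j))\<^sup>2 / (2 * A k k))) \<partial>lborel) \<partial>field_space I)"
  proof (subst product_nn_integral_insert[OF insert.hyps], measurable, intro nn_integral_cong)
    fix s :: "'a \<Rightarrow> real" and r :: real
    let ?t = "s(k := r)"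
    have tI: "\<And>j. j \<in> I \<Longrightarrow> ?t j = s j" using insert.hyps by auto
    have "(\<Sum>i\<in>insert k I. \<Sum>j\<in>insert k I. ?t i * A i j * ?t j)
       = (\<Sum>i\<in>I. \<Sum>j\<in>I. ?t i * schur k A i j * ?t j) + (A k k * r + (\<Sum>j\<in>I. A k j * s j))\<^sup>2 / A k k"
    proof (rule schur_quadratic_form[OF insert.hyps])
      have "(\<Sum>j\<in>I. A k j * ?t j) = (\<Sum>j\<in>I. A k j * s j)" using tI by (intro sum.cong refl) simp
      then show "A k k * ?t k + (\<Sum>j\<in>I. A k j * ?t j) = A k k * r + (\<Sum>j\<in>I. A k j * s j)" by simp
    qed (use akk sym in auto)
    also have "(\<Sum>i\<in>I. \<Sum>j\<in>I. ?t i * schur k A i j * ?t j) = (\<Sum>i\<in>I. \<Sum>j\<in>I. s i * schur k A i j * s j)"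
      using tI by (intro sum.cong refl) simp
    finally have eq: "(\<Sum>i\<in>insert k I. \<Sum>j\<in>insert k I. ?t i * A i j * ?t j) = \<dots> + (A k k * r + (\<Sum>j\<in>I. A k j *
        s j))\<^sup>2 / A k k" .
    show "ennreal (exp (- 1/2 * (\<Sum>i\<in>insert k I. \<Sum>j\<in>insert k I. ?t i * A i j * ?t j)))
      = ennreal (exp (- 1/2 * (\<Sum>i\<in>I. \<Sum>j\<in>I. s i * schur k A i j * s j))) *
           ennreal (exp (- (A k k * r + (\<Sum>j\<in>I. A k j * s j))\<^sup>2 / (2 * A k k)))"
      unfolding eq by (subst ennreal_mult'[symmetric]) (simp_all add: exp_add[symmetric] field_simps)
  qed
  also have "\<dots> = (\<integral>\<^sup>+s. ennreal (exp (- 1/2 * (\<Sum>i\<in>I. \<Sum>j\<in>I. s i * schur k A i j * s j))) \<partial>field_space I)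
       * ennreal (sqrt (2 * pi) / sqrt (A k k))"
    by (subst nn_integral_cmult, measurable, subst nn_integral_gaussian[OF akk], subst nn_integral_multc)
        measurable
  also have "\<dots> = ennreal (sqrt (2 * pi) ^ card I / sqrt (det_on I (schur k A)) * (sqrt (2 * pi) / sqrt (A k
      k)))"
    using akk det by (subst insert.IH[OF spd_on_schur[OF insert.hyps insert.prems]]) (simp add:
        ennreal_mult'[symmetric])
  also have "\<dots> = ennreal (sqrt (2 * pi) ^ card (insert k I) / sqrt (det_on (insert k I) A))"
    using akk insert.hyps by (simp add: det_on_schur real_sqrt_mult mult_ac)
  finally show ?case .
qed

section \<open>The inverse Gaussian integral\<close>

text \<open>The image under \<open>g\<close> of the measure \<open>g' x dx\<close> on the half-line gives every interval its length.\<close>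

lemma nn_integral_substitution_halfline:
  fixes g g' :: "real \<Rightarrow> real"
  assumes deriv: "\<And>x. x > 0 \<Longrightarrow> (g has_real_derivative g' x) (at x)"
    and pos: "\<And>x. x > 0 \<Longrightarrow> g' x > 0"
    and surj: "\<And>y. \<exists>x>0. g x = y"
    and [measurable]: "g \<in> borel_measurable borel" "g' \<in> borel_measurable borel"
      "f \<in> borel_measurable borel"
  shows "(\<integral>\<^sup>+y. f y \<partial>lborel) = (\<integral>\<^sup>+x. indicator {0<..} x * (ennreal (g' x) * f (g x)) \<partial>lborel)"
proof -
  define N where "N = distr (density lborel (\<lambda>x. ennreal (g' x) * indicator {0<..} x)) borel g"
  have mono: "g x < g y" if "0 < x" "x < y" for x y
    using that by (intro DERIV_pos_imp_increasing[OF that(2)]) (meson deriv pos less_le_trans)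
  have less: "g x < g y \<longleftrightarrow> x < y" if "0 < x" "0 < y" for x y
    using mono[of x y] mono[of y x] that by (cases x y rule: linorder_cases) auto
  have "lborel = N"
  proof (rule lborel_eqI)
    fix l u :: real assume "\<And>b. b \<in> Basis \<Longrightarrow> l \<bullet> b \<le> u \<bullet> b"
    then have lu: "l \<le> u" by simp
    obtain a where a: "a > 0" "g a = l" using surj by blast
    obtain b where b: "b > 0" "g b = u" using surj by blast
    have ab: "a \<le> b" using less[of b a] a b lu by force
    have [measurable]: "g -` {l<..<u} \<in> sets borel"
      using measurable_sets_borel[of g borel "{l<..<u}"] by simp
    have "emeasure N (box l u) = (\<integral>\<^sup>+x. ennreal (g' x) * indicator {0<..} x * indicator (g -` {l<..<u}) x
        \<partial>lborel)"
      unfolding N_def by (subst emeasure_distr) (simp_all add: box_real emeasure_density)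
    also have "\<dots> = (\<integral>\<^sup>+x. ennreal (g' x) * indicator {a..b} x \<partial>lborel)"
    proof (rule nn_integral_cong_AE)
      have "AE x in lborel. x \<noteq> a" "AE x in lborel. x \<noteq> b" by (rule AE_lborel_singleton)+
      then show "AE x in lborel. ennreal (g' x) * indicator {0<..} x * indicator (g -` {l<..<u}) x
          = ennreal (g' x) * indicator {a..b} x"
      proof eventually_elim
        case (elim x)
        have "0 < x \<and> l < g x \<and> g x < u \<longleftrightarrow> a \<le> x \<and> x \<le> b"
          using elim less[of a x] less[of x b] a b by (cases "x > 0") auto
        then show ?case by (auto simp: indicator_def)
      qed
    qed
    also have "\<dots> = ennreal (g b - g a)"
    proof (rule nn_integral_FTC_Icc)
      fix x assume "x \<in> {a..b}"
      then have x: "x > 0" using a by simp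
      show "(g has_real_derivative g' x) (at x)" by (rule deriv[OF x])
      show "0 \<le> g' x" using pos[OF x] by simp
    qed (use ab in simp_all)
    finally show "emeasure N (box l u) = (\<Prod>b\<in>Basis. (u - l) \<bullet> b)" using a b by simp
  qed (simp add: N_def)
  then have "(\<integral>\<^sup>+y. f y \<partial>lborel) = (\<integral>\<^sup>+y. f y \<partial>N)" by simp
  also have "\<dots> = (\<integral>\<^sup>+x. ennreal (g' x) * indicator {0<..} x * f (g x) \<partial>lborel)"
    unfolding N_def by (simp add: nn_integral_distr nn_integral_density)
  finally show ?thesis by (simp add: mult_ac)
qed

lemma nn_integral_reflect:
  fixes f :: "real \<Rightarrow> ennreal"
  assumes [measurable]: "f \<in> borel_measurable borel"
  shows "(\<integral>\<^sup>+y. f (- y) \<partial>lborel) = (\<integral>\<^sup>+y. f y \<partial>lborel)"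
  using nn_integral_real_affine[of f "-1" 0] by simp

lemma nn_integral_log_substitution:
  fixes f :: "real \<Rightarrow> ennreal"
  assumes [measurable]: "f \<in> borel_measurable borel" and S: "S > 0"
  shows "(\<integral>\<^sup>+y. f y \<partial>lborel) = (\<integral>\<^sup>+h. indicator {0<..} h * (ennreal (1 / h) * f (ln (S / h))) \<partial>lborel)"
proof -
  have "(\<integral>\<^sup>+y. f y \<partial>lborel) = (\<integral>\<^sup>+y. f (- y) \<partial>lborel)" by (simp add: nn_integral_reflect)
  also have "\<dots> = (\<integral>\<^sup>+h. indicator {0<..} h * (ennreal (1 / h) * f (- (ln h - ln S))) \<partial>lborel)"
  proof (rule nn_integral_substitution_halfline)
    show "\<exists>x>0. ln x - ln S = y" for y by (intro exI[of _ "exp (y + ln S)"]) simp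
    show "((\<lambda>h. ln h - ln S) has_real_derivative 1 / h) (at h)" if "h > 0" for h
      using that by (auto intro!: derivative_eq_intros)
  qed (use S in auto)
  also have "\<dots> = (\<integral>\<^sup>+h. indicator {0<..} h * (ennreal (1 / h) * f (ln (S / h))) \<partial>lborel)"
    using S by (intro nn_integral_cong) (auto simp: ln_div indicator_def)
  finally show ?thesis .
qed

text \<open>The law of the reciprocal of an inverse Gaussian variable with mean \<open>1/t\<close> and shape parameter 1.\<close>

definition ig_density :: "real \<Rightarrow> real \<Rightarrow> real" where
  "ig_density t h = exp (- (h - t)\<^sup>2 / (2 * h)) / sqrt (2 * pi * h)"

lemma borel_measurable_ig_density [measurable]: "ig_density t \<in> borel_measurable borel"
  unfolding ig_density_def by measurable

text \<open>For \<open>y = sqrt h - t / sqrt h\<close> the exponent is \<open>- y\<^sup>2 / 2\<close>, and the change of variables turns the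
  density into the standard normal one times \<open>1 + y / sqrt (y\<^sup>2 + 4 t)\<close>; the odd part integrates to
  \<open>0\<close>.\<close>

lemma nn_integral_ig_density:
  assumes t: "t > 0"
  shows "(\<integral>\<^sup>+h. indicator {0<..} h * ennreal (ig_density t h) \<partial>lborel) = 1"
proof -
  define f where "f y = std_normal_density y * (1 + y / sqrt (y\<^sup>2 + 4 * t))" for y :: real
  have [measurable]: "f \<in> borel_measurable borel" unfolding f_def by measurable
  have f_nonneg: "f y \<ge> 0" for y
  proof -
    have "\<bar>y\<bar> \<le> sqrt (y\<^sup>2 + 4 * t)" using t by (intro real_le_rsqrt) simp
    then have "\<bar>y / sqrt (y\<^sup>2 + 4 * t)\<bar> \<le> 1" using t add_nonneg_pos[of "y\<^sup>2" "4 * t"] by (simp add: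
        divide_le_eq_1)
    then have "- 1 \<le> y / sqrt (y\<^sup>2 + 4 * t)" by linarith
    then show ?thesis by (simp add: f_def)
  qed
  let ?J = "\<integral>\<^sup>+y. ennreal (f y) \<partial>lborel"
  have "?J = (\<integral>\<^sup>+h. indicator {0<..} h *
      (ennreal ((1 / sqrt h + t / (h * sqrt h)) / 2) * ennreal (f (sqrt h - t / sqrt h))) \<partial>lborel)"
  proof (rule nn_integral_substitution_halfline)
    fix h :: real assume h: "h > 0"
    show "((\<lambda>h. sqrt h - t / sqrt h) has_real_derivative (1 / sqrt h + t / (h * sqrt h)) / 2) (at h)"
      using h by (auto intro!: derivative_eq_intros simp: field_simps)
    show "(1 / sqrt h + t / (h * sqrt h)) / 2 > 0" using h t by (simp add: add_pos_pos)
  next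
    fix y :: real
    \<comment> \<open>The positive root of \<open>r - t / r = y\<close>, so that \<open>h = r\<^sup>2\<close>.\<close>
    let ?r = "(y + sqrt (y\<^sup>2 + 4 * t)) / 2"
    have "\<bar>y\<bar> < sqrt (y\<^sup>2 + 4 * t)" using t by (intro real_less_rsqrt) simp
    then have "- y < sqrt (y\<^sup>2 + 4 * t)" by (rule le_less_trans[OF abs_ge_minus_self])
    then have r: "?r > 0" by simp
    have "?r\<^sup>2 - t = y * ?r" using t by (simp add: power2_eq_square field_simps)
    then have "?r - t / ?r = y" using r by (simp add: field_simps power2_eq_square)
    then show "\<exists>h>0. sqrt h - t / sqrt h = y"
      using r by (intro exI[of _ "?r\<^sup>2"]) (simp add: real_sqrt_abs)
  qed measurable
  also have "\<dots> = (\<integral>\<^sup>+h. indicator {0<..} h * ennreal (ig_density t h) \<partial>lborel)"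
  proof (rule nn_integral_cong)
    fix h :: real
    show "indicator {0<..} h * (ennreal ((1 / sqrt h + t / (h * sqrt h)) / 2) * ennreal (f (sqrt h - t /
        sqrt h)))
       = indicator {0<..} h * ennreal (ig_density t h)"
    proof (cases "h > 0")
      case True
      define r where "r = sqrt h"
      have r: "r > 0" and h: "h = r\<^sup>2" using True by (auto simp: r_def)
      have "(r - t / r)\<^sup>2 + 4 * t = (r + t / r)\<^sup>2"
        using r by (simp add: power2_eq_square field_simps)
      then have s: "sqrt ((r - t / r)\<^sup>2 + 4 * t) = r + t / r"
        using r t by (simp add: real_sqrt_abs)
      have e: "(r - t / r)\<^sup>2 = (h - t)\<^sup>2 / h"
        using r unfolding h by (simp add: power2_eq_square field_simps)
      have q: "1 + (r - t / r) / (r + t / r) = 2 * r\<^sup>2 / (r\<^sup>2 + t)"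
      proof -
        have p: "r\<^sup>2 + t \<noteq> 0" using add_pos_pos[of "r\<^sup>2" t] r t by simp
        have d: "r - t / r = (r\<^sup>2 - t) / r" "r + t / r = (r\<^sup>2 + t) / r"
          using r by (simp_all add: field_simps power2_eq_square)
        have "(r - t / r) / (r + t / r) = (r\<^sup>2 - t) / (r\<^sup>2 + t)"
          unfolding d using r by (simp only: divide_divide_eq_left divide_divide_eq_right) simp
        moreover have "1 = (r\<^sup>2 + t) / (r\<^sup>2 + t)" using p by simp
        ultimately have "1 + (r - t / r) / (r + t / r) = ((r\<^sup>2 + t) + (r\<^sup>2 - t)) / (r\<^sup>2 + t)"
          by (metis add_divide_distrib)
        then show ?thesis by simp
      qed
      have "(1 / r + t / (h * r)) / 2 * (1 + (r - t / r) / (r + t / r)) = 1 / r"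
      proof -
        have "r\<^sup>2 + t > 0" using r t by (simp add: add_pos_pos)
        moreover have "(1 / r + t / (h * r)) / 2 = (r\<^sup>2 + t) / (2 * r ^ 3)"
          using r unfolding h by (simp add: field_simps power2_eq_square power3_eq_cube)
        moreover have "P / (2 * r ^ 3) * (2 * r\<^sup>2 / P) = 1 / r" if "P > 0" for P :: real
          using that r by (simp add: power2_eq_square power3_eq_cube)
        ultimately show ?thesis unfolding q by metis
      qed
      then have "(1 / r + t / (h * r)) / 2 * f (r - t / r) = std_normal_density (r - t / r) * (1 / r)"
        unfolding f_def s by (simp add: mult_ac)
      also have "\<dots> = ig_density t h"
        unfolding std_normal_density_def ig_density_def e using r h
        by (simp add: real_sqrt_mult real_sqrt_abs)
      finally have "(1 / sqrt h + t / (h * sqrt h)) / 2 * f (sqrt h - t / sqrt h) = ig_density t h"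
        by (simp add: r_def)
      moreover have "(1 / sqrt h + t / (h * sqrt h)) / 2 \<ge> 0" using True t by simp
      ultimately show ?thesis by (simp add: ennreal_mult'[symmetric])
    qed simp
  qed
  finally have J: "?J = (\<integral>\<^sup>+h. indicator {0<..} h * ennreal (ig_density t h) \<partial>lborel)" .
  \<comment> \<open>Adding the reflected integrand cancels the odd part.\<close>
  have "?J + ?J = ?J + (\<integral>\<^sup>+y. ennreal (f (- y)) \<partial>lborel)"
    using nn_integral_reflect[of "\<lambda>y. ennreal (f y)"] by simp
  also have "\<dots> = (\<integral>\<^sup>+y. 2 * ennreal (std_normal_density y) \<partial>lborel)"
  proof (subst nn_integral_add[symmetric], measurable, intro nn_integral_cong)
    fix y :: real
    have "std_normal_density (- y) = std_normal_density y" by (simp add: std_normal_density_def)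
    then have "f y + f (- y) = 2 * std_normal_density y" by (simp add: f_def algebra_simps)
    then have "ennreal (f y) + ennreal (f (- y)) = ennreal (2 * std_normal_density y)"
      by (metis ennreal_plus f_nonneg)
    then show "ennreal (f y) + ennreal (f (- y)) = 2 * ennreal (std_normal_density y)"
      by (simp add: ennreal_mult')
  qed
  also have "\<dots> = 2 * (\<integral>\<^sup>+y. ennreal (std_normal_density y) \<partial>lborel)"
    by (rule nn_integral_cmult) simp
  also have "(\<integral>\<^sup>+y. ennreal (std_normal_density y) \<partial>lborel) = 1"
    using prob_space.emeasure_space_1[OF prob_space_normal_density[of 1 0]]
    by (simp add: emeasure_density)
  finally have JJ: "?J + ?J = 2" by simp
  show ?thesis
  proof (cases ?J)
    case (real j)
    with JJ have "ennreal (j + j) = ennreal 2" by (subst ennreal_plus) auto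
    then have "j + j = 2" using real by (subst (asm) ennreal_inj) auto
    then show ?thesis using J real by simp
  next
    case top
    then show ?thesis using JJ by simp
  qed
qed

section \<open>Grounded networks and elimination of a vertex\<close>

lemma inverse_on_cong:
  assumes "\<And>i j. i \<in> I \<Longrightarrow> j \<in> I \<Longrightarrow> A i j = B i j"
  shows "inverse_on I A = inverse_on I B"
proof -
  have "(\<Sum>k\<in>I. A i k * C k j) = (\<Sum>k\<in>I. B i k * C k j)" "(\<Sum>k\<in>I. C i k * A k j) = (\<Sum>k\<in>I. C i k * B k j)"
    if "i \<in> I" "j \<in> I" for i j and C :: "'a \<Rightarrow> 'a \<Rightarrow> real"
    using assms that by (auto intro!: sum.cong)
  then show ?thesis unfolding inverse_on_def by (simp cong: ball_cong)
qed

lemma inverse_form_cong: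
  assumes "\<And>i j. i \<in> I \<Longrightarrow> j \<in> I \<Longrightarrow> A i j = B i j" "\<And>i. i \<in> I \<Longrightarrow> b i = c i"
  shows "inverse_form I A b = inverse_form I B c"
proof -
  have "inverse_on I A = inverse_on I B" by (rule inverse_on_cong) (rule assms(1))
  then show ?thesis using assms(2) by (simp add: inverse_form_def)
qed

text \<open>Every nonempty set of vertices has an edge leaving it, to another vertex or to the reference vertex.
  For a finite network this says that all vertices are connected to the reference vertex. In this form
  the property passes to a network with one vertex eliminated, and it is what positive definiteness
  uses.\<close>

definition grounded :: "'a set \<Rightarrow> ('a \<Rightarrow> 'a \<Rightarrow> real) \<Rightarrow> ('a \<Rightarrow> real) \<Rightarrow> bool" where
  "grounded V W \<eta> \<longleftrightarrow>
     (\<forall>S\<subseteq>V. S \<noteq> {} \<longrightarrow> (\<exists>i\<in>S. \<eta> i > 0 \<or> (\<exists>j\<in>V - S. W i j > 0)))"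

text \<open>The number \<open>\<eta> i\<close> is the weight between \<open>i\<close> and the reference vertex, which does not belong to \<open>V\<close>.
  Loops \<open>W i i\<close> are allowed: elimination of a vertex creates them, and if they are counted in \<open>\<beta> i\<close>,
  then \<open>\<beta> i\<close> does not change when another vertex is eliminated.\<close>

definition network :: "'a set \<Rightarrow> ('a \<Rightarrow> 'a \<Rightarrow> real) \<Rightarrow> ('a \<Rightarrow> real) \<Rightarrow> bool" where
  "network V W \<eta> \<longleftrightarrow> finite V \<and> (\<forall>i\<in>V. \<forall>j\<in>V. W i j = W j i) \<and>
     (\<forall>i\<in>V. \<forall>j\<in>V. W i j \<ge> 0) \<and> (\<forall>i\<in>V. \<eta> i \<ge> 0) \<and> grounded V W \<eta>"

lemma networkD:
  assumes "network V W \<eta>"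
  shows "finite V" "\<And>i j. i \<in> V \<Longrightarrow> j \<in> V \<Longrightarrow> W i j = W j i"
    "\<And>i j. i \<in> V \<Longrightarrow> j \<in> V \<Longrightarrow> W i j \<ge> 0" "\<And>i. i \<in> V \<Longrightarrow> \<eta> i \<ge> 0"
    "\<And>S. S \<subseteq> V \<Longrightarrow> S \<noteq> {} \<Longrightarrow> \<exists>i\<in>S. \<eta> i > 0 \<or> (\<exists>j\<in>V - S. W i j > 0)"
  using assms unfolding network_def grounded_def by blast+

lemma network_mono_pinning:
  assumes "network V W \<eta>" "\<And>i. i \<in> V \<Longrightarrow> \<theta> i \<ge> 0"
  shows "network V W (\<lambda>i. \<eta> i + \<theta> i)"
proof -
  have "grounded V W (\<lambda>i. \<eta> i + \<theta> i)"
    unfolding grounded_def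
  proof (intro allI impI)
    fix S assume S: "S \<subseteq> V" "S \<noteq> {}"
    then obtain i where i: "i \<in> S" "\<eta> i > 0 \<or> (\<exists>j\<in>V - S. W i j > 0)"
      using networkD(5)[OF assms(1)] by blast
    then have "\<eta> i + \<theta> i > 0 \<or> (\<exists>j\<in>V - S. W i j > 0)"
      using assms(2)[of i] S by (auto intro: add_pos_nonneg)
    then show "\<exists>i\<in>S. \<eta> i + \<theta> i > 0 \<or> (\<exists>j\<in>V - S. W i j > 0)" using i by blast
  qed
  then show ?thesis using assms unfolding network_def by auto
qed

text \<open>Star-mesh transformation at the vertex \<open>k\<close>, with \<open>h\<close> in the place of the diagonal entry \<open>H k k\<close>: the
  Schur complement of \<open>H = 2\<beta> - W\<close> has the off-diagonal entries \<open>- elim_weight W k h i j\<close>.\<close>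

definition elim_weight :: "('a \<Rightarrow> 'a \<Rightarrow> real) \<Rightarrow> 'a \<Rightarrow> real \<Rightarrow> 'a \<Rightarrow> 'a \<Rightarrow> real" where
  "elim_weight W k h i j = W i j + W i k * W k j / h"

definition elim_pinning :: "('a \<Rightarrow> 'a \<Rightarrow> real) \<Rightarrow> 'a \<Rightarrow> real \<Rightarrow> ('a \<Rightarrow> real) \<Rightarrow> 'a \<Rightarrow> real" where
  "elim_pinning W k h \<eta> i = \<eta> i + W i k * \<eta> k / h"

lemma network_elim:
  assumes net: "network (insert k V) W \<eta>" and k: "k \<notin> V" and h: "h > 0"
  shows "network V (elim_weight W k h) (elim_pinning W k h \<eta>)"
proof -
  note N = networkD[OF net]
  have W: "elim_weight W k h i j \<ge> W i j" "elim_weight W k h i j \<ge> 0"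
    if "i \<in> V" "j \<in> V" for i j
    using N(3)[of i j] N(3)[of i k] N(3)[of k j] that h by (auto simp: elim_weight_def)
  have e: "elim_pinning W k h \<eta> i \<ge> \<eta> i" "elim_pinning W k h \<eta> i \<ge> 0" if "i \<in> V" for i
    using N(4)[of i] N(4)[of k] N(3)[of i k] that h by (auto simp: elim_pinning_def)
  have "grounded V (elim_weight W k h) (elim_pinning W k h \<eta>)"
    unfolding grounded_def
  proof (intro allI impI)
    fix S assume S: "S \<subseteq> V" "S \<noteq> {}"
    let ?Q = "\<lambda>i. elim_pinning W k h \<eta> i > 0 \<or> (\<exists>j\<in>V - S. elim_weight W k h i j > 0)"
    have direct: "\<exists>i\<in>S. ?Q i" if "i \<in> S" "\<eta> i > 0 \<or> (\<exists>j\<in>V - S. W i j > 0)" for i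
      using that W(1)[of i] e(1)[of i] S by (metis DiffD1 less_le_trans subsetD)
    obtain i where i: "i \<in> S" "\<eta> i > 0 \<or> (\<exists>j\<in>insert k V - S. W i j > 0)"
      using N(5)[of S] S by blast
    show "\<exists>i\<in>S. ?Q i"
    proof (cases "\<eta> i > 0 \<or> (\<exists>j\<in>V - S. W i j > 0)")
      case True
      then show ?thesis using direct i by blast
    next
      case False
      with i have ik: "W i k > 0" by auto
      \<comment> \<open>If \<open>i\<close> leaves \<open>S\<close> only towards \<open>k\<close>, then an edge leaving \<open>S \<union> {k}\<close> is needed.\<close>
      obtain l where l: "l \<in> insert k S" "\<eta> l > 0 \<or> (\<exists>j\<in>insert k V - insert k S. W l j > 0)"
        using N(5)[of "insert k S"] S by blast
      show ?thesis
      proof (cases "l = k")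
        case True
        have "i \<in> V" using i S by blast
        have "?Q i" using l(2)[unfolded True]
        proof (elim disjE bexE)
          assume "\<eta> k > 0"
          then have "W i k * \<eta> k / h > 0" using ik h by simp
          then show ?thesis using N(4)[of i] \<open>i \<in> V\<close> by (simp add: elim_pinning_def add_nonneg_pos)
        next
          fix j assume j: "j \<in> insert k V - insert k S" "W k j > 0"
          then have "W i k * W k j / h > 0" using ik h by simp
          then have "elim_weight W k h i j > 0"
            using N(3)[of i j] \<open>i \<in> V\<close> j by (simp add: elim_weight_def add_nonneg_pos)
          then show ?thesis using j by blast
        qed
        then show ?thesis using i by blast
      next
        case False
        then have "l \<in> S" "\<eta> l > 0 \<or> (\<exists>j\<in>V - S. W l j > 0)" using l k by auto
        then show ?thesis using direct by blast
      qed
    qed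
  qed
  moreover have "elim_weight W k h i j = elim_weight W k h j i" if "i \<in> V" "j \<in> V" for i j
    using N(2)[of i j] N(2)[of i k] N(2)[of k j] that by (simp add: elim_weight_def)
  moreover have "finite V" using N(1) by simp
  ultimately show ?thesis using W(2) e(2) unfolding network_def by blast
qed

definition inflow :: "'a set \<Rightarrow> ('a \<Rightarrow> 'a \<Rightarrow> real) \<Rightarrow> ('a \<Rightarrow> real) \<Rightarrow> ('a \<Rightarrow> real) \<Rightarrow> 'a \<Rightarrow> real" where
  "inflow V W \<eta> u i = (\<Sum>j\<in>V. W i j * exp (u j)) + \<eta> i"

text \<open>Half of the sum of \<open>W i j e\<^bsup>u j - u i\<^esup>\<close> over all \<open>j\<close>, including \<open>i\<close> itself and the reference vertex,
  where \<open>u\<close> is \<open>0\<close>.\<close>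

definition field_beta :: "'a set \<Rightarrow> ('a \<Rightarrow> 'a \<Rightarrow> real) \<Rightarrow> ('a \<Rightarrow> real) \<Rightarrow> ('a \<Rightarrow> real) \<Rightarrow> 'a \<Rightarrow> real" where
  "field_beta V W \<eta> u i = inflow V W \<eta> u i * exp (- u i) / 2"

definition H_matrix ::
  "'a set \<Rightarrow> ('a \<Rightarrow> 'a \<Rightarrow> real) \<Rightarrow> ('a \<Rightarrow> real) \<Rightarrow> ('a \<Rightarrow> real) \<Rightarrow> 'a \<Rightarrow> 'a \<Rightarrow> real" where
  "H_matrix V W \<eta> u i j = 2 * field_beta V W \<eta> u i * of_bool (i = j) - W i j"

text \<open>The density of \<open>u\<close> under the \<open>H\<^sup>2\<^sup>|\<^sup>2\<close> measure after integration over \<open>s\<close>, with the sum of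
  \<open>W i j (cosh (u i - u j) - 1)\<close> over the edges rewritten in terms of \<open>\<beta>\<close>, and \<open>det A \<Prod>e\<^bsup>-2u\<^esup>\<close> as
  \<open>det H\<close>.\<close>

definition field_density ::
  "'a set \<Rightarrow> ('a \<Rightarrow> 'a \<Rightarrow> real) \<Rightarrow> ('a \<Rightarrow> real) \<Rightarrow> ('a \<Rightarrow> real) \<Rightarrow> real" where
  "field_density V W \<eta> u =
     exp (- (\<Sum>i\<in>V. field_beta V W \<eta> u i) - (\<Sum>i\<in>V. \<eta> i * exp (u i)) / 2
          + (\<Sum>i\<in>V. \<Sum>j\<in>V. W i j) / 2 + (\<Sum>i\<in>V. \<eta> i))
     * sqrt (det_on V (H_matrix V W \<eta> u)) / sqrt (2 * pi) ^ card V"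

definition field_integral ::
  "'a set \<Rightarrow> ('a \<Rightarrow> 'a \<Rightarrow> real) \<Rightarrow> ('a \<Rightarrow> real) \<Rightarrow> (('a \<Rightarrow> real) \<Rightarrow> ennreal) \<Rightarrow> ennreal" where
  "field_integral V W \<eta> F = (\<integral>\<^sup>+u. F u * ennreal (field_density V W \<eta> u) \<partial>field_space V)"

lemma field_beta_cong:
  assumes "\<And>j. j \<in> V \<Longrightarrow> u j = v j" "\<And>j. j \<in> V \<Longrightarrow> \<eta> j = \<eta>' j" "i \<in> V"
  shows "field_beta V W \<eta> u i = field_beta V W \<eta>' v i"
  using assms by (simp add: field_beta_def inflow_def)

lemma H_matrix_cong:
  assumes "\<And>j. j \<in> V \<Longrightarrow> u j = v j" "\<And>j. j \<in> V \<Longrightarrow> \<eta> j = \<eta>' j" "i \<in> V"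
  shows "H_matrix V W \<eta> u i j = H_matrix V W \<eta>' v i j"
  using field_beta_cong[OF assms] by (simp add: H_matrix_def)

lemma field_density_cong:
  assumes "\<And>j. j \<in> V \<Longrightarrow> u j = v j" "\<And>j. j \<in> V \<Longrightarrow> \<eta> j = \<eta>' j"
  shows "field_density V W \<eta> u = field_density V W \<eta>' v"
proof -
  have "det_on V (H_matrix V W \<eta> u) = det_on V (H_matrix V W \<eta>' v)"
    by (intro det_on_cong H_matrix_cong) (simp_all add: assms)
  moreover have "field_beta V W \<eta> u i = field_beta V W \<eta>' v i" if "i \<in> V" for i
    by (rule field_beta_cong) (simp_all add: assms that)
  ultimately show ?thesis using assms by (simp add: field_density_def)
qed

lemma field_integral_pinning_cong:
  assumes "\<And>j. j \<in> V \<Longrightarrow> \<eta> j = \<eta>' j"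
  shows "field_integral V W \<eta> F = field_integral V W \<eta>' F"
proof -
  have "field_density V W \<eta> u = field_density V W \<eta>' u" for u
    by (rule field_density_cong) (simp_all add: assms)
  then show ?thesis by (simp add: field_integral_def)
qed

lemma inflow_pos:
  assumes net: "network (insert k V) W \<eta>" and k: "k \<notin> V"
  shows "inflow V W \<eta> u k > 0"
proof -
  note N = networkD[OF net]
  have nn: "(\<Sum>j\<in>V. W k j * exp (u j)) \<ge> 0"
    using N(3) by (intro sum_nonneg) auto
  from N(5)[of "{k}"] k consider "\<eta> k > 0" | j where "j \<in> V" "W k j > 0" by auto
  then show ?thesis
  proof cases
    case 1
    then show ?thesis using nn by (simp add: inflow_def)
  next
    case 2
    then have "(\<Sum>j\<in>V. W k j * exp (u j)) > 0"
      using N(1,3) by (intro sum_pos2[of _ j]) auto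
    then show ?thesis using N(4)[of k] by (simp add: inflow_def add_pos_nonneg)
  qed
qed

text \<open>Hence \<open>e\<^sup>u = H\<^sup>-\<^sup>1 \<eta>\<close>.\<close>

lemma H_matrix_exp:
  assumes "finite V" "i \<in> V"
  shows "(\<Sum>j\<in>V. H_matrix V W \<eta> u i j * exp (u j)) = \<eta> i"
proof -
  have "(\<Sum>j\<in>V. H_matrix V W \<eta> u i j * exp (u j))
     = (\<Sum>j\<in>V. of_bool (i = j) * (2 * field_beta V W \<eta> u i * exp (u j))) - (\<Sum>j\<in>V. W i j * exp (u j))"
    by (simp add: H_matrix_def algebra_simps sum_subtractf)
  also have "\<dots> = 2 * field_beta V W \<eta> u i * exp (u i) - (\<Sum>j\<in>V. W i j * exp (u j))"
    by (simp only: sum_of_bool_mult[OF assms])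
  also have "2 * field_beta V W \<eta> u i * exp (u i) = inflow V W \<eta> u i * (exp (- u i) * exp (u i))"
    by (simp add: field_beta_def)
  also have "\<dots> - (\<Sum>j\<in>V. W i j * exp (u j)) = \<eta> i"
    by (simp add: inflow_def exp_minus)
  finally show ?thesis .
qed

text \<open>For \<open>x = y e\<^sup>u\<close> the quadratic form is the Dirichlet form of \<open>y\<close> with conductances
  \<open>W i j e\<^bsup>u i + u j\<^esup>\<close>. If it vanished, the set where \<open>y \<noteq> 0\<close> would have no edge leaving it.\<close>

lemma spd_on_H_matrix:
  assumes net: "network V W \<eta>"
  shows "spd_on V (H_matrix V W \<eta> u)"
proof -
  note N = networkD[OF net]
  have "pos_def_on V (H_matrix V W \<eta> u)"
    unfolding pos_def_on_def
  proof (intro allI impI)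
    fix x :: "'a \<Rightarrow> real" assume x: "\<exists>i\<in>V. x i \<noteq> 0"
    define y where "y i = x i * exp (- u i)" for i
    have xy: "x i = y i * exp (u i)" for i by (simp add: y_def exp_minus)
    let ?c = "\<lambda>i j. W i j * exp (u i) * exp (u j)"
    let ?E = "\<Sum>i\<in>V. \<Sum>j\<in>V. ?c i j * (y i - y j)\<^sup>2"
    let ?P = "\<Sum>i\<in>V. \<eta> i * exp (u i) * (y i)\<^sup>2"
    have "(\<Sum>i\<in>V. \<Sum>j\<in>V. x i * H_matrix V W \<eta> u i j * x j)
      = (\<Sum>i\<in>V. \<Sum>j\<in>V. of_bool (i = j) * (2 * field_beta V W \<eta> u i * x i * x j)) - (\<Sum>i\<in>V. \<Sum>j\<in>V. x i * W i j *
          x j)"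
      unfolding sum_subtractf[symmetric] by (intro sum.cong refl) (simp add: H_matrix_def algebra_simps)
    also have "(\<Sum>i\<in>V. \<Sum>j\<in>V. of_bool (i = j) * (2 * field_beta V W \<eta> u i * x i * x j))
      = (\<Sum>i\<in>V. 2 * field_beta V W \<eta> u i * x i * x i)"
      by (intro sum.cong refl) (rule sum_of_bool_mult[OF N(1)])
    also have "\<dots> = (\<Sum>i\<in>V. \<Sum>j\<in>V. ?c i j * (y i)\<^sup>2) + ?P"
      unfolding sum.distrib[symmetric]
    proof (intro sum.cong refl)
      fix i
      have "2 * field_beta V W \<eta> u i * x i * x i = inflow V W \<eta> u i * (exp (- u i) * exp (u i)) * exp (u i)
          * (y i)\<^sup>2"
        by (simp add: field_beta_def xy power2_eq_square)
      also have "\<dots> = inflow V W \<eta> u i * exp (u i) * (y i)\<^sup>2" by (simp add: exp_minus)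
      also have "\<dots> = (\<Sum>j\<in>V. ?c i j * (y i)\<^sup>2) + \<eta> i * exp (u i) * (y i)\<^sup>2"
        by (simp add: inflow_def algebra_simps sum_distrib_left sum_distrib_right)
      finally show "2 * field_beta V W \<eta> u i * x i * x i = (\<Sum>j\<in>V. ?c i j * (y i)\<^sup>2) + \<eta> i * exp (u i) * (y
          i)\<^sup>2" .
    qed
    also have "(\<Sum>i\<in>V. \<Sum>j\<in>V. x i * W i j * x j) = (\<Sum>i\<in>V. \<Sum>j\<in>V. ?c i j * (y i * y j))"
      by (intro sum.cong refl) (simp add: xy)
    finally have 1: "(\<Sum>i\<in>V. \<Sum>j\<in>V. x i * H_matrix V W \<eta> u i j * x j)
      = (\<Sum>i\<in>V. \<Sum>j\<in>V. ?c i j * (y i)\<^sup>2) + ?P - (\<Sum>i\<in>V. \<Sum>j\<in>V. ?c i j * (y i * y j))" .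
    have "(\<Sum>i\<in>V. \<Sum>j\<in>V. ?c i j * (y j)\<^sup>2) = (\<Sum>i\<in>V. \<Sum>j\<in>V. ?c i j * (y i)\<^sup>2)"
      by (subst sum.swap) (intro sum.cong refl, use N(2) in auto)
    moreover have "?E = (\<Sum>i\<in>V. \<Sum>j\<in>V. ?c i j * (y i)\<^sup>2) + (\<Sum>i\<in>V. \<Sum>j\<in>V. ?c i j * (y j)\<^sup>2)
        - 2 * (\<Sum>i\<in>V. \<Sum>j\<in>V. ?c i j * (y i * y j))"
      unfolding sum_distrib_left sum.distrib[symmetric] sum_subtractf[symmetric]
      by (intro sum.cong refl) (simp add: power2_eq_square algebra_simps)
    ultimately have 2: "(\<Sum>i\<in>V. \<Sum>j\<in>V. x i * H_matrix V W \<eta> u i j * x j) = ?E / 2 + ?P"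
      unfolding 1 by simp
    have E: "?E \<ge> 0" using N(3) by (intro sum_nonneg) auto
    have P: "?P \<ge> 0" using N(4) by (intro sum_nonneg) auto
    define S where "S = {i\<in>V. y i \<noteq> 0}"
    have "S \<noteq> {}" "S \<subseteq> V" using x by (auto simp: S_def y_def)
    then obtain i where i: "i \<in> S" "\<eta> i > 0 \<or> (\<exists>j\<in>V - S. W i j > 0)" using N(5) by blast
    then have iV: "i \<in> V" "y i \<noteq> 0" by (auto simp: S_def)
    show "0 < (\<Sum>i\<in>V. \<Sum>j\<in>V. x i * H_matrix V W \<eta> u i j * x j)"
    proof (cases "\<eta> i > 0")
      case True
      then have "?P > 0" using iV N(1,4) by (intro sum_pos2[of _ i]) auto
      then show ?thesis unfolding 2 using E by simp
    next
      case False
      with i obtain j where j: "j \<in> V" "y j = 0" "W i j > 0" by (auto simp: S_def)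
      have "(\<Sum>j\<in>V. ?c i j * (y i - y j)\<^sup>2) > 0"
        using iV j N(1,3) by (intro sum_pos2[of _ j]) auto
      then have "?E > 0"
        by (rule sum_pos2[OF N(1) iV(1)]) (use N(3) in \<open>auto intro!: sum_nonneg\<close>)
      then show ?thesis unfolding 2 using P by simp
    qed
  qed
  moreover have "H_matrix V W \<eta> u i j = H_matrix V W \<eta> u j i" if "i \<in> V" "j \<in> V" for i j
    using N(2)[OF that] by (auto simp: H_matrix_def)
  ultimately show ?thesis unfolding spd_on_def by blast
qed

context
  fixes V :: "'a set" and W :: "'a \<Rightarrow> 'a \<Rightarrow> real" and \<eta> :: "'a \<Rightarrow> real" and k :: 'a and h :: real
    and u v :: "'a \<Rightarrow> real"
  assumes net: "network (insert k V) W \<eta>" and k: "k \<notin> V" and h: "h > 0"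
    and v: "v = u(k := ln (inflow V W \<eta> u k / h))"
begin

private lemma exp_v: "exp (v k) = inflow V W \<eta> u k / h"
  using inflow_pos[OF net k, of u] h by (simp add: v)

private lemma v_eq: "i \<in> V \<Longrightarrow> v i = u i"
  using k by (auto simp: v)

private lemma finite_V: "finite V"
  using networkD(1)[OF net] by simp

lemma field_beta_elim_same: "field_beta (insert k V) W \<eta> v k = (h + W k k) / 2"
proof -
  have "inflow (insert k V) W \<eta> v k = W k k * exp (v k) + inflow V W \<eta> u k"
    using finite_V k by (simp add: inflow_def v_eq)
  moreover have "inflow V W \<eta> u k = h * exp (v k)" using h by (simp add: exp_v)
  ultimately have "inflow (insert k V) W \<eta> v k = (h + W k k) * exp (v k)" by (simp add: algebra_simps)
  then show ?thesis by (simp add: field_beta_def exp_minus)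
qed

lemma inflow_elim:
  assumes i: "i \<in> V"
  shows "inflow (insert k V) W \<eta> v i = inflow V (elim_weight W k h) (elim_pinning W k h \<eta>) u i"
proof -
  have "inflow (insert k V) W \<eta> v i = W i k * (inflow V W \<eta> u k / h) + (\<Sum>j\<in>V. W i j * exp (u j)) + \<eta> i"
    using finite_V k by (simp add: inflow_def v_eq exp_v)
  also have "\<dots> = inflow V (elim_weight W k h) (elim_pinning W k h \<eta>) u i"
    by (simp add: inflow_def elim_weight_def elim_pinning_def algebra_simps sum.distrib
        sum_distrib_left sum_divide_distrib add_divide_distrib)
  finally show ?thesis .
qed

lemma field_beta_elim:
  "i \<in> V \<Longrightarrow> field_beta (insert k V) W \<eta> v i = field_beta V (elim_weight W k h) (elim_pinning W k h \<eta>) u i"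
  by (simp add: field_beta_def inflow_elim v_eq)

lemma H_matrix_elim_diag: "H_matrix (insert k V) W \<eta> v k k = h"
  by (simp add: H_matrix_def field_beta_elim_same add_divide_distrib)

text \<open>This is why the remaining vertices carry a field of the same kind.\<close>

lemma schur_H_matrix:
  assumes "i \<in> V" "j \<in> V"
  shows "schur k (H_matrix (insert k V) W \<eta> v) i j = H_matrix V (elim_weight W k h) (elim_pinning W k h \<eta>) u
      i j"
proof -
  have "i \<noteq> k" "j \<noteq> k" using assms k by auto
  then show ?thesis
    using assms unfolding schur_def H_matrix_elim_diag
    by (simp add: H_matrix_def field_beta_elim elim_weight_def)
qed

lemma restrict_field_beta_elim:
  "restrict (field_beta (insert k V) W \<eta> v) (insert k V)
   = (restrict (field_beta V (elim_weight W k h) (elim_pinning W k h \<eta>) u) V)(k := (h + W k k) / 2)"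
  using k by (auto simp: fun_eq_iff field_beta_elim field_beta_elim_same)

lemma sum_exp_elim:
  "(\<Sum>i\<in>insert k V. \<theta> i * exp (v i)) = (\<Sum>i\<in>V. elim_pinning W k h \<theta> i * exp (u i)) + \<theta> k * \<eta> k / h"
proof -
  have s: "(\<Sum>i\<in>V. W i k * exp (u i)) = (\<Sum>i\<in>V. W k i * exp (u i))"
    using networkD(2)[OF net] by (intro sum.cong) auto
  have "(\<Sum>i\<in>V. elim_pinning W k h \<theta> i * exp (u i))
     = (\<Sum>i\<in>V. \<theta> i * exp (u i)) + \<theta> k / h * (\<Sum>i\<in>V. W i k * exp (u i))"
    unfolding sum_distrib_left sum.distrib[symmetric]
    by (intro sum.cong refl) (simp add: elim_pinning_def algebra_simps)
  moreover have "(\<Sum>i\<in>insert k V. \<theta> i * exp (v i)) = \<theta> k * (inflow V W \<eta> u k / h) + (\<Sum>i\<in>V. \<theta> i * exp (u i))"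
    using finite_V k by (simp add: v_eq exp_v)
  ultimately show ?thesis unfolding s inflow_def by (simp add: algebra_simps add_divide_distrib)
qed

lemma inverse_form_elim:
  "inverse_form (insert k V) (H_matrix (insert k V) W \<eta> v) \<theta>
   = (\<theta> k)\<^sup>2 / h + inverse_form V (H_matrix V (elim_weight W k h) (elim_pinning W k h \<eta>) u) (elim_pinning W
       k h \<theta>)"
proof -
  have "inverse_form V (schur k (H_matrix (insert k V) W \<eta> v)) (\<lambda>i. \<theta> i - H_matrix (insert k V) W \<eta> v i k *
      \<theta> k / h)
     = inverse_form V (H_matrix V (elim_weight W k h) (elim_pinning W k h \<eta>) u) (elim_pinning W k h \<theta>)"
    using k by (intro inverse_form_cong schur_H_matrix) (auto simp: H_matrix_def elim_pinning_def)
  then show ?thesis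
    using inverse_form_insert[OF finite_V k spd_on_H_matrix[OF net], of v \<theta>] by (simp add: H_matrix_elim_diag)
qed

text \<open>Eliminating \<open>k\<close> changes the exponent by \<open>- (h - t)\<^sup>2 / (2 h)\<close>, where \<open>t\<close> is the total weight at \<open>k\<close>.
  The factor \<open>1 / h\<close> is the Jacobian of \<open>u k \<mapsto> h\<close>.\<close>

lemma field_density_elim:
  "field_density (insert k V) W \<eta> v / h
   = ig_density ((\<Sum>j\<in>V. W k j) + \<eta> k) h * field_density V (elim_weight W k h) (elim_pinning W k h \<eta>) u"
proof -
  let ?W = "elim_weight W k h" and ?e = "elim_pinning W k h \<eta>"
  define c where "c = (\<Sum>j\<in>V. W k j)"
  have sym: "W i k = W k i" if "i \<in> V" for i using networkD(2)[OF net] that by blast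
  have c': "(\<Sum>i\<in>V. W i k) = c" unfolding c_def using sym by (intro sum.cong) auto
  define t where "t = c + \<eta> k"
  have B: "(\<Sum>i\<in>insert k V. field_beta (insert k V) W \<eta> v i) = (h + W k k) / 2 + (\<Sum>i\<in>V. field_beta V ?W ?e u i)"
    using finite_V k by (simp add: field_beta_elim_same field_beta_elim)
  have E: "(\<Sum>i\<in>insert k V. \<eta> i * exp (v i)) = (\<Sum>i\<in>V. ?e i * exp (u i)) + \<eta> k * \<eta> k / h"
    by (rule sum_exp_elim)
  have T: "(\<Sum>i\<in>insert k V. \<eta> i) = (\<Sum>i\<in>V. ?e i) + \<eta> k - c * \<eta> k / h"
    using finite_V k by (simp add: elim_pinning_def sum.distrib sum_distrib_right[symmetric]
        sum_divide_distrib[symmetric] c')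
  have WW: "(\<Sum>i\<in>insert k V. \<Sum>j\<in>insert k V. W i j) = (\<Sum>i\<in>V. \<Sum>j\<in>V. ?W i j) + 2 * c + W k k - c\<^sup>2 / h"
  proof -
    have "(\<Sum>i\<in>V. \<Sum>j\<in>V. ?W i j) = (\<Sum>i\<in>V. \<Sum>j\<in>V. W i j) + (\<Sum>i\<in>V. W i k) * (\<Sum>j\<in>V. W k j) / h"
      by (simp add: elim_weight_def sum.distrib sum_product sum_divide_distrib)
    then show ?thesis using finite_V k
      by (simp add: sum.distrib c' c_def[symmetric] power2_eq_square)
  qed
  have D: "det_on (insert k V) (H_matrix (insert k V) W \<eta> v) = h * det_on V (H_matrix V ?W ?e u)"
  proof -
    have "det_on V (schur k (H_matrix (insert k V) W \<eta> v)) = det_on V (H_matrix V ?W ?e u)"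
      by (intro det_on_cong schur_H_matrix)
    then show ?thesis using h by (subst det_on_schur[OF finite_V k]) (simp_all add: H_matrix_elim_diag)
  qed
  let ?X = "- (\<Sum>i\<in>V. field_beta V ?W ?e u i) - (\<Sum>i\<in>V. ?e i * exp (u i)) / 2
      + (\<Sum>i\<in>V. \<Sum>j\<in>V. ?W i j) / 2 + (\<Sum>i\<in>V. ?e i)"
  have "- (\<Sum>i\<in>insert k V. field_beta (insert k V) W \<eta> v i) - (\<Sum>i\<in>insert k V. \<eta> i * exp (v i)) / 2
      + (\<Sum>i\<in>insert k V. \<Sum>j\<in>insert k V. W i j) / 2 + (\<Sum>i\<in>insert k V. \<eta> i) = ?X - (h - t)\<^sup>2 / (2 * h)"
    unfolding B E T WW t_def using h by (simp add: field_simps power2_eq_square)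
  then have "field_density (insert k V) W \<eta> v
     = exp (?X - (h - t)\<^sup>2 / (2 * h)) * (sqrt h * sqrt (det_on V (H_matrix V ?W ?e u))) / (sqrt (2 * pi) *
         sqrt (2 * pi) ^ card V)"
    unfolding field_density_def D using finite_V k by (simp add: real_sqrt_mult)
  also have "exp (?X - (h - t)\<^sup>2 / (2 * h)) = exp (- (h - t)\<^sup>2 / (2 * h)) * exp ?X"
    by (simp add: exp_add[symmetric] algebra_simps)
  finally have "field_density (insert k V) W \<eta> v / h
     = (exp (- (h - t)\<^sup>2 / (2 * h)) * (sqrt h / h) / sqrt (2 * pi)) * field_density V ?W ?e u"
    unfolding field_density_def by (simp add: mult_ac)
  also have "sqrt h / h = 1 / sqrt h" using h by (simp add: field_simps)
  finally show ?thesis by (simp add: ig_density_def t_def c_def real_sqrt_mult)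
qed

end

lemma borel_measurable_inflow [measurable]:
  "(\<lambda>u. inflow V W \<eta> u i) \<in> borel_measurable (field_space V)"
  unfolding inflow_def by measurable

lemma borel_measurable_field_beta [measurable]:
  assumes "i \<in> V"
  shows "(\<lambda>u. field_beta V W \<eta> u i) \<in> borel_measurable (field_space V)"
  using assms unfolding field_beta_def by measurable

lemma borel_measurable_H_matrix [measurable]:
  assumes "i \<in> V"
  shows "(\<lambda>u. H_matrix V W \<eta> u i j) \<in> borel_measurable (field_space V)"
  using assms unfolding H_matrix_def by measurable

lemma borel_measurable_field_density [measurable]:
  "field_density V W \<eta> \<in> borel_measurable (field_space V)"
proof -
  have [measurable]: "(\<lambda>u. det_on V (H_matrix V W \<eta> u)) \<in> borel_measurable (field_space V)"
    by (rule borel_measurable_det_on) measurable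
  have "(\<lambda>u. field_density V W \<eta> u) \<in> borel_measurable (field_space V)"
    unfolding field_density_def by measurable
  then show ?thesis by simp
qed

lemma borel_measurable_inverse_form_H_matrix:
  assumes net: "network V W \<eta>"
  shows "(\<lambda>u. inverse_form V (H_matrix V W \<eta> u) \<theta>) \<in> borel_measurable (field_space V)"
proof -
  have [measurable]: "(\<lambda>u. inverse_on V (H_matrix V W \<eta> u) i j) \<in> borel_measurable (field_space V)" for i j
    by (rule borel_measurable_inverse_on[OF networkD(1)[OF net] spd_on_H_matrix[OF net]]) measurable
  show ?thesis unfolding inverse_form_def by measurable
qed

lemma measurable_restrict_field_beta:
  assumes "V \<subseteq> V'"
  shows "(\<lambda>u. restrict (field_beta V' W \<eta> u) V) \<in> Pi\<^sub>M V' (\<lambda>_. lborel) \<rightarrow>\<^sub>M Pi\<^sub>M V (\<lambda>_. borel)"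
  using assms by (intro measurable_restrict) (auto intro: borel_measurable_field_beta)

lemma field_integral_cmult:
  assumes [measurable]: "F \<in> borel_measurable (field_space V)"
  shows "field_integral V W \<eta> (\<lambda>u. c * F u) = c * field_integral V W \<eta> F"
  unfolding field_integral_def by (subst nn_integral_cmult[symmetric]) (measurable, simp add: mult.assoc)

lemma field_integral_cong:
  assumes "\<And>u. u \<in> space (field_space V) \<Longrightarrow> F u = G u"
  shows "field_integral V W \<eta> F = field_integral V W \<eta> G"
  unfolding field_integral_def using assms by (intro nn_integral_cong) simp

text \<open>Eliminating \<open>k\<close> replaces the variable \<open>u k\<close> by \<open>h = 2 \<beta> k - W k k\<close>. The new variable has
  the density \<open>ig_density\<close>, and given \<open>h\<close> the remaining field lives on the network with the weights
  obtained by star-mesh transformation.\<close>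

lemma field_integral_elim:
  assumes net: "network (insert k V) W \<eta>" and k: "k \<notin> V"
    and F [measurable]: "F \<in> borel_measurable (field_space (insert k V))"
  shows "field_integral (insert k V) W \<eta> F = (\<integral>\<^sup>+h. indicator {0<..} h *
      (ennreal (ig_density ((\<Sum>j\<in>V. W k j) + \<eta> k) h) *
       field_integral V (elim_weight W k h) (elim_pinning W k h \<eta>)
         (\<lambda>u. F (u(k := ln (inflow V W \<eta> u k / h))))) \<partial>lborel)"
proof -
  interpret product_sigma_finite "\<lambda>_::'a. lborel :: real measure" ..
  have fin: "finite V" using networkD(1)[OF net] by simp
  interpret V: finite_product_sigma_finite "\<lambda>_::'a. lborel :: real measure" V by standard (rule fin)
  interpret P: pair_sigma_finite "field_space V" "lborel :: real measure" ..
  let ?M = "field_space V"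
  let ?v = "\<lambda>u h. u(k := ln (inflow V W \<eta> u k / h))"
  let ?D = "\<lambda>v. F v * ennreal (field_density (insert k V) W \<eta> v)"
  have D [measurable]: "?D \<in> borel_measurable (field_space (insert k V))" by measurable
  have v [measurable]: "(\<lambda>(u, h). ?v u h) \<in> ?M \<Otimes>\<^sub>M lborel \<rightarrow>\<^sub>M field_space (insert k V)"
    unfolding split_beta' by (rule measurable_fun_upd[where J=V]) (auto simp: measurable_lborel1)
  have vh: "(\<lambda>u. ?v u h) \<in> ?M \<rightarrow>\<^sub>M field_space (insert k V)" for h
    by (rule measurable_fun_upd[where J=V]) (auto simp: measurable_lborel1)
  have "field_integral (insert k V) W \<eta> F = (\<integral>\<^sup>+u. (\<integral>\<^sup>+y. ?D (u(k := y)) \<partial>lborel) \<partial>?M)"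
    unfolding field_integral_def by (rule product_nn_integral_insert[OF fin k D])
  also have "\<dots> = (\<integral>\<^sup>+u. (\<integral>\<^sup>+h. indicator {0<..} h * (ennreal (1 / h) * ?D (?v u h)) \<partial>lborel) \<partial>?M)"
  proof (rule nn_integral_cong, rule nn_integral_log_substitution)
    fix u assume "u \<in> space ?M"
    then have "(\<lambda>y. u(k := y)) \<in> lborel \<rightarrow>\<^sub>M field_space (insert k V)"
      by (intro measurable_fun_upd[where J=V]) auto
    from measurable_compose[OF this D] show "(\<lambda>y. ?D (u(k := y))) \<in> borel_measurable borel" by simp
  qed (rule inflow_pos[OF net k])
  also have "\<dots> = (\<integral>\<^sup>+h. (\<integral>\<^sup>+u. indicator {0<..} h * (ennreal (1 / h) * ?D (?v u h)) \<partial>?M) \<partial>lborel)"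
    by (rule P.Fubini'[symmetric]) (measurable)
  also have "\<dots> = (\<integral>\<^sup>+h. indicator {0<..} h *
      (ennreal (ig_density ((\<Sum>j\<in>V. W k j) + \<eta> k) h) *
       field_integral V (elim_weight W k h) (elim_pinning W k h \<eta>) (\<lambda>u. F (?v u h))) \<partial>lborel)"
  proof (rule nn_integral_cong)
    fix h :: real
    let ?g = "ig_density ((\<Sum>j\<in>V. W k j) + \<eta> k) h"
    let ?d = "field_density V (elim_weight W k h) (elim_pinning W k h \<eta>)"
    show "(\<integral>\<^sup>+u. indicator {0<..} h * (ennreal (1 / h) * ?D (?v u h)) \<partial>?M) = indicator {0<..} h *
      (ennreal ?g * field_integral V (elim_weight W k h) (elim_pinning W k h \<eta>) (\<lambda>u. F (?v u h)))"
    proof (cases "h > 0")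
      case True
      have "?g \<ge> 0" using True by (simp add: ig_density_def)
      have "ennreal (1 / h) * ?D (?v u h) = ennreal ?g * (F (?v u h) * ennreal (?d u))" for u
      proof -
        have "ennreal (1 / h) * ennreal (field_density (insert k V) W \<eta> (?v u h)) = ennreal (?g * ?d u)"
          using field_density_elim[OF net k True refl, of u] True by (subst ennreal_mult'[symmetric]) auto
        also have "\<dots> = ennreal ?g * ennreal (?d u)" using \<open>?g \<ge> 0\<close> by (rule ennreal_mult')
        finally show ?thesis by (metis mult.left_commute)
      qed
      then show ?thesis using True vh[of h] unfolding field_integral_def
        by (simp add: nn_integral_cmult measurable_compose[OF vh F])
    qed simp
  qed
  finally show ?thesis .
qed

section \<open>Total mass, tilting and marginals\<close>

lemma field_integral_empty: "field_integral {} W \<eta> F = F (\<lambda>_. undefined)"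
proof -
  interpret product_sigma_finite "\<lambda>_::'a. lborel :: real measure" ..
  show ?thesis by (simp add: field_integral_def field_density_def nn_integral_empty)
qed

text \<open>By induction: each elimination step contributes the total mass of an \<open>ig_density\<close>, which is \<open>1\<close>.\<close>

theorem field_integral_const:
  assumes "network V W \<eta>"
  shows "field_integral V W \<eta> (\<lambda>_. c) = c"
proof -
  have "finite V" using networkD(1)[OF assms] .
  from this assms have "field_integral V W \<eta> (\<lambda>_. 1) = 1"
  proof (induction V arbitrary: W \<eta>)
    case (insert k V)
    have "inflow V W \<eta> (\<lambda>_. 0) k > 0" by (rule inflow_pos[OF insert.prems insert.hyps(2)])
    then have t: "(\<Sum>j\<in>V. W k j) + \<eta> k > 0" by (simp add: inflow_def)
    have "field_integral (insert k V) W \<eta> (\<lambda>_. 1) = (\<integral>\<^sup>+h. indicator {0<..} h *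
      ennreal (ig_density ((\<Sum>j\<in>V. W k j) + \<eta> k) h) \<partial>lborel)"
      unfolding field_integral_elim[OF insert.prems insert.hyps(2) measurable_const, of 1, simplified]
    proof (intro nn_integral_cong)
      fix h :: real
      show "indicator {0<..} h * (ennreal (ig_density ((\<Sum>j\<in>V. W k j) + \<eta> k) h) *
          field_integral V (elim_weight W k h) (elim_pinning W k h \<eta>) (\<lambda>u. 1))
        = indicator {0<..} h * ennreal (ig_density ((\<Sum>j\<in>V. W k j) + \<eta> k) h)"
        using insert.IH[OF network_elim[OF insert.prems insert.hyps(2)], of h]
        by (cases "h > 0") auto
    qed
    then show ?case using nn_integral_ig_density[OF t] by simp
  qed (simp add: field_integral_empty)
  then show ?thesis using field_integral_cmult[of "\<lambda>_. 1" V W \<eta> c] by simp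
qed

lemma elim_pinning_add:
  "elim_pinning W k h (\<lambda>i. \<eta> i + \<theta> i) = (\<lambda>i. elim_pinning W k h \<eta> i + elim_pinning W k h \<theta> i)"
  by (simp add: elim_pinning_def fun_eq_iff algebra_simps add_divide_distrib)

lemma ig_density_shift:
  assumes "h > 0"
  shows "ig_density (t + s) h * exp (- s)
    = ig_density t h * exp (- t * s / h - s\<^sup>2 / (2 * h))"
proof -
  have "- (h - (t + s))\<^sup>2 / (2 * h) - s = - (h - t)\<^sup>2 / (2 * h) + (- t * s / h - s\<^sup>2 / (2 * h))"
    using assms by (simp add: field_simps power2_eq_square)
  then show ?thesis by (simp add: ig_density_def exp_add[symmetric] flip: exp_diff)
qed

text \<open>The Green's function \<open>H\<^sup>-\<^sup>1\<close> depends on \<open>\<beta>\<close> only, whereas \<open>e\<^sup>u = H\<^sup>-\<^sup>1 \<eta>\<close> depends on \<open>\<eta>\<close> as well.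
  Therefore the two sides are compared for functions of \<open>\<beta>\<close>. In an elimination step the quadratic form
  splits off \<open>(\<theta> k)\<^sup>2 / h\<close>, the load \<open>\<theta>\<close> transforms in the same way as \<open>\<eta>\<close>, and \<open>ig_density_shift\<close>
  absorbs the scalar factors. The constant stays under the integral on the right-hand side, so that
  the induction step compares the two sides separately for every \<open>h\<close>.\<close>

theorem field_integral_tilt:
  assumes "network V W \<eta>" and "\<And>i. i \<in> V \<Longrightarrow> \<theta> i \<ge> 0"
    and "\<Phi> \<in> borel_measurable (Pi\<^sub>M V (\<lambda>_. borel))"
  shows "field_integral V W \<eta> (\<lambda>u. ennreal (exp (- (\<Sum>i\<in>V. \<theta> i * exp (u i)) - inverse_form V (H_matrix V W \<eta>
      u) \<theta> / 2))
        * \<Phi> (restrict (field_beta V W \<eta> u) V))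
    = field_integral V W (\<lambda>i. \<eta> i + \<theta> i)
        (\<lambda>u. ennreal (exp (- (\<Sum>i\<in>V. \<theta> i))) * \<Phi> (restrict (field_beta V W (\<lambda>i. \<eta> i + \<theta> i) u) V))"
proof -
  have "finite V" using networkD(1)[OF assms(1)] .
  from this assms show ?thesis
  proof (induction V arbitrary: W \<eta> \<theta> \<Phi>)
    case empty
    show ?case by (simp add: field_integral_empty inverse_form_def)
  next
    case (insert k V)
    note net = insert.prems(1) and k = insert.hyps(2) and \<theta> = insert.prems(2)
    note [measurable] = insert.prems(3)
    let ?t = "(\<Sum>j\<in>V. W k j) + \<eta> k"
    have net': "network (insert k V) W (\<lambda>i. \<eta> i + \<theta> i)"
      by (rule network_mono_pinning[OF net \<theta>])
    note [measurable] = borel_measurable_inverse_form_H_matrix[OF net]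
      measurable_restrict_field_beta[of "insert k V" "insert k V", OF order_refl]
    have sum\<theta>: "(\<Sum>i\<in>V. elim_pinning W k h \<theta> i) = (\<Sum>i\<in>V. \<theta> i) + (\<Sum>j\<in>V. W k j) * \<theta> k / h" for h
    proof -
      have "(\<Sum>i\<in>V. W i k) = (\<Sum>j\<in>V. W k j)"
        using networkD(2)[OF net] by (intro sum.cong) auto
      then show ?thesis by (simp add: elim_pinning_def sum.distrib sum_divide_distrib[symmetric]
          sum_distrib_right[symmetric])
    qed
    let ?F = "\<lambda>u. ennreal (exp (- (\<Sum>i\<in>insert k V. \<theta> i * exp (u i)) - inverse_form (insert k V) (H_matrix
        (insert k V) W \<eta> u) \<theta> / 2))
        * \<Phi> (restrict (field_beta (insert k V) W \<eta> u) (insert k V))"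
    let ?G = "\<lambda>u. ennreal (exp (- (\<Sum>i\<in>insert k V. \<theta> i))) * \<Phi> (restrict (field_beta (insert k V) W (\<lambda>i. \<eta> i +
        \<theta> i) u) (insert k V))"
    have F: "?F \<in> borel_measurable (field_space (insert k V))" by measurable
    have G: "?G \<in> borel_measurable (field_space (insert k V))" by measurable
    show ?case
      unfolding field_integral_elim[OF net k F] field_integral_elim[OF net' k G]
    proof (rule nn_integral_cong)
      fix h :: real
      let ?W = "elim_weight W k h" and ?e = "elim_pinning W k h \<eta>" and ?th = "elim_pinning W k h \<theta>"
      let ?\<Psi> = "\<lambda>b. \<Phi> (b(k := (h + W k k) / 2))"
      let ?c = "- \<theta> k * \<eta> k / h - (\<theta> k)\<^sup>2 / (2 * h)"
      show "indicator {0<..} h * (ennreal (ig_density ?t h) *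
           field_integral V ?W ?e (\<lambda>u. ?F (u(k := ln (inflow V W \<eta> u k / h)))))
         = indicator {0<..} h * (ennreal (ig_density ((\<Sum>j\<in>V. W k j) + (\<eta> k + \<theta> k)) h) *
           field_integral V ?W (elim_pinning W k h (\<lambda>i. \<eta> i + \<theta> i))
             (\<lambda>u. ?G (u(k := ln (inflow V W (\<lambda>i. \<eta> i + \<theta> i) u k / h)))))"
      proof (cases "h > 0")
        case h: True
        note net1 = network_elim[OF net k h]
        have \<Psi>: "?\<Psi> \<in> borel_measurable (Pi\<^sub>M V (\<lambda>_. borel))"
          by (rule measurable_compose[OF _ insert.prems(3)]) (rule measurable_fun_upd[where J=V], auto)
        have th: "?th i \<ge> 0" if "i \<in> V" for i
          using \<theta>[of i] \<theta>[of k] networkD(3)[OF net, of i k] that h by (simp add: elim_pinning_def)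
        let ?f = "\<lambda>u. ennreal (exp (- (\<Sum>i\<in>V. ?th i * exp (u i)) - inverse_form V (H_matrix V ?W ?e u) ?th / 2))
            * ?\<Psi> (restrict (field_beta V ?W ?e u) V)"
        let ?g = "\<lambda>u. ?\<Psi> (restrict (field_beta V ?W (\<lambda>i. ?e i + ?th i) u) V)"
        note [measurable] = borel_measurable_inverse_form_H_matrix[OF net1] \<Psi>
           measurable_restrict_field_beta[of "V" "V", OF order_refl]
        have f: "?f \<in> borel_measurable (field_space V)" by measurable
        have g: "?g \<in> borel_measurable (field_space V)" by measurable
        have "field_integral V ?W ?e (\<lambda>u. ?F (u(k := ln (inflow V W \<eta> u k / h))))
           = field_integral V ?W ?e (\<lambda>u. ennreal (exp ?c) * ?f u)"
        proof (rule field_integral_cong)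
          fix u
          let ?v = "u(k := ln (inflow V W \<eta> u k / h))"
          have "exp (- (\<Sum>i\<in>insert k V. \<theta> i * exp (?v i)) - inverse_form (insert k V) (H_matrix (insert k V)
              W \<eta> ?v) \<theta> / 2)
              = exp ?c * exp (- (\<Sum>i\<in>V. ?th i * exp (u i)) - inverse_form V (H_matrix V ?W ?e u) ?th / 2)"
            unfolding sum_exp_elim[OF net k h refl] inverse_form_elim[OF net k h refl] exp_add[symmetric]
            by (simp add: add_divide_distrib)
          then show "?F ?v = ennreal (exp ?c) * ?f u"
            unfolding restrict_field_beta_elim[OF net k h refl] by (simp add: ennreal_mult' mult.assoc)
        qed
        also have "\<dots> = ennreal (exp ?c) * field_integral V ?W ?e ?f" by (rule field_integral_cmult[OF f])
        also have "field_integral V ?W ?e ?f = ennreal (exp (- (\<Sum>i\<in>V. ?th i))) * field_integral V ?W (\<lambda>i. ?e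
            i + ?th i) ?g"
          by (rule trans[OF insert.IH[OF net1 th \<Psi>] field_integral_cmult[OF g]])
        finally have L: "field_integral V ?W ?e (\<lambda>u. ?F (u(k := ln (inflow V W \<eta> u k / h))))
           = ennreal (exp ?c) * (ennreal (exp (- (\<Sum>i\<in>V. ?th i))) * field_integral V ?W (\<lambda>i. ?e i + ?th i) ?g)" .
        have "field_integral V ?W (elim_pinning W k h (\<lambda>i. \<eta> i + \<theta> i))
             (\<lambda>u. ?G (u(k := ln (inflow V W (\<lambda>i. \<eta> i + \<theta> i) u k / h))))
           = field_integral V ?W (\<lambda>i. ?e i + ?th i) (\<lambda>u. ennreal (exp (- (\<Sum>i\<in>insert k V. \<theta> i))) * ?g u)"
          unfolding elim_pinning_add[symmetric]
          by (rule field_integral_cong) (simp only: restrict_field_beta_elim[OF net' k h refl])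
        also have "\<dots> = ennreal (exp (- (\<Sum>i\<in>insert k V. \<theta> i))) * field_integral V ?W (\<lambda>i. ?e i + ?th i) ?g"
          by (rule field_integral_cmult[OF g])
        finally have R: "field_integral V ?W (elim_pinning W k h (\<lambda>i. \<eta> i + \<theta> i))
             (\<lambda>u. ?G (u(k := ln (inflow V W (\<lambda>i. \<eta> i + \<theta> i) u k / h)))) = \<dots>" .
        have pos: "ig_density t h \<ge> 0" for t using h by (simp add: ig_density_def)
        have "ig_density ?t h * (exp ?c * exp (- (\<Sum>i\<in>V. ?th i)))
            = ig_density ?t h * exp (- ?t * \<theta> k / h - (\<theta> k)\<^sup>2 / (2 * h)) * exp (- (\<Sum>i\<in>V. \<theta> i))"
          unfolding sum\<theta> mult.assoc exp_add[symmetric] by (simp add: algebra_simps add_divide_distrib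
              diff_divide_distrib)
        also have "\<dots> = ig_density (?t + \<theta> k) h * (exp (- \<theta> k) * exp (- (\<Sum>i\<in>V. \<theta> i)))"
          unfolding ig_density_shift[OF h, symmetric] by (simp only: mult.assoc)
        also have "exp (- \<theta> k) * exp (- (\<Sum>i\<in>V. \<theta> i)) = exp (- (\<Sum>i\<in>insert k V. \<theta> i))"
          using insert.hyps by (simp add: exp_add[symmetric])
        finally have "ig_density ?t h * (exp ?c * exp (- (\<Sum>i\<in>V. ?th i)))
            = ig_density ((\<Sum>j\<in>V. W k j) + (\<eta> k + \<theta> k)) h * exp (- (\<Sum>i\<in>insert k V. \<theta> i))"
          by (simp add: add.assoc)
        then have "ennreal (ig_density ?t h) * (ennreal (exp ?c) * ennreal (exp (- (\<Sum>i\<in>V. ?th i))))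
            = ennreal (ig_density ((\<Sum>j\<in>V. W k j) + (\<eta> k + \<theta> k)) h) * ennreal (exp (- (\<Sum>i\<in>insert k V. \<theta> i)))"
          using pos by (simp add: ennreal_mult'[symmetric])
        then show ?thesis unfolding L R by (simp add: mult.assoc[symmetric])
      qed simp
    qed
  qed
qed

text \<open>Eliminating a vertex of \<open>V\<close> commutes with collapsing \<open>U\<close> into the reference vertex; once \<open>V\<close> is
  empty, only the total mass remains.\<close>

theorem field_integral_marginal:
  assumes "network (V \<union> U) W \<eta>" and "V \<inter> U = {}"
    and "\<Phi> \<in> borel_measurable (Pi\<^sub>M V (\<lambda>_. borel))"
  shows "field_integral (V \<union> U) W \<eta> (\<lambda>u. \<Phi> (restrict (field_beta (V \<union> U) W \<eta> u) V))
    = field_integral V W (\<lambda>i. \<eta> i + (\<Sum>l\<in>U. W i l))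
        (\<lambda>u. \<Phi> (restrict (field_beta V W (\<lambda>i. \<eta> i + (\<Sum>l\<in>U. W i l)) u) V))"
proof -
  have "finite V" using networkD(1)[OF assms(1)] by simp
  from this assms show ?thesis
  proof (induction V arbitrary: W \<eta> \<Phi>)
    case empty
    then show ?case by (simp add: field_integral_empty field_integral_const)
  next
    case (insert k V)
    let ?k = "\<lambda>A. insert k A"
    let ?e = "\<lambda>i. \<eta> i + (\<Sum>l\<in>U. W i l)"
    have finU: "finite U" using networkD(1)[OF insert.prems(1)] by simp
    have net: "network (insert k (V \<union> U)) W \<eta>" using insert.prems(1) by simp
    have k: "k \<notin> V \<union> U" and k': "k \<notin> V" using insert.hyps insert.prems by auto
    have disj: "V \<inter> U = {}" using insert.prems by auto
    have net': "network (insert k V) W ?e"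
    proof -
      note N = networkD[OF net]
      have "grounded (insert k V) W ?e"
        unfolding grounded_def
      proof (intro allI impI)
        fix S assume S: "S \<subseteq> insert k V" "S \<noteq> {}"
        then have "S \<subseteq> insert k (V \<union> U)" by auto
        from N(5)[OF this S(2)] obtain i where
          i: "i \<in> S" "\<eta> i > 0 \<or> (\<exists>j\<in>insert k (V \<union> U) - S. W i j > 0)" by blast
        have iV: "i \<in> insert k (V \<union> U)" using i S by auto
        have nn: "(\<Sum>l\<in>U. W i l) \<ge> 0" using N(3) iV by (intro sum_nonneg) auto
        have "?e i > 0 \<or> (\<exists>j\<in>insert k V - S. W i j > 0)"
          using i(2)
        proof
          assume "\<eta> i > 0" then show ?thesis using nn by (simp add: add_pos_nonneg)
        next
          assume "\<exists>j\<in>insert k (V \<union> U) - S. W i j > 0"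
          then obtain j where j: "j \<in> insert k (V \<union> U) - S" "W i j > 0" by blast
          show ?thesis
          proof (cases "j \<in> U")
            case True
            then have "(\<Sum>l\<in>U. W i l) > 0" using j iV N(3) finU by (intro sum_pos2[of _ j]) auto
            then show ?thesis using N(4)[OF iV] by (simp add: add_nonneg_pos)
          qed (use j in auto)
        qed
        then show "\<exists>i\<in>S. ?e i > 0 \<or> (\<exists>j\<in>insert k V - S. W i j > 0)" using i by blast
      qed
      moreover have "?e i \<ge> 0" if "i \<in> insert k V" for i
        using that N(3,4) by (intro add_nonneg_nonneg sum_nonneg) auto
      ultimately show ?thesis using N(1-3) unfolding network_def by auto
    qed
    have "insert k V \<subseteq> insert k (V \<union> U)" by auto
    note [measurable] = insert.prems(3) measurable_restrict_field_beta[OF this]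
      measurable_restrict_field_beta[of "insert k V" "insert k V", OF order_refl]
    let ?F = "\<lambda>u. \<Phi> (restrict (field_beta (insert k (V \<union> U)) W \<eta> u) (insert k V))"
    let ?G = "\<lambda>u. \<Phi> (restrict (field_beta (insert k V) W ?e u) (insert k V))"
    have F: "?F \<in> borel_measurable (Pi\<^sub>M (insert k (V \<union> U)) (\<lambda>_. lborel))" by measurable
    have G: "?G \<in> borel_measurable (field_space (insert k V))" by measurable
    have t: "(\<Sum>j\<in>V \<union> U. W k j) + \<eta> k = (\<Sum>j\<in>V. W k j) + ?e k"
      using insert.hyps finU disj by (simp add: sum.union_disjoint)
    show ?case
      unfolding Un_insert_left field_integral_elim[OF net k F] field_integral_elim[OF net' k' G] t
    proof (rule nn_integral_cong)
      fix h :: real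
      let ?W = "elim_weight W k h" and ?p = "elim_pinning W k h"
      let ?\<Psi> = "\<lambda>b. \<Phi> (b(k := (h + W k k) / 2))"
      show "indicator {0<..} h * (ennreal (ig_density ((\<Sum>j\<in>V. W k j) + ?e k) h) *
           field_integral (V \<union> U) ?W (?p \<eta>) (\<lambda>u. ?F (u(k := ln (inflow (V \<union> U) W \<eta> u k / h)))))
         = indicator {0<..} h * (ennreal (ig_density ((\<Sum>j\<in>V. W k j) + ?e k) h) *
           field_integral V ?W (?p ?e) (\<lambda>u. ?G (u(k := ln (inflow V W ?e u k / h)))))"
      proof (cases "h > 0")
        case h: True
        have \<Psi>: "?\<Psi> \<in> borel_measurable (Pi\<^sub>M V (\<lambda>_. borel))"
          by (rule measurable_compose[OF _ insert.prems(3)]) (rule measurable_fun_upd[where J=V], auto)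
        have pe: "?p ?e = (\<lambda>i. ?p \<eta> i + (\<Sum>l\<in>U. ?W i l))"
          by (simp add: fun_eq_iff elim_pinning_def elim_weight_def sum.distrib algebra_simps
              add_divide_distrib sum_distrib_left sum_divide_distrib)
        have "field_integral (V \<union> U) ?W (?p \<eta>) (\<lambda>u. ?F (u(k := ln (inflow (V \<union> U) W \<eta> u k / h))))
          = field_integral (V \<union> U) ?W (?p \<eta>) (\<lambda>u. ?\<Psi> (restrict (field_beta (V \<union> U) ?W (?p \<eta>) u) V))"
        proof (rule field_integral_cong)
          fix u
          let ?v = "u(k := ln (inflow (V \<union> U) W \<eta> u k / h))"
          have "restrict (field_beta (insert k (V \<union> U)) W \<eta> ?v) (insert k V)
             = restrict (restrict (field_beta (insert k (V \<union> U)) W \<eta> ?v) (insert k (V \<union> U))) (insert k V)"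
            by (auto simp: fun_eq_iff)
          also have "\<dots> = (restrict (field_beta (V \<union> U) ?W (?p \<eta>) u) V)(k := (h + W k k) / 2)"
            unfolding restrict_field_beta_elim[OF net k h refl] using k by (auto simp: fun_eq_iff)
          finally show "?F ?v = ?\<Psi> (restrict (field_beta (V \<union> U) ?W (?p \<eta>) u) V)" by simp
        qed
        also have "\<dots> = field_integral V ?W (?p ?e) (\<lambda>u. ?\<Psi> (restrict (field_beta V ?W (?p ?e) u) V))"
          unfolding pe by (rule insert.IH[OF network_elim[OF net k h] disj \<Psi>])
        also have "\<dots> = field_integral V ?W (?p ?e) (\<lambda>u. ?G (u(k := ln (inflow V W ?e u k / h))))"
          by (rule field_integral_cong) (simp only: restrict_field_beta_elim[OF net' k' h refl])
        finally show ?thesis by simp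
      qed simp
    qed
  qed
qed

section \<open>Moments\<close>

text \<open>The property is used for \<open>e\<^sup>u\<close> and the Green's function: unlike integrability it is closed under
  products.\<close>

definition all_moments :: "'b measure \<Rightarrow> ('b \<Rightarrow> real) \<Rightarrow> bool" where
  "all_moments M Z \<longleftrightarrow> Z \<in> borel_measurable M \<and> (\<forall>p::nat. integrable M (\<lambda>x. \<bar>Z x\<bar> ^ p))"

lemma all_moments_integrable:
  assumes "all_moments M Z"
  shows "integrable M Z"
proof -
  have "integrable M (\<lambda>x. \<bar>Z x\<bar> ^ 1)" "Z \<in> borel_measurable M"
    using assms unfolding all_moments_def by blast+
  then have "integrable M (\<lambda>x. \<bar>Z x\<bar>)" "Z \<in> borel_measurable M" by (simp_all only: power_one_right)
  then show ?thesis by (rule integrable_abs_cancel)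
qed

lemma all_moments_measurable: "all_moments M Z \<Longrightarrow> Z \<in> borel_measurable M"
  by (simp add: all_moments_def)

lemma all_moments_dominated:
  assumes Y: "all_moments M Y" and [measurable]: "Z \<in> borel_measurable M"
    and le: "\<And>x. x \<in> space M \<Longrightarrow> \<bar>Z x\<bar> \<le> \<bar>Y x\<bar>"
  shows "all_moments M Z"
  unfolding all_moments_def
proof (intro conjI allI)
  fix p :: nat
  show "integrable M (\<lambda>x. \<bar>Z x\<bar> ^ p)"
  proof (rule Bochner_Integration.integrable_bound[of M "\<lambda>x. \<bar>Y x\<bar> ^ p"])
    show "integrable M (\<lambda>x. \<bar>Y x\<bar> ^ p)" using Y by (simp add: all_moments_def)
    show "AE x in M. norm (\<bar>Z x\<bar> ^ p) \<le> norm (\<bar>Y x\<bar> ^ p)"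
    proof (rule AE_I2)
      fix x assume "x \<in> space M"
      then have "\<bar>Z x\<bar> ^ p \<le> \<bar>Y x\<bar> ^ p" by (intro power_mono le) simp_all
      then show "norm (\<bar>Z x\<bar> ^ p) \<le> norm (\<bar>Y x\<bar> ^ p)"
        by (simp only: real_norm_def power_abs abs_abs)
    qed
  qed measurable
qed fact

lemma all_moments_const [simp]: "finite_measure M \<Longrightarrow> all_moments M (\<lambda>_. c)"
  by (simp add: all_moments_def finite_measure.integrable_const)

lemma all_moments_mult:
  assumes X: "all_moments M X" and Y: "all_moments M Y"
  shows "all_moments M (\<lambda>x. X x * Y x)"
  unfolding all_moments_def
proof (intro conjI allI)
  have [measurable]: "X \<in> borel_measurable M" "Y \<in> borel_measurable M"
    using assms by (auto simp: all_moments_def)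
  show "(\<lambda>x. X x * Y x) \<in> borel_measurable M" by measurable
  fix p :: nat
  show "integrable M (\<lambda>x. \<bar>X x * Y x\<bar> ^ p)"
  proof (rule Bochner_Integration.integrable_bound[of M "\<lambda>x. \<bar>X x\<bar> ^ (2 * p) + \<bar>Y x\<bar> ^ (2 * p)"])
    show "integrable M (\<lambda>x. \<bar>X x\<bar> ^ (2 * p) + \<bar>Y x\<bar> ^ (2 * p))"
      using assms unfolding all_moments_def by (intro Bochner_Integration.integrable_add) auto
    have "\<bar>a * b\<bar> ^ p \<le> \<bar>a\<bar> ^ (2 * p) + \<bar>b\<bar> ^ (2 * p)" for a b :: real
    proof -
      let ?a = "\<bar>a\<bar> ^ p" and ?b = "\<bar>b\<bar> ^ p"
      have "2 * ?a * ?b \<le> ?a\<^sup>2 + ?b\<^sup>2" by (rule sum_squares_bound)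
      moreover have "?a * ?b \<ge> 0" by simp
      ultimately have "?a * ?b \<le> ?a\<^sup>2 + ?b\<^sup>2" by linarith
      then show ?thesis by (simp only: abs_mult power_mult_distrib power_even_eq)
    qed
    then show "AE x in M. norm (\<bar>X x * Y x\<bar> ^ p) \<le> norm (\<bar>X x\<bar> ^ (2 * p) + \<bar>Y x\<bar> ^ (2 * p))"
      by (intro AE_I2) simp
  qed measurable
qed

lemma all_moments_add:
  assumes X: "all_moments M X" and Y: "all_moments M Y"
  shows "all_moments M (\<lambda>x. X x + Y x)"
  unfolding all_moments_def
proof (intro conjI allI)
  have [measurable]: "X \<in> borel_measurable M" "Y \<in> borel_measurable M"
    using assms by (auto simp: all_moments_def)
  show "(\<lambda>x. X x + Y x) \<in> borel_measurable M" by measurable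
  fix p :: nat
  show "integrable M (\<lambda>x. \<bar>X x + Y x\<bar> ^ p)"
  proof (rule Bochner_Integration.integrable_bound[of M "\<lambda>x. 2 ^ p * (\<bar>X x\<bar> ^ p + \<bar>Y x\<bar> ^ p)"])
    show "integrable M (\<lambda>x. 2 ^ p * (\<bar>X x\<bar> ^ p + \<bar>Y x\<bar> ^ p))"
      using assms unfolding all_moments_def
      by (intro integrable_mult_right Bochner_Integration.integrable_add) auto
    have "\<bar>a + b\<bar> ^ p \<le> 2 ^ p * (\<bar>a\<bar> ^ p + \<bar>b\<bar> ^ p)" for a b :: real
    proof -
      have "\<bar>a + b\<bar> ^ p \<le> (2 * max \<bar>a\<bar> \<bar>b\<bar>) ^ p" by (intro power_mono) auto
      also have "\<dots> = 2 ^ p * max \<bar>a\<bar> \<bar>b\<bar> ^ p" by (simp add: power_mult_distrib)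
      also have "\<dots> \<le> 2 ^ p * (\<bar>a\<bar> ^ p + \<bar>b\<bar> ^ p)"
        by (intro mult_left_mono) (auto simp: max_def)
      finally show ?thesis .
    qed
    then show "AE x in M. norm (\<bar>X x + Y x\<bar> ^ p) \<le> norm (2 ^ p * (\<bar>X x\<bar> ^ p + \<bar>Y x\<bar> ^ p))"
      by (intro AE_I2) simp
  qed measurable
qed

lemma all_moments_sum:
  assumes "finite_measure M" "\<And>i. i \<in> I \<Longrightarrow> all_moments M (X i)"
  shows "all_moments M (\<lambda>x. \<Sum>i\<in>I. X i x)"
  using assms(2)
proof (induction I rule: infinite_finite_induct)
  case (insert i I)
  have "all_moments M (X i)" by (rule insert.prems) simp
  moreover have "all_moments M (\<lambda>x. \<Sum>i\<in>I. X i x)" by (rule insert.IH) (rule insert.prems, simp)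
  ultimately show ?case using insert.hyps by (simp add: all_moments_add)
qed (simp_all add: assms(1))

lemma all_moments_prod:
  assumes "finite_measure M" "\<And>i. i \<in> I \<Longrightarrow> all_moments M (X i)"
  shows "all_moments M (\<lambda>x. \<Prod>i\<in>I. X i x)"
  using assms(2)
proof (induction I rule: infinite_finite_induct)
  case (insert i I)
  have "all_moments M (X i)" by (rule insert.prems) simp
  moreover have "all_moments M (\<lambda>x. \<Prod>i\<in>I. X i x)" by (rule insert.IH) (rule insert.prems, simp)
  ultimately show ?case using insert.hyps by (simp add: all_moments_mult)
qed (simp_all add: assms(1))

definition network_field ::
  "'a set \<Rightarrow> ('a \<Rightarrow> 'a \<Rightarrow> real) \<Rightarrow> ('a \<Rightarrow> real) \<Rightarrow> ('a \<Rightarrow> real) measure" where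
  "network_field V W \<eta> = density (field_space V) (\<lambda>u. ennreal (field_density V W \<eta> u))"

lemma measurable_network_field [simp]:
  "measurable (network_field V W \<eta>) N = measurable (field_space V) N"
  by (rule measurable_cong_sets) (simp_all add: network_field_def)

lemma nn_integral_network_field:
  assumes "F \<in> borel_measurable (field_space V)"
  shows "(\<integral>\<^sup>+u. F u \<partial>network_field V W \<eta>) = field_integral V W \<eta> F"
  unfolding network_field_def field_integral_def using assms
  by (subst nn_integral_density) (auto simp: mult.commute)

lemma prob_space_network_field:
  assumes "network V W \<eta>"
  shows "prob_space (network_field V W \<eta>)"
proof
  show "emeasure (network_field V W \<eta>) (space (network_field V W \<eta>)) = 1"
    using nn_integral_network_field[of "\<lambda>_. 1" V W \<eta>] field_integral_const[OF assms, of 1] by simp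
qed

lemma power_le_fact_exp:
  fixes x :: real
  assumes "x \<ge> 0"
  shows "x ^ p \<le> fact p * 2 ^ p * exp (x / 2)"
proof -
  define y where "y = x / 2"
  have s: "(\<lambda>n. y ^ n /\<^sub>R fact n) sums exp y" by (rule exp_converges)
  have "(\<Sum>n\<in>{p}. y ^ n /\<^sub>R fact n) \<le> (\<Sum>n. y ^ n /\<^sub>R fact n)"
    using sums_summable[OF s] assms by (intro sum_le_suminf) (auto simp: y_def)
  then have "y ^ p / fact p \<le> exp y"
    using sums_unique[OF s] by (simp add: divide_inverse mult.commute)
  then have "y ^ p \<le> fact p * exp y" by (simp add: field_simps)
  then have "2 ^ p * y ^ p \<le> 2 ^ p * (fact p * exp y)" by (intro mult_left_mono) simp_all
  then show ?thesis by (simp add: y_def power_divide mult_ac)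
qed

lemma field_beta_nonneg:
  assumes net: "network V W \<eta>" and i: "i \<in> V"
  shows "field_beta V W \<eta> u i \<ge> 0"
  using networkD(3,4)[OF net] i
  by (auto simp: field_beta_def inflow_def intro!: mult_nonneg_nonneg add_nonneg_nonneg sum_nonneg)

text \<open>All of \<open>\<beta>\<close>, \<open>H\<close> and \<open>\<langle>\<eta>, e\<^sup>u\<rangle>\<close> are linear in the weights.\<close>

lemma field_density_scale:
  assumes "finite V"
  shows "field_density V W \<eta> u * exp (((\<Sum>i\<in>V. field_beta V W \<eta> u i) + (\<Sum>i\<in>V. \<eta> i * exp (u i)) / 2) / 2)
   = exp ((\<Sum>i\<in>V. \<Sum>j\<in>V. W i j) / 4 + (\<Sum>i\<in>V. \<eta> i) / 2) * sqrt (2 ^ card V)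
     * field_density V (\<lambda>i j. W i j / 2) (\<lambda>i. \<eta> i / 2) u"
proof -
  have vb: "field_beta V (\<lambda>i j. W i j / 2) (\<lambda>i. \<eta> i / 2) u i = field_beta V W \<eta> u i / 2" for i
  proof -
    have "inflow V (\<lambda>i j. W i j / 2) (\<lambda>i. \<eta> i / 2) u i = inflow V W \<eta> u i / 2"
      by (simp add: inflow_def sum_divide_distrib add_divide_distrib)
    then show ?thesis by (simp add: field_beta_def)
  qed
  have "H_matrix V (\<lambda>i j. W i j / 2) (\<lambda>i. \<eta> i / 2) u = (\<lambda>i j. H_matrix V W \<eta> u i j / 2)"
    by (auto simp: fun_eq_iff H_matrix_def vb diff_divide_distrib)
  then have "det_on V (H_matrix V (\<lambda>i j. W i j / 2) (\<lambda>i. \<eta> i / 2) u) = det_on V (H_matrix V W \<eta> u) / 2 ^ card V"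
    by (simp add: det_on_def prod_dividef flip: sum_divide_distrib)
  then have d: "sqrt (det_on V (H_matrix V W \<eta> u)) = sqrt (2 ^ card V) * sqrt (det_on V (H_matrix V (\<lambda>i j. W
      i j / 2) (\<lambda>i. \<eta> i / 2) u))"
    by (simp add: real_sqrt_mult[symmetric])
  let ?B = "\<Sum>i\<in>V. field_beta V W \<eta> u i" and ?P = "\<Sum>i\<in>V. \<eta> i * exp (u i)"
    and ?w = "\<Sum>i\<in>V. \<Sum>j\<in>V. W i j" and ?e = "\<Sum>i\<in>V. \<eta> i"
  have "exp (- ?B - ?P / 2 + ?w / 2 + ?e) * exp ((?B + ?P / 2) / 2)
     = exp (?w / 4 + ?e / 2) * exp (- (?B / 2) - (?P / 2) / 2 + (?w / 2) / 2 + ?e / 2)"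
    unfolding exp_add[symmetric] by (simp add: field_simps)
  moreover have "(\<Sum>i\<in>V. field_beta V W \<eta> u i / 2) = ?B / 2" "(\<Sum>i\<in>V. \<eta> i / 2 * exp (u i)) = ?P / 2"
    "(\<Sum>i\<in>V. \<Sum>j\<in>V. W i j / 2) = ?w / 2" "(\<Sum>i\<in>V. \<eta> i / 2) = ?e / 2"
    by (simp_all add: sum_divide_distrib)
  ultimately show ?thesis unfolding field_density_def d vb by (simp only: mult_ac times_divide_eq_left
      times_divide_eq_right)
qed

text \<open>Halving the weights tilts the density by an exponential of \<open>\<Sum>\<beta> + \<langle>\<eta>, e\<^sup>u\<rangle> / 2\<close>, and the total
  mass is 1 for all weights; so this quantity has an exponential moment.\<close>

lemma all_moments_energy:
  assumes net: "network V W \<eta>"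
  shows "all_moments (network_field V W \<eta>)
    (\<lambda>u. (\<Sum>i\<in>V. field_beta V W \<eta> u i) + (\<Sum>i\<in>V. \<eta> i * exp (u i)) / 2)"
proof -
  note N = networkD[OF net]
  let ?Z = "\<lambda>u. (\<Sum>i\<in>V. field_beta V W \<eta> u i) + (\<Sum>i\<in>V. \<eta> i * exp (u i)) / 2"
  have [measurable]: "?Z \<in> borel_measurable (field_space V)" by measurable
  have Z: "?Z u \<ge> 0" for u
    using field_beta_nonneg[OF net] N(4) by (intro add_nonneg_nonneg sum_nonneg divide_nonneg_pos) auto
  let ?C = "exp ((\<Sum>i\<in>V. \<Sum>j\<in>V. W i j) / 4 + (\<Sum>i\<in>V. \<eta> i) / 2) * sqrt (2 ^ card V)"
  have net2: "network V (\<lambda>i j. W i j / 2) (\<lambda>i. \<eta> i / 2)"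
    using net unfolding network_def grounded_def by simp
  have "(\<integral>\<^sup>+u. ennreal (\<bar>?Z u\<bar> ^ p) \<partial>network_field V W \<eta>) < \<infinity>" for p
  proof -
    have "(\<integral>\<^sup>+u. ennreal (\<bar>?Z u\<bar> ^ p) \<partial>network_field V W \<eta>) = field_integral V W \<eta> (\<lambda>u. ennreal (\<bar>?Z u\<bar> ^ p))"
      by (rule nn_integral_network_field) measurable
    also have "\<dots> \<le> field_integral V (\<lambda>i j. W i j / 2) (\<lambda>i. \<eta> i / 2) (\<lambda>_. ennreal (fact p * 2 ^ p * ?C))"
      unfolding field_integral_def
    proof (rule nn_integral_mono)
      fix u
      have hd: "field_density V W \<eta> u \<ge> 0"
        using det_on_pos[OF N(1) spd_on_H_matrix[OF net], of u] by (simp add: field_density_def)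
      have "\<bar>?Z u\<bar> ^ p * field_density V W \<eta> u \<le> fact p * 2 ^ p * exp (?Z u / 2) * field_density V W \<eta> u"
        using power_le_fact_exp[OF Z[of u], of p] Z[of u] hd by (intro mult_right_mono) simp_all
      also have "\<dots> = fact p * 2 ^ p * (field_density V W \<eta> u * exp (?Z u / 2))" by simp
      also have "\<dots> = fact p * 2 ^ p * ?C * field_density V (\<lambda>i j. W i j / 2) (\<lambda>i. \<eta> i / 2) u"
        unfolding field_density_scale[OF N(1)] by simp
      finally show "ennreal (\<bar>?Z u\<bar> ^ p) * ennreal (field_density V W \<eta> u)
         \<le> ennreal (fact p * 2 ^ p * ?C) * ennreal (field_density V (\<lambda>i j. W i j / 2) (\<lambda>i. \<eta> i / 2) u)"
        by (subst (1 2) ennreal_mult'[symmetric]) (auto intro: ennreal_leI)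
    qed
    also have "\<dots> = ennreal (fact p * 2 ^ p * ?C)" by (rule field_integral_const[OF net2])
    finally show ?thesis by (simp add: le_less_trans)
  qed
  then show ?thesis unfolding all_moments_def
    by (auto intro!: integrableI_bounded)
qed

lemma all_moments_field_beta:
  assumes net: "network V W \<eta>" and i: "i \<in> V"
  shows "all_moments (network_field V W \<eta>) (\<lambda>u. field_beta V W \<eta> u i)"
proof (rule all_moments_dominated[OF all_moments_energy[OF net]])
  fix u
  have "field_beta V W \<eta> u i \<le> (\<Sum>i\<in>V. field_beta V W \<eta> u i)"
    using field_beta_nonneg[OF net] networkD(1)[OF net] i by (intro member_le_sum) auto
  moreover have "(\<Sum>i\<in>V. \<eta> i * exp (u i)) \<ge> 0"
    using networkD(4)[OF net] by (intro sum_nonneg) auto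
  ultimately show "\<bar>field_beta V W \<eta> u i\<bar> \<le> \<bar>(\<Sum>i\<in>V. field_beta V W \<eta> u i) + (\<Sum>i\<in>V. \<eta> i * exp (u i)) / 2\<bar>"
    using field_beta_nonneg[OF net i, of u] by linarith
qed (use i in simp)

text \<open>Row \<open>j\<close> of \<open>H x \<ge> 0\<close> reads \<open>2 \<beta> j * x j \<ge> W j i * x i\<close> up to nonnegative terms, so bounds on \<open>x\<close>
  spread along edges; groundedness makes them reach every vertex from the pinned ones.\<close>

lemma all_moments_superharmonic:
  assumes net: "network V W \<eta>"
    and meas: "\<And>i. i \<in> V \<Longrightarrow> (\<lambda>u. x u i) \<in> borel_measurable (field_space V)"
    and nonneg: "\<And>u i. i \<in> V \<Longrightarrow> x u i \<ge> 0"
    and super: "\<And>u i. i \<in> V \<Longrightarrow> (\<Sum>j\<in>V. H_matrix V W \<eta> u i j * x u j) \<ge> 0"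
    and pinned: "\<And>i. i \<in> V \<Longrightarrow> \<eta> i > 0 \<Longrightarrow> all_moments (network_field V W \<eta>) (\<lambda>u. x u i)"
    and i: "i \<in> V"
  shows "all_moments (network_field V W \<eta>) (\<lambda>u. x u i)"
proof (rule ccontr)
  interpret prob_space "network_field V W \<eta>" by (rule prob_space_network_field[OF net])
  note N = networkD[OF net]
  define S where "S = {i\<in>V. \<not> all_moments (network_field V W \<eta>) (\<lambda>u. x u i)}"
  assume "\<not> ?thesis"
  then have "S \<subseteq> V" "S \<noteq> {}" using i by (auto simp: S_def)
  then obtain k where k: "k \<in> S" "\<eta> k > 0 \<or> (\<exists>j\<in>V - S. W k j > 0)" using N(5) by blast
  then have kV: "k \<in> V" by (simp add: S_def)
  show False
  proof (cases "\<eta> k > 0")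
    case True
    then show False using pinned kV k(1) by (simp add: S_def)
  next
    case False
    with k obtain j where j: "j \<in> V" "j \<notin> S" "W k j > 0" by blast
    have Wjk: "W j k > 0" using N(2)[OF kV j(1)] j(3) by simp
    have "all_moments (network_field V W \<eta>) (\<lambda>u. x u j)" using j by (simp add: S_def)
    then have "all_moments (network_field V W \<eta>) (\<lambda>u. 2 / W j k * field_beta V W \<eta> u j * x u j)"
      by (intro all_moments_mult all_moments_const all_moments_field_beta[OF net j(1)] finite_measure_axioms)
    then have "all_moments (network_field V W \<eta>) (\<lambda>u. x u k)"
    proof (rule all_moments_dominated)
      fix u
      have "0 \<le> (\<Sum>l\<in>V. H_matrix V W \<eta> u j l * x u l)" using super[OF j(1)] .
      also have "\<dots> = (\<Sum>l\<in>V. of_bool (j = l) * (2 * field_beta V W \<eta> u j * x u l)) - (\<Sum>l\<in>V. W j l * x u l)"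
        unfolding sum_subtractf[symmetric] by (intro sum.cong refl) (simp add: H_matrix_def algebra_simps)
      also have "\<dots> = 2 * field_beta V W \<eta> u j * x u j - (\<Sum>l\<in>V. W j l * x u l)"
        by (simp only: sum_of_bool_mult[OF N(1) j(1)])
      finally have "(\<Sum>l\<in>V. W j l * x u l) \<le> 2 * field_beta V W \<eta> u j * x u j" by simp
      moreover have "W j k * x u k \<le> (\<Sum>l\<in>V. W j l * x u l)"
        using N(1) N(3)[OF j(1)] nonneg kV by (intro member_le_sum) auto
      ultimately have "x u k \<le> 2 / W j k * field_beta V W \<eta> u j * x u j"
        using Wjk by (simp add: field_simps)
      then show "\<bar>x u k\<bar> \<le> \<bar>2 / W j k * field_beta V W \<eta> u j * x u j\<bar>"
        using nonneg[OF kV, of u] by linarith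
    qed (use meas[OF kV] in simp)
    then show False using k(1) by (simp add: S_def)
  qed
qed

text \<open>The bound starts at the vertices with \<open>\<eta> i > 0\<close>, where \<open>\<eta> i e\<^bsup>u i\<^esup>\<close> is part of the energy.\<close>

lemma all_moments_exp:
  assumes net: "network V W \<eta>" and i: "i \<in> V"
  shows "all_moments (network_field V W \<eta>) (\<lambda>u. exp (u i))"
proof (rule all_moments_superharmonic[OF net, where x="\<lambda>u i. exp (u i)"])
  interpret prob_space "network_field V W \<eta>" by (rule prob_space_network_field[OF net])
  note N = networkD[OF net]
  show "0 \<le> (\<Sum>j\<in>V. H_matrix V W \<eta> u i j * exp (u j))" if "i \<in> V" for u i
    using H_matrix_exp[OF N(1) that] N(4)[OF that] by simp
  fix i assume i: "i \<in> V" and pos: "\<eta> i > 0"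
  have "all_moments (network_field V W \<eta>)
    (\<lambda>u. 2 / \<eta> i * ((\<Sum>i\<in>V. field_beta V W \<eta> u i) + (\<Sum>i\<in>V. \<eta> i * exp (u i)) / 2))"
    by (intro all_moments_mult all_moments_const all_moments_energy[OF net] finite_measure_axioms)
  then show "all_moments (network_field V W \<eta>) (\<lambda>u. exp (u i))"
  proof (rule all_moments_dominated)
    fix u
    have "\<eta> i * exp (u i) \<le> (\<Sum>i\<in>V. \<eta> i * exp (u i))"
      using N(1,4) i by (intro member_le_sum) auto
    moreover have "(\<Sum>i\<in>V. field_beta V W \<eta> u i) \<ge> 0"
      using field_beta_nonneg[OF net] by (intro sum_nonneg) auto
    ultimately have "\<eta> i * exp (u i) \<le> 2 * ((\<Sum>i\<in>V. field_beta V W \<eta> u i) + (\<Sum>i\<in>V. \<eta> i * exp (u i)) / 2)"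
      by simp
    then have "exp (u i) \<le> 2 / \<eta> i * ((\<Sum>i\<in>V. field_beta V W \<eta> u i) + (\<Sum>i\<in>V. \<eta> i * exp (u i)) / 2)"
      using pos by (simp add: field_simps)
    then show "\<bar>exp (u i)\<bar> \<le> \<bar>2 / \<eta> i * ((\<Sum>i\<in>V. field_beta V W \<eta> u i) + (\<Sum>i\<in>V. \<eta> i * exp (u i)) / 2)\<bar>"
      unfolding abs_exp_cancel by (rule order_trans[OF _ abs_ge_self])
  qed (use i in simp)
qed (use i in auto)

text \<open>\<open>H\<close> is a positive definite matrix with nonpositive off-diagonal entries: testing \<open>H x \<ge> 0\<close> against the
  negative part of \<open>x\<close> shows that this part vanishes.\<close>

lemma inverse_on_H_matrix_nonneg:
  assumes net: "network V W \<eta>" and ij: "i \<in> V" "j \<in> V"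
  shows "inverse_on V (H_matrix V W \<eta> u) i j \<ge> 0"
proof -
  note N = networkD[OF net]
  let ?H = "H_matrix V W \<eta> u"
  define x where "x l = inverse_on V ?H l j" for l
  define n where "n l = max 0 (- x l)" for l
  define p where "p l = max 0 (x l)" for l
  have xpn: "x l = p l - n l" and pn: "p l * n l = 0" "n l * p l = 0" "p l \<ge> 0" "n l \<ge> 0" for l
    by (auto simp: p_def n_def max_def)
  have "(\<Sum>a\<in>V. n a * (\<Sum>b\<in>V. ?H a b * x b)) = (\<Sum>a\<in>V. n a * of_bool (a = j))"
    unfolding x_def using inverse_on_spec(2)[OF N(1) spd_on_H_matrix[OF net]] ij(2) by (intro sum.cong) auto
  then have 1: "(\<Sum>a\<in>V. n a * (\<Sum>b\<in>V. ?H a b * x b)) \<ge> 0"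
    using pn(4) by (simp add: sum_nonneg)
  have "(\<Sum>a\<in>V. n a * (\<Sum>b\<in>V. ?H a b * x b))
     = (\<Sum>a\<in>V. \<Sum>b\<in>V. n a * ?H a b * p b) - (\<Sum>a\<in>V. \<Sum>b\<in>V. n a * ?H a b * n b)"
    unfolding sum_subtractf[symmetric] sum_distrib_left
    by (intro sum.cong refl) (simp add: xpn algebra_simps)
  moreover have "(\<Sum>a\<in>V. \<Sum>b\<in>V. n a * ?H a b * p b) \<le> 0"
  proof (intro sum_nonpos)
    fix a b assume ab: "a \<in> V" "b \<in> V"
    have "n a * ?H a b * p b = - (n a * W a b * p b)"
      using pn(2)[of a] by (auto simp: H_matrix_def algebra_simps)
    also have "\<dots> \<le> 0" using N(3)[OF ab] pn(3,4) by simp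
    finally show "n a * ?H a b * p b \<le> 0" .
  qed
  ultimately have "(\<Sum>a\<in>V. \<Sum>b\<in>V. n a * ?H a b * n b) \<le> 0" using 1 by linarith
  then have "\<forall>a\<in>V. n a = 0"
    using spd_on_H_matrix[OF net, of u] unfolding spd_on_def pos_def_on_def by (meson not_less)
  then have "n i = 0" using ij by blast
  then show ?thesis by (simp add: n_def x_def max_def split: if_splits)
qed

text \<open>At a vertex with \<open>\<eta> i > 0\<close> the bound comes from \<open>G k i \<eta> i \<le> \<Sum>\<^sub>l G k l \<eta> l = e\<^bsup>u k\<^esup>\<close>, as all entries
  of \<open>G\<close> are nonnegative.\<close>

lemma all_moments_inverse_on_H_matrix:
  assumes net: "network V W \<eta>" and i: "i \<in> V" and k: "k \<in> V"
  shows "all_moments (network_field V W \<eta>) (\<lambda>u. inverse_on V (H_matrix V W \<eta> u) i k)"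
proof (rule all_moments_superharmonic[OF net, where x="\<lambda>u i. inverse_on V (H_matrix V W \<eta> u) i k"])
  interpret prob_space "network_field V W \<eta>" by (rule prob_space_network_field[OF net])
  note N = networkD[OF net]
  have meas: "(\<lambda>u. inverse_on V (H_matrix V W \<eta> u) i j) \<in> borel_measurable (field_space V)" for i j
    by (rule borel_measurable_inverse_on[OF N(1) spd_on_H_matrix[OF net]]) measurable
  then show "(\<lambda>u. inverse_on V (H_matrix V W \<eta> u) i k) \<in> borel_measurable (field_space V)" for i .
  show "0 \<le> inverse_on V (H_matrix V W \<eta> u) i k" if "i \<in> V" for u i
    by (rule inverse_on_H_matrix_nonneg[OF net that k])
  show "0 \<le> (\<Sum>j\<in>V. H_matrix V W \<eta> u i j * inverse_on V (H_matrix V W \<eta> u) j k)" if "i \<in> V" for u i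
    using inverse_on_spec(2)[OF N(1) spd_on_H_matrix[OF net] that k] by simp
  fix i assume i: "i \<in> V" and pos: "\<eta> i > 0"
  have "all_moments (network_field V W \<eta>) (\<lambda>u. 1 / \<eta> i * exp (u k))"
    by (intro all_moments_mult all_moments_const all_moments_exp[OF net k] finite_measure_axioms)
  then show "all_moments (network_field V W \<eta>) (\<lambda>u. inverse_on V (H_matrix V W \<eta> u) i k)"
  proof (rule all_moments_dominated)
    fix u
    let ?G = "inverse_on V (H_matrix V W \<eta> u)"
    have "exp (u k) = (\<Sum>l\<in>V. ?G k l * \<eta> l)"
      by (rule inverse_on_solution[OF N(1) spd_on_H_matrix[OF net] H_matrix_exp[OF N(1)] k])
    moreover have "?G k i * \<eta> i \<le> (\<Sum>l\<in>V. ?G k l * \<eta> l)"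
      using N(1,4) i inverse_on_H_matrix_nonneg[OF net k] by (intro member_le_sum) auto
    moreover have "?G k i = ?G i k" by (rule inverse_on_spec(4)[OF N(1) spd_on_H_matrix[OF net]])
    ultimately have "?G i k \<le> 1 / \<eta> i * exp (u k)" using pos by (simp add: field_simps)
    then show "\<bar>?G i k\<bar> \<le> \<bar>1 / \<eta> i * exp (u k)\<bar>"
      using inverse_on_H_matrix_nonneg[OF net i k, of u] by linarith
  qed (use meas in simp)
qed (rule i)

section \<open>Wick polynomials\<close>

text \<open>Summing over partial pairings \<open>P\<close> instead of a set \<open>I\<close> and a pairing of it (the set is \<open>\<Union>P\<close>) gives
  the recursion in one index that the differentiation below produces.\<close>

definition matchings :: "'b set \<Rightarrow> 'b set set set" where
  "matchings J = {P. disjoint P \<and> (\<forall>p\<in>P. card p = 2) \<and> \<Union>P \<subseteq> J}"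

definition wick :: "nat set \<Rightarrow> (nat \<Rightarrow> real) \<Rightarrow> (nat \<Rightarrow> nat \<Rightarrow> real) \<Rightarrow> real" where
  "wick J Z Y = (\<Sum>P\<in>matchings J. (-1) ^ card P * (\<Prod>j\<in>J - \<Union>P. Z j) * (\<Prod>p\<in>P. Y (Min p) (Max p)))"

lemma finite_matchings: "finite J \<Longrightarrow> finite (matchings J)"
  by (rule finite_subset[of _ "Pow (Pow J)"]) (auto simp: matchings_def)

lemma finite_matching: "finite J \<Longrightarrow> P \<in> matchings J \<Longrightarrow> finite P"
  by (rule finite_subset[of _ "Pow J"]) (auto simp: matchings_def)

lemma card_Union_matching:
  assumes "finite J" "P \<in> matchings J"
  shows "card (\<Union>P) = 2 * card P"
proof -
  have P: "disjoint P" "\<And>p. p \<in> P \<Longrightarrow> card p = 2" using assms by (auto simp: matchings_def)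
  have "card (\<Union>P) = (\<Sum>p\<in>P. card p)"
    using P by (intro card_Union_disjoint) (auto simp: pairwise_def disjnt_def disjoint_def intro:
        card_ge_0_finite)
  then show ?thesis using P(2) by simp
qed

lemma sum_pairings_eq_sum_matchings:
  assumes J: "finite J"
  shows "(\<Sum>I | I \<subseteq> J \<and> even (card I). \<Sum>P\<in>pairings I. g I P) = (\<Sum>P\<in>matchings J. g (\<Union>P) P)"
proof -
  have fin: "finite {I. I \<subseteq> J \<and> even (card I)}" using J by simp
  have "finite (pairings I)" if "I \<subseteq> J" for I
  proof (rule finite_subset)
    show "pairings I \<subseteq> matchings J" using that by (auto simp: pairings_def matchings_def partition_on_def)
  qed (rule finite_matchings[OF J])
  then have "(\<Sum>I | I \<subseteq> J \<and> even (card I). \<Sum>P\<in>pairings I. g I P)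
      = (\<Sum>(I, P)\<in>Sigma {I. I \<subseteq> J \<and> even (card I)} pairings. g I P)"
    using fin by (intro sum.Sigma) auto
  also have "\<dots> = (\<Sum>P\<in>matchings J. g (\<Union>P) P)"
  proof (rule sum.reindex_bij_witness[of _ "\<lambda>P. (\<Union>P, P)" snd])
    fix P assume P: "P \<in> matchings J"
    then have "{} \<notin> P" by (auto simp: matchings_def)
    then show "(\<Union>P, P) \<in> Sigma {I. I \<subseteq> J \<and> even (card I)} pairings"
      using P card_Union_matching[OF J P] by (auto simp: matchings_def pairings_def partition_on_def)
  next
    fix IP assume "IP \<in> Sigma {I. I \<subseteq> J \<and> even (card I)} pairings"
    then obtain I P where IP: "IP = (I, P)" "I \<subseteq> J" "P \<in> pairings I" by blast
    then have U: "\<Union>P = I" by (simp add: pairings_def partition_on_def)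
    then show "(\<Union>(snd IP), snd IP) = IP" "g (\<Union>(snd IP)) (snd IP) = (case IP of (I, P) \<Rightarrow> g I P)"
      using IP by simp_all
    show "snd IP \<in> matchings J"
      using IP U by (simp add: pairings_def partition_on_def matchings_def)
  qed simp
  finally show ?thesis .
qed

text \<open>The index \<open>k\<close> is either unmatched or matched with exactly one \<open>l\<close>.\<close>

lemma matchings_insert:
  assumes "k \<notin> J"
  shows "matchings (insert k J) = matchings J \<union> (\<Union>l\<in>J. insert {k, l} ` matchings (J - {l}))" (is "?L = ?R")
proof (rule set_eqI, rule iffI)
  fix P assume P: "P \<in> ?L"
  show "P \<in> ?R"
  proof (cases "k \<in> \<Union>P")
    case False
    then show ?thesis using P by (auto simp: matchings_def)
  next
    case True
    then obtain p where p: "p \<in> P" "k \<in> p" by blast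
    have "card p = 2" using P p by (auto simp: matchings_def)
    then obtain l where l: "p = {k, l}" "l \<noteq> k"
      using p(2) by (metis card_2_iff insert_iff singletonD insert_commute)
    have lJ: "l \<in> J" using P p(1) l by (auto simp: matchings_def)
    have dj: "q \<inter> p = {}" if "q \<in> P - {p}" for q
      using P p(1) that by (auto simp: matchings_def disjoint_def)
    have "P - {p} \<in> matchings (J - {l})"
      using P dj l by (fastforce simp: matchings_def disjoint_def)
    moreover have "P = insert {k, l} (P - {p})" using p l by auto
    ultimately show ?thesis using lJ by blast
  qed
next
  fix P assume "P \<in> ?R"
  then consider "P \<in> matchings J" | l Q where "l \<in> J" "Q \<in> matchings (J - {l})" "P = insert {k, l} Q" by blast
  then show "P \<in> ?L"
  proof cases
    case 1
    then show ?thesis by (auto simp: matchings_def)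
  next
    case 2
    have "q \<inter> {k, l} = {}" if "q \<in> Q" for q using 2 that assms by (auto simp: matchings_def)
    moreover have "k \<noteq> l" using 2(1) assms by blast
    then have "card {k, l} = 2" by simp
    ultimately show ?thesis using 2 by (auto simp: matchings_def disjoint_def)
  qed
qed

lemma sum_matchings_insert:
  assumes J: "finite J" and k: "k \<notin> J"
  shows "(\<Sum>P\<in>matchings (insert k J). g P)
    = (\<Sum>P\<in>matchings J. g P) + (\<Sum>l\<in>J. \<Sum>P\<in>matchings (J - {l}). g (insert {k, l} P))"
proof -
  have kP: "k \<notin> q" if "q \<in> P" "P \<in> matchings J'" "J' \<subseteq> J" for q P J'
    using that k by (auto simp: matchings_def)
  have kl: "{k, l} \<notin> P" if "P \<in> matchings J'" "J' \<subseteq> J" for l P J'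
    using kP[OF _ that, of "{k, l}"] by auto
  have inj: "inj_on (insert {k, l}) (matchings (J - {l}))" for l
    by (rule inj_onI) (metis Diff_subset insert_ident kl)
  have "(\<Sum>P\<in>matchings (insert k J). g P)
     = (\<Sum>P\<in>matchings J. g P) + (\<Sum>P\<in>(\<Union>l\<in>J. insert {k, l} ` matchings (J - {l})). g P)"
    unfolding matchings_insert[OF k]
    by (rule sum.union_disjoint) (use J kl in \<open>auto simp: finite_matchings\<close>)
  also have "(\<Sum>P\<in>(\<Union>l\<in>J. insert {k, l} ` matchings (J - {l})). g P)
     = (\<Sum>l\<in>J. \<Sum>P\<in>insert {k, l} ` matchings (J - {l}). g P)"
  proof (rule sum.UNION_disjoint)
    show "\<forall>l\<in>J. \<forall>l'\<in>J. l \<noteq> l' \<longrightarrow> insert {k, l} ` matchings (J - {l}) \<inter> insert {k, l'} ` matchings (J - {l'})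
        = {}"
    proof (intro ballI impI equals0I)
      fix l l' P assume "l \<in> J" "l' \<in> J" "l \<noteq> l'"
        "P \<in> insert {k, l} ` matchings (J - {l}) \<inter> insert {k, l'} ` matchings (J - {l'})"
      then obtain Q Q' where Q: "Q' \<in> matchings (J - {l'})" "insert {k, l} Q = insert {k, l'} Q'" by auto
      have "{k, l} \<notin> Q'" by (rule kl[OF Q(1)]) auto
      then have "{k, l} = {k, l'}" using Q(2) by blast
      then show False using \<open>l \<noteq> l'\<close> by (auto simp: doubleton_eq_iff)
    qed
  qed (use J in \<open>auto simp: finite_matchings\<close>)
  also have "\<dots> = (\<Sum>l\<in>J. \<Sum>P\<in>matchings (J - {l}). g (insert {k, l} P))"
    by (rule sum.cong[OF refl]) (simp add: sum.reindex[OF inj])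
  finally show ?thesis .
qed

lemma wick_empty [simp]: "wick {} Z Y = 1"
proof -
  have "P = {}" if "P \<in> matchings {}" for P :: "nat set set"
  proof (rule ccontr)
    assume "P \<noteq> {}"
    then obtain p where p: "p \<in> P" by blast
    then have "p = {}" "card p = 2" using that by (auto simp: matchings_def)
    then show False by simp
  qed
  then have "matchings {} = {{} :: nat set set}"
    by (auto simp: matchings_def)
  then show ?thesis by (simp add: wick_def)
qed

text \<open>The recursion of the multivariate Hermite polynomials.\<close>

lemma wick_insert:
  assumes J: "finite J" and k: "k \<notin> J" and sym: "\<And>i j. Y i j = Y j i"
  shows "wick (insert k J) Z Y = Z k * wick J Z Y - (\<Sum>l\<in>J. Y k l * wick (J - {l}) Z Y)"
proof -
  let ?g = "\<lambda>J P. (-1) ^ card P * (\<Prod>j\<in>J - \<Union>P. Z j) * (\<Prod>p\<in>P. Y (Min p) (Max p))"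
  have 1: "?g (insert k J) P = Z k * ?g J P" if P: "P \<in> matchings J" for P
  proof -
    have "insert k J - \<Union>P = insert k (J - \<Union>P)" using P k by (auto simp: matchings_def)
    then show ?thesis using J k by simp
  qed
  have 2: "?g (insert k J) (insert {k, l} P) = - (Y k l * ?g (J - {l}) P)"
    if l: "l \<in> J" and P: "P \<in> matchings (J - {l})" for l P
  proof -
    have "insert k J - \<Union>(insert {k, l} P) = (J - {l}) - \<Union>P" using k by auto
    moreover have "{k, l} \<notin> P" using P by (auto simp: matchings_def)
    moreover have "finite P" using finite_matching[OF _ P] J by simp
    moreover have "Y (Min {k, l}) (Max {k, l}) = Y k l" using sym by (auto simp: min_def max_def)
    ultimately show ?thesis by simp
  qed
  have "(\<Sum>P\<in>matchings J. ?g (insert k J) P) = Z k * wick J Z Y"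
    unfolding wick_def sum_distrib_left by (rule sum.cong[OF refl]) (rule 1)
  moreover have "(\<Sum>l\<in>J. \<Sum>P\<in>matchings (J - {l}). ?g (insert k J) (insert {k, l} P))
      = - (\<Sum>l\<in>J. Y k l * wick (J - {l}) Z Y)"
    unfolding wick_def sum_distrib_left sum_negf[symmetric]
    by (rule sum.cong[OF refl], rule sum.cong[OF refl]) (rule 2)
  ultimately show ?thesis unfolding wick_def[of "insert k J"] sum_matchings_insert[OF J k] by simp
qed

text \<open>Differentiating the factor of an unmatched \<open>l\<close> removes \<open>l\<close>, and the matchings of \<open>J\<close> that avoid \<open>l\<close>
  are the matchings of \<open>J - {l}\<close>.\<close>

lemma wick_has_derivative:
  assumes J: "finite J" and Z: "\<And>j. j \<in> J \<Longrightarrow> ((\<lambda>\<tau>. Z \<tau> j) has_real_derivative D j) (at \<tau>)"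
  shows "((\<lambda>\<tau>. wick J (Z \<tau>) Y) has_real_derivative (\<Sum>l\<in>J. D l * wick (J - {l}) (Z \<tau>) Y)) (at \<tau>)"
proof -
  let ?c = "\<lambda>P. (-1) ^ card P :: real" and ?y = "\<lambda>P. \<Prod>p\<in>P. Y (Min p) (Max p)"
  have prod: "((\<lambda>\<tau>. \<Prod>j\<in>K. Z \<tau> j) has_real_derivative (\<Sum>l\<in>K. D l * (\<Prod>j\<in>K - {l}. Z \<tau> j))) (at \<tau>)"
    if "K \<subseteq> J" for K
  proof (rule has_field_derivative_prod)
    fix j assume "j \<in> K"
    then show "((\<lambda>\<tau>. Z \<tau> j) has_real_derivative D j) (at \<tau>)" using that by (intro Z) auto
  qed
  have "((\<lambda>\<tau>. wick J (Z \<tau>) Y) has_real_derivative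
     (\<Sum>P\<in>matchings J. ?c P * (\<Sum>l\<in>J - \<Union>P. D l * (\<Prod>j\<in>J - \<Union>P - {l}. Z \<tau> j)) * ?y P)) (at \<tau>)"
    unfolding wick_def
    by (intro DERIV_sum DERIV_cmult DERIV_cmult_right prod) auto
  also have "(\<Sum>P\<in>matchings J. ?c P * (\<Sum>l\<in>J - \<Union>P. D l * (\<Prod>j\<in>J - \<Union>P - {l}. Z \<tau> j)) * ?y P)
      = (\<Sum>P\<in>matchings J. \<Sum>l | l \<in> J \<and> l \<notin> \<Union>P. D l * (?c P * (\<Prod>j\<in>J - {l} - \<Union>P. Z \<tau> j) * ?y P))"
  proof (rule sum.cong[OF refl])
    fix P
    have "{l. l \<in> J \<and> l \<notin> \<Union>P} = J - \<Union>P" by auto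
    moreover have "J - \<Union>P - {l} = J - {l} - \<Union>P" for l by auto
    ultimately show "?c P * (\<Sum>l\<in>J - \<Union>P. D l * (\<Prod>j\<in>J - \<Union>P - {l}. Z \<tau> j)) * ?y P
      = (\<Sum>l | l \<in> J \<and> l \<notin> \<Union>P. D l * (?c P * (\<Prod>j\<in>J - {l} - \<Union>P. Z \<tau> j) * ?y P))"
      by (simp add: sum_distrib_left sum_distrib_right mult_ac)
  qed
  also have "\<dots> = (\<Sum>l\<in>J. \<Sum>P | P \<in> matchings J \<and> l \<notin> \<Union>P. D l * (?c P * (\<Prod>j\<in>J - {l} - \<Union>P. Z \<tau> j) * ?y P))"
    by (rule sum.swap_restrict[OF finite_matchings[OF J] J])
  also have "\<dots> = (\<Sum>l\<in>J. D l * wick (J - {l}) (Z \<tau>) Y)"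
  proof (rule sum.cong[OF refl])
    fix l
    have "{P. P \<in> matchings J \<and> l \<notin> \<Union>P} = matchings (J - {l})"
      by (auto simp: matchings_def)
    then show "(\<Sum>P | P \<in> matchings J \<and> l \<notin> \<Union>P. D l * (?c P * (\<Prod>j\<in>J - {l} - \<Union>P. Z \<tau> j) * ?y P))
       = D l * wick (J - {l}) (Z \<tau>) Y"
      by (simp add: wick_def sum_distrib_left)
  qed
  finally show ?thesis .
qed

lemma abs_wick_le:
  assumes "\<And>j. j \<in> J \<Longrightarrow> \<bar>Z j\<bar> \<le> B j"
  shows "\<bar>wick J Z Y\<bar> \<le> (\<Sum>P\<in>matchings J. (\<Prod>j\<in>J - \<Union>P. B j) * (\<Prod>p\<in>P. \<bar>Y (Min p) (Max p)\<bar>))"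
proof -
  have "\<bar>wick J Z Y\<bar> \<le> (\<Sum>P\<in>matchings J. \<bar>(-1) ^ card P * (\<Prod>j\<in>J - \<Union>P. Z j) * (\<Prod>p\<in>P. Y (Min p) (Max p))\<bar>)"
    unfolding wick_def by (rule sum_abs)
  also have "\<dots> \<le> (\<Sum>P\<in>matchings J. (\<Prod>j\<in>J - \<Union>P. B j) * (\<Prod>p\<in>P. \<bar>Y (Min p) (Max p)\<bar>))"
  proof (rule sum_mono)
    fix P
    have "(\<Prod>j\<in>J - \<Union>P. \<bar>Z j\<bar>) \<le> (\<Prod>j\<in>J - \<Union>P. B j)" using assms by (intro prod_mono) auto
    then show "\<bar>(-1) ^ card P * (\<Prod>j\<in>J - \<Union>P. Z j) * (\<Prod>p\<in>P. Y (Min p) (Max p))\<bar>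
       \<le> (\<Prod>j\<in>J - \<Union>P. B j) * (\<Prod>p\<in>P. \<bar>Y (Min p) (Max p)\<bar>)"
      by (simp add: abs_mult power_abs abs_prod mult_right_mono prod_nonneg)
  qed
  finally show ?thesis .
qed

lemma all_moments_wick:
  assumes "finite_measure M" "\<And>j. all_moments M (\<lambda>\<omega>. Z \<omega> j)" "\<And>i j. all_moments M (\<lambda>\<omega>. Y \<omega> i j)"
  shows "all_moments M (\<lambda>\<omega>. wick J (Z \<omega>) (Y \<omega>))"
  unfolding wick_def
  by (intro all_moments_sum all_moments_mult all_moments_prod all_moments_const assms)

section \<open>Extracting the Wick polynomial from its generating function\<close>

text \<open>The difference quotient is one-sided, since the generating function is available for nonnegative
  parameters only.\<close>

lemma difference_quotient_integral_limit:
  fixes f f' :: "real \<Rightarrow> 'w \<Rightarrow> real"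
  assumes f: "\<And>\<tau>. 0 \<le> \<tau> \<Longrightarrow> \<tau> \<le> 1 \<Longrightarrow> integrable M (f \<tau>)"
    and deriv: "\<And>\<tau> \<omega>. \<omega> \<in> space M \<Longrightarrow> 0 \<le> \<tau> \<Longrightarrow> \<tau> \<le> 1 \<Longrightarrow> ((\<lambda>\<tau>. f \<tau> \<omega>) has_real_derivative f' \<tau> \<omega>) (at \<tau>)"
    and bound: "\<And>\<tau> \<omega>. \<omega> \<in> space M \<Longrightarrow> 0 \<le> \<tau> \<Longrightarrow> \<tau> \<le> 1 \<Longrightarrow> \<bar>f' \<tau> \<omega>\<bar> \<le> B \<omega>"
    and B: "integrable M B"
  shows "(\<lambda>n. ((\<integral>\<omega>. f (inverse (real (Suc n))) \<omega> \<partial>M) - (\<integral>\<omega>. f 0 \<omega> \<partial>M)) / inverse (real (Suc n)))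
     \<longlonglongrightarrow> (\<integral>\<omega>. f' 0 \<omega> \<partial>M)"
proof -
  define h where "h n = inverse (real (Suc n))" for n
  have h: "0 < h n" "h n \<le> 1" for n by (auto simp: h_def inverse_le_1_iff)
  define s where "s n \<omega> = (f (h n) \<omega> - f 0 \<omega>) / h n" for n \<omega>
  have [measurable]: "f 0 \<in> borel_measurable M" "f (h n) \<in> borel_measurable M" for n
    using f[of 0] f[of "h n"] h[of n] by (auto intro: borel_measurable_integrable)
  have s [measurable]: "s n \<in> borel_measurable M" for n unfolding s_def by measurable
  have lim: "(\<lambda>n. s n \<omega>) \<longlonglongrightarrow> f' 0 \<omega>" if \<omega>: "\<omega> \<in> space M" for \<omega>
  proof -
    have "((\<lambda>t. (f (0 + t) \<omega> - f 0 \<omega>) / t) \<longlongrightarrow> f' 0 \<omega>) (at 0)"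
      using deriv[OF \<omega>, of 0] by (simp add: DERIV_def)
    moreover have "filterlim h (at 0) sequentially"
    proof -
      have "h \<longlonglongrightarrow> 0" using LIMSEQ_inverse_real_of_nat by (simp add: h_def[abs_def])
      moreover have "h n \<noteq> 0" for n using h(1)[of n] by simp
      ultimately show ?thesis unfolding filterlim_at by simp
    qed
    ultimately have "((\<lambda>n. (f (0 + h n) \<omega> - f 0 \<omega>) / h n) \<longlongrightarrow> f' 0 \<omega>) sequentially"
      by (rule filterlim_compose)
    then show ?thesis by (simp add: s_def)
  qed
  have "(\<lambda>n. \<integral>\<omega>. s n \<omega> \<partial>M) \<longlonglongrightarrow> (\<integral>\<omega>. f' 0 \<omega> \<partial>M)"
  proof (rule integral_dominated_convergence[where w=B])
    show "(\<lambda>\<omega>. f' 0 \<omega>) \<in> borel_measurable M"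
      by (rule borel_measurable_LIMSEQ_real[of _ s, OF lim s])
    show "AE \<omega> in M. (\<lambda>n. s n \<omega>) \<longlonglongrightarrow> f' 0 \<omega>" using lim by (intro AE_I2)
    show "AE \<omega> in M. norm (s n \<omega>) \<le> B \<omega>" for n
    proof (rule AE_I2)
      fix \<omega> assume \<omega>: "\<omega> \<in> space M"
      obtain z where z: "0 < z" "z < h n" "f (h n) \<omega> - f 0 \<omega> = (h n - 0) * f' z \<omega>"
        using MVT2[OF h(1)[of n], of "\<lambda>\<tau>. f \<tau> \<omega>" "\<lambda>\<tau>. f' \<tau> \<omega>"] deriv[OF \<omega>] h(2)[of n]
        by (meson order_trans)
      then have "s n \<omega> = f' z \<omega>" using h(1)[of n] by (simp add: s_def)
      then show "norm (s n \<omega>) \<le> B \<omega>" using bound[OF \<omega>, of z] z h(2)[of n] by simp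
    qed
  qed (use B in measurable)
  moreover have "(\<integral>\<omega>. s n \<omega> \<partial>M) = ((\<integral>\<omega>. f (h n) \<omega> \<partial>M) - (\<integral>\<omega>. f 0 \<omega> \<partial>M)) / h n" for n
    unfolding s_def using f[of 0] f[of "h n"] h[of n] by simp
  ultimately show ?thesis by (simp add: h_def)
qed

text \<open>The generating function of Wick polynomials in the parameters \<open>t\<close>; the negative linear term makes it
  bounded for nonnegative data. For symmetric \<open>Y\<close>, the gradient of its exponent in \<open>t\<close> is the negative
  of \<open>gauss_shift\<close>.\<close>

definition gauss_exp :: "nat set \<Rightarrow> (nat \<Rightarrow> real) \<Rightarrow> (nat \<Rightarrow> real) \<Rightarrow> (nat \<Rightarrow> nat \<Rightarrow> real) \<Rightarrow> real" where
  "gauss_exp A t X Y = exp (- (\<Sum>k\<in>A. t k * X k) - (\<Sum>k\<in>A. \<Sum>l\<in>A. t k * t l * Y k l) / 2)"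

definition gauss_shift :: "nat set \<Rightarrow> (nat \<Rightarrow> real) \<Rightarrow> (nat \<Rightarrow> real) \<Rightarrow> (nat \<Rightarrow> nat \<Rightarrow> real) \<Rightarrow> nat \<Rightarrow> real" where
  "gauss_shift A t X Y k = X k + (\<Sum>l\<in>A. t l * Y k l)"

lemma sum_fun_upd_eq:
  fixes t :: "nat \<Rightarrow> real"
  assumes "finite A" "k \<in> A" "t k = 0"
  shows "(\<Sum>l\<in>A. (t(k := \<tau>)) l * c l) = (\<Sum>l\<in>A. t l * c l) + \<tau> * c k"
proof -
  have "(\<Sum>l\<in>A. (t(k := \<tau>)) l * c l) = \<tau> * c k + (\<Sum>l\<in>A - {k}. (t(k := \<tau>)) l * c l)"
    using assms by (subst sum.remove[of A k]) auto
  also have "(\<Sum>l\<in>A - {k}. (t(k := \<tau>)) l * c l) = (\<Sum>l\<in>A - {k}. t l * c l)"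
    by (intro sum.cong) auto
  also have "(\<Sum>l\<in>A - {k}. t l * c l) = (\<Sum>l\<in>A. t l * c l)"
    using sum.remove[OF assms(1,2), of "\<lambda>l. t l * c l"] assms(3) by simp
  finally show ?thesis by simp
qed

lemma gauss_shift_upd:
  assumes "finite A" "k \<in> A" "t k = 0"
  shows "gauss_shift A (t(k := \<tau>)) X Y j = gauss_shift A t X Y j + \<tau> * Y j k"
  unfolding gauss_shift_def sum_fun_upd_eq[where t=t, OF assms] by simp

lemma gauss_exp_upd:
  assumes A: "finite A" "k \<in> A" "t k = 0" and sym: "\<And>i j. Y i j = Y j i"
  shows "gauss_exp A (t(k := \<tau>)) X Y
    = gauss_exp A t X Y * exp (- \<tau> * gauss_shift A t X Y k - \<tau>\<^sup>2 * Y k k / 2)"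
proof -
  let ?t = "t(k := \<tau>)"
  have "(\<Sum>i\<in>A. \<Sum>l\<in>A. ?t i * ?t l * Y i l) = (\<Sum>i\<in>A. ?t i * (\<Sum>l\<in>A. ?t l * Y i l))"
    by (simp add: sum_distrib_left mult.assoc)
  also have "\<dots> = (\<Sum>i\<in>A. ?t i * ((\<Sum>l\<in>A. t l * Y i l) + \<tau> * Y i k))"
    unfolding sum_fun_upd_eq[where t=t, OF A] ..
  also have "\<dots> = (\<Sum>i\<in>A. t i * ((\<Sum>l\<in>A. t l * Y i l) + \<tau> * Y i k)) + \<tau> * ((\<Sum>l\<in>A. t l * Y k l) + \<tau> * Y k k)"
    by (rule sum_fun_upd_eq[where t=t, OF A])
  also have "(\<Sum>i\<in>A. t i * ((\<Sum>l\<in>A. t l * Y i l) + \<tau> * Y i k))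
     = (\<Sum>i\<in>A. \<Sum>l\<in>A. t i * t l * Y i l) + \<tau> * (\<Sum>i\<in>A. t i * Y k i)"
    by (simp add: distrib_left sum.distrib sum_distrib_left mult_ac sym[of _ k])
  finally have "(\<Sum>i\<in>A. \<Sum>l\<in>A. ?t i * ?t l * Y i l)
     = (\<Sum>i\<in>A. \<Sum>l\<in>A. t i * t l * Y i l) + 2 * \<tau> * (\<Sum>l\<in>A. t l * Y k l) + \<tau>\<^sup>2 * Y k k"
    by (simp add: algebra_simps power2_eq_square)
  then show ?thesis
    unfolding gauss_exp_def exp_add[symmetric] sum_fun_upd_eq[where t=t, OF A] gauss_shift_def
    by (simp add: algebra_simps)
qed

text \<open>Differentiation in a new parameter appends its index to the Wick polynomial, by \<open>wick_insert\<close>.\<close>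

lemma wick_gauss_has_derivative:
  assumes A: "finite A" "k \<in> A" "t k = 0" and sym: "\<And>i j. Y i j = Y j i"
    and J: "finite J" "k \<notin> J"
  shows "((\<lambda>\<tau>. wick J (gauss_shift A (t(k := \<tau>)) X Y) Y * gauss_exp A (t(k := \<tau>)) X Y)
    has_real_derivative
      - (wick (insert k J) (gauss_shift A (t(k := \<tau>)) X Y) Y * gauss_exp A (t(k := \<tau>)) X Y)) (at \<tau>)"
proof -
  let ?Z = "\<lambda>\<tau>. gauss_shift A (t(k := \<tau>)) X Y" and ?e = "\<lambda>\<tau>. gauss_exp A (t(k := \<tau>)) X Y"
  have "((\<lambda>\<tau>. ?Z \<tau> j) has_real_derivative Y j k) (at \<tau>)" for j
    unfolding gauss_shift_upd[where t=t, OF A] by (auto intro!: derivative_eq_intros)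
  then have 1: "((\<lambda>\<tau>. wick J (?Z \<tau>) Y) has_real_derivative (\<Sum>l\<in>J. Y l k * wick (J - {l}) (?Z \<tau>) Y)) (at \<tau>)"
    by (intro wick_has_derivative J)
  have 2: "(?e has_real_derivative (?e \<tau> * (- ?Z \<tau> k))) (at \<tau>)"
    unfolding gauss_exp_upd[where t=t and Y=Y, OF A sym] gauss_shift_upd[where t=t, OF A]
    by (auto intro!: derivative_eq_intros simp: algebra_simps)
  show ?thesis
    using DERIV_mult[OF 1 2]
    by (rule DERIV_cong) (simp add: wick_insert[where Y=Y, OF J sym] sym[of _ k] algebra_simps)
qed

text \<open>Nonnegativity keeps \<open>gauss_exp\<close> between \<open>0\<close> and \<open>1\<close> for \<open>t \<ge> 0\<close>; the moments provide the dominating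
  function for differentiation under the integral.\<close>

definition gauss_pair :: "'w measure \<Rightarrow> ('w \<Rightarrow> nat \<Rightarrow> real) \<Rightarrow> ('w \<Rightarrow> nat \<Rightarrow> nat \<Rightarrow> real) \<Rightarrow> bool" where
  "gauss_pair M X Y \<longleftrightarrow>
     (\<forall>k. all_moments M (\<lambda>\<omega>. X \<omega> k)) \<and> (\<forall>k l. all_moments M (\<lambda>\<omega>. Y \<omega> k l)) \<and>
     (\<forall>\<omega> k. X \<omega> k \<ge> 0) \<and> (\<forall>\<omega> k l. Y \<omega> k l \<ge> 0) \<and> (\<forall>\<omega> k l. Y \<omega> k l = Y \<omega> l k)"

lemma wick_integral_limit:
  assumes M: "finite_measure M" and XY: "gauss_pair M X Y" and S: "S \<in> sets M"
    and A: "finite A" "k \<in> A" "t k = 0" and t: "\<And>j. t j \<ge> 0" and J: "finite J" "k \<notin> J"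
  defines "\<phi> \<equiv> \<lambda>J t. \<integral>\<omega>. indicator S \<omega> * (wick J (gauss_shift A t (X \<omega>) (Y \<omega>)) (Y \<omega>) * gauss_exp A t (X \<omega>)
      (Y \<omega>)) \<partial>M"
  shows "(\<lambda>n. (\<phi> J (t(k := inverse (real (Suc n)))) - \<phi> J (t(k := 0))) / inverse (real (Suc n)))
     \<longlonglongrightarrow> - \<phi> (insert k J) (t(k := 0))"
proof -
  let ?Z = "\<lambda>\<tau> \<omega>. gauss_shift A (t(k := \<tau>)) (X \<omega>) (Y \<omega>)" and ?e = "\<lambda>\<tau> \<omega>. gauss_exp A (t(k := \<tau>)) (X \<omega>) (Y \<omega>)"
  have am: "\<And>k. all_moments M (\<lambda>\<omega>. X \<omega> k)" "\<And>k l. all_moments M (\<lambda>\<omega>. Y \<omega> k l)"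
    and nn: "\<And>\<omega> k. X \<omega> k \<ge> 0" "\<And>\<omega> k l. Y \<omega> k l \<ge> 0" and sym: "\<And>\<omega> k l. Y \<omega> k l = Y \<omega> l k"
    using XY unfolding gauss_pair_def by blast+
  note [measurable] = all_moments_measurable[OF am(1)] all_moments_measurable[OF am(2)] S
  have Z: "all_moments M (\<lambda>\<omega>. ?Z \<tau> \<omega> j)" for \<tau> j
    unfolding gauss_shift_def
    by (intro all_moments_add all_moments_sum all_moments_mult all_moments_const am M)
  have W: "all_moments M (\<lambda>\<omega>. wick K (?Z \<tau> \<omega>) (Y \<omega>))" for K \<tau>
    by (rule all_moments_wick[OF M Z am(2)])
  have e1: "0 \<le> ?e \<tau> \<omega>" "?e \<tau> \<omega> \<le> 1" if "\<tau> \<ge> 0" for \<tau> \<omega>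
  proof -
    have t': "(t(k := \<tau>)) j \<ge> 0" for j using t that by simp
    have "(\<Sum>i\<in>A. (t(k := \<tau>)) i * X \<omega> i) \<ge> 0"
      by (intro sum_nonneg mult_nonneg_nonneg t' nn)
    moreover have "(\<Sum>i\<in>A. \<Sum>l\<in>A. (t(k := \<tau>)) i * (t(k := \<tau>)) l * Y \<omega> i l) \<ge> 0"
      by (intro sum_nonneg mult_nonneg_nonneg t' nn)
    ultimately show "?e \<tau> \<omega> \<le> 1" unfolding gauss_exp_def by (simp del: fun_upd_apply)
  qed (simp add: gauss_exp_def)
  have [measurable]: "(\<lambda>\<omega>. ?e \<tau> \<omega>) \<in> borel_measurable M" for \<tau>
    unfolding gauss_exp_def by measurable
  \<comment> \<open>For \<open>0 \<le> \<tau> \<le> 1\<close> the shift at \<open>\<tau>\<close> exceeds the one at \<open>0\<close> by at most \<open>Y j k\<close>.\<close>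
  define B where "B \<omega> = (\<Sum>P\<in>matchings (insert k J). (\<Prod>j\<in>insert k J - \<Union>P. ?Z 0 \<omega> j + Y \<omega> j k) *
      (\<Prod>p\<in>P. \<bar>Y \<omega> (Min p) (Max p)\<bar>))" for \<omega>
  have "all_moments M (\<lambda>\<omega>. \<bar>Y \<omega> i j\<bar>)" for i j using am(2)[of i j] nn(2) by simp
  then have "all_moments M B" unfolding B_def
    by (intro all_moments_add all_moments_sum all_moments_mult all_moments_prod M Z am(2))
  then have Bint: "integrable M B" by (rule all_moments_integrable)
  have le: "\<bar>indicator S \<omega> * (w * ?e \<tau> \<omega>)\<bar> \<le> \<bar>w\<bar>" if "\<tau> \<ge> 0" for \<tau> \<omega> and w :: real
  proof -
    have "\<bar>indicator S \<omega> * (w * ?e \<tau> \<omega>)\<bar> = \<bar>w\<bar> * (indicator S \<omega> * ?e \<tau> \<omega>)"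
      using e1[OF that, of \<omega>] by (simp add: abs_mult)
    also have "\<dots> \<le> \<bar>w\<bar> * (1 * 1)"
      by (intro mult_left_mono mult_mono e1 that) (auto simp: indicator_def)
    finally show ?thesis by simp
  qed
  have upd0: "t(k := 0) = t" using A(3) by auto
  have "(\<lambda>n. ((\<integral>\<omega>. indicator S \<omega> * (wick J (?Z (inverse (real (Suc n))) \<omega>) (Y \<omega>) * ?e (inverse (real (Suc
      n))) \<omega>) \<partial>M)
        - (\<integral>\<omega>. indicator S \<omega> * (wick J (?Z 0 \<omega>) (Y \<omega>) * ?e 0 \<omega>) \<partial>M)) / inverse (real (Suc n)))
     \<longlonglongrightarrow> (\<integral>\<omega>. indicator S \<omega> * - (wick (insert k J) (?Z 0 \<omega>) (Y \<omega>) * ?e 0 \<omega>) \<partial>M)"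
  proof (rule difference_quotient_integral_limit[where B=B])
    fix \<tau> :: real assume \<tau>: "0 \<le> \<tau>" "\<tau> \<le> 1"
    note [measurable] = all_moments_measurable[OF W]
    show "integrable M (\<lambda>\<omega>. indicator S \<omega> * (wick J (?Z \<tau> \<omega>) (Y \<omega>) * ?e \<tau> \<omega>))"
    proof (rule Bochner_Integration.integrable_bound[OF all_moments_integrable[OF W]])
      show "AE \<omega> in M. norm (indicator S \<omega> * (wick J (?Z \<tau> \<omega>) (Y \<omega>) * ?e \<tau> \<omega>)) \<le> norm (wick J (?Z \<tau> \<omega>) (Y \<omega>))"
        using le[OF \<tau>(1)] by (intro AE_I2) simp
    qed measurable
    fix \<omega>
    show "((\<lambda>\<tau>. indicator S \<omega> * (wick J (?Z \<tau> \<omega>) (Y \<omega>) * ?e \<tau> \<omega>)) has_real_derivative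
        indicator S \<omega> * - (wick (insert k J) (?Z \<tau> \<omega>) (Y \<omega>) * ?e \<tau> \<omega>)) (at \<tau>)"
      by (intro DERIV_cmult wick_gauss_has_derivative A J sym)
    have "\<bar>?Z \<tau> \<omega> j\<bar> \<le> ?Z 0 \<omega> j + Y \<omega> j k" for j
    proof -
      have "?Z 0 \<omega> j \<ge> 0" unfolding upd0 gauss_shift_def using nn t by (intro add_nonneg_nonneg sum_nonneg) auto
      moreover have "?Z \<tau> \<omega> j = ?Z 0 \<omega> j + \<tau> * Y \<omega> j k" by (simp add: gauss_shift_upd[where t=t, OF A])
      moreover have "0 \<le> \<tau> * Y \<omega> j k" "\<tau> * Y \<omega> j k \<le> Y \<omega> j k"
        using nn(2)[of \<omega> j k] \<tau> by (auto intro: mult_left_le_one_le)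
      ultimately show ?thesis by simp
    qed
    then have "\<bar>wick (insert k J) (?Z \<tau> \<omega>) (Y \<omega>)\<bar> \<le> B \<omega>" unfolding B_def by (rule abs_wick_le)
    then show "\<bar>indicator S \<omega> * - (wick (insert k J) (?Z \<tau> \<omega>) (Y \<omega>) * ?e \<tau> \<omega>)\<bar> \<le> B \<omega>"
      using le[OF \<tau>(1), of \<omega> "wick (insert k J) (?Z \<tau> \<omega>) (Y \<omega>)"] by simp
  qed (rule Bint)
  then show ?thesis unfolding \<phi>_def by simp
qed

text \<open>Equality of the generating functions is differentiated once in each parameter at \<open>0\<close>. The induction
  keeps the other parameters free: the differentiated ones, those in \<open>J\<close>, are \<open>0\<close>.\<close>

theorem wick_integral_eq:
  assumes M: "finite_measure M" and XY: "gauss_pair M X Y" "gauss_pair M X' Y'" and S: "S \<in> sets M"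
    and A: "finite A"
    and gen: "\<And>t. (\<And>j. t j \<ge> 0) \<Longrightarrow> (\<integral>\<omega>. indicator S \<omega> * gauss_exp A t (X \<omega>) (Y \<omega>) \<partial>M)
        = (\<integral>\<omega>. indicator S \<omega> * gauss_exp A t (X' \<omega>) (Y' \<omega>) \<partial>M)"
  shows "(\<integral>\<omega>. indicator S \<omega> * wick A (X \<omega>) (Y \<omega>) \<partial>M) = (\<integral>\<omega>. indicator S \<omega> * wick A (X' \<omega>) (Y' \<omega>) \<partial>M)"
proof -
  let ?\<phi> = "\<lambda>X Y J t. \<integral>\<omega>. indicator S \<omega> * (wick J (gauss_shift A t (X \<omega>) (Y \<omega>)) (Y \<omega>) * gauss_exp A t (X \<omega>)
      (Y \<omega>)) \<partial>M"
  have "?\<phi> X Y J t = ?\<phi> X' Y' J t" if "J \<subseteq> A" "\<And>j. t j \<ge> 0" "\<And>j. j \<in> J \<Longrightarrow> t j = 0" for J t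
    using finite_subset[OF that(1) A] that
  proof (induction J arbitrary: t)
    case empty
    then show ?case using gen[of t] by simp
  next
    case (insert k J)
    have k: "k \<in> A" "t k = 0" "k \<notin> J" using insert by auto
    have t: "t j \<ge> 0" for j using insert.prems by auto
    have upd: "t(k := 0) = t" using k by auto
    have eq: "?\<phi> X Y J (t(k := \<tau>)) = ?\<phi> X' Y' J (t(k := \<tau>))" if "\<tau> \<ge> 0" for \<tau>
      using insert.prems insert.hyps that by (intro insert.IH) auto
    have "- ?\<phi> X Y (insert k J) (t(k := 0)) = - ?\<phi> X' Y' (insert k J) (t(k := 0))"
      by (rule LIMSEQ_unique[OF wick_integral_limit[where t=t, OF M XY(1) S A k(1,2) t insert.hyps(1) k(3)]])
         (use wick_integral_limit[where t=t, OF M XY(2) S A k(1,2) t insert.hyps(1) k(3)] in \<open>simp add: eq\<close>)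
    then show ?case unfolding upd by simp
  qed
  from this[of A "\<lambda>_. 0"] have "?\<phi> X Y A (\<lambda>_. 0) = ?\<phi> X' Y' A (\<lambda>_. 0)" by simp
  moreover have "gauss_shift A (\<lambda>_. 0) x y = x" "gauss_exp A (\<lambda>_. 0) x y = 1" for x y
    by (auto simp: gauss_shift_def gauss_exp_def)
  ultimately show ?thesis by simp
qed

section \<open>The \<open>H\<^sup>2\<^sup>|\<^sup>2\<close> measure as a network field\<close>

lemma spd_on_congruence:
  assumes d: "\<And>i. i \<in> I \<Longrightarrow> d i \<noteq> 0" and H: "spd_on I H"
    and A: "\<And>i j. i \<in> I \<Longrightarrow> j \<in> I \<Longrightarrow> A i j = d i * H i j * d j"
  shows "spd_on I A"
proof -
  have pd: "pos_def_on I H" and sym: "\<And>i j. i \<in> I \<Longrightarrow> j \<in> I \<Longrightarrow> H i j = H j i"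
    using H unfolding spd_on_def by blast+
  have "pos_def_on I A"
    unfolding pos_def_on_def
  proof (intro allI impI)
    fix x :: "'a \<Rightarrow> real" assume "\<exists>i\<in>I. x i \<noteq> 0"
    then have "\<exists>i\<in>I. d i * x i \<noteq> 0" using d by auto
    then have "0 < (\<Sum>i\<in>I. \<Sum>j\<in>I. (d i * x i) * H i j * (d j * x j))"
      using pd[unfolded pos_def_on_def, rule_format, of "\<lambda>i. d i * x i"] by simp
    also have "\<dots> = (\<Sum>i\<in>I. \<Sum>j\<in>I. x i * A i j * x j)"
      by (intro sum.cong refl) (simp add: A mult_ac)
    finally show "0 < (\<Sum>i\<in>I. \<Sum>j\<in>I. x i * A i j * x j)" .
  qed
  moreover have "A i j = A j i" if "i \<in> I" "j \<in> I" for i j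
    using sym[OF that] that by (simp add: A)
  ultimately show ?thesis unfolding spd_on_def by blast
qed

lemma det_on_congruence:
  assumes A: "\<And>i j. i \<in> I \<Longrightarrow> j \<in> I \<Longrightarrow> A i j = d i * H i j * d j"
  shows "det_on I A = (\<Prod>i\<in>I. d i)\<^sup>2 * det_on I H"
proof -
  have "(\<Prod>i\<in>I. A i (p i)) = (\<Prod>i\<in>I. d i)\<^sup>2 * (\<Prod>i\<in>I. H i (p i))" if p: "p permutes I" for p
  proof -
    have "(\<Prod>i\<in>I. A i (p i)) = (\<Prod>i\<in>I. d i * H i (p i) * d (p i))"
      using p by (intro prod.cong refl A) (simp_all add: permutes_in_image)
    also have "\<dots> = (\<Prod>i\<in>I. d i) * (\<Prod>i\<in>I. H i (p i)) * (\<Prod>i\<in>I. d (p i))"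
      by (simp add: prod.distrib)
    also have "(\<Prod>i\<in>I. d (p i)) = (\<Prod>i\<in>I. d i)"
      using prod.permute[OF p, of d] by (simp add: comp_def)
    finally show ?thesis by (simp add: power2_eq_square mult_ac)
  qed
  then show ?thesis by (simp add: det_on_def sum_distrib_left mult_ac)
qed

lemma inverse_on_congruence:
  assumes I: "finite I" and d: "\<And>i. i \<in> I \<Longrightarrow> d i \<noteq> 0" and H: "spd_on I H"
    and A: "\<And>i j. i \<in> I \<Longrightarrow> j \<in> I \<Longrightarrow> A i j = d i * H i j * d j"
    and ij: "i \<in> I" "j \<in> I"
  shows "d i * inverse_on I A i j * d j = inverse_on I H i j"
proof -
  have spdA: "spd_on I A" by (rule spd_on_congruence[OF d H A])
  have "(\<Sum>l\<in>I. H k l * (d l * inverse_on I A l j * d j)) = of_bool (k = j)" if k: "k \<in> I" for k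
  proof -
    have "d k * (\<Sum>l\<in>I. H k l * (d l * inverse_on I A l j * d j)) = (\<Sum>l\<in>I. A k l * inverse_on I A l j) * d j"
      unfolding sum_distrib_left sum_distrib_right by (intro sum.cong refl) (simp add: A k mult_ac)
    also have "\<dots> = d k * of_bool (k = j)"
      by (simp add: inverse_on_spec(2)[OF I spdA k ij(2)])
    finally show ?thesis using d[OF k] by simp
  qed
  from inverse_on_solution[OF I H this ij(1)]
  show ?thesis by (simp add: sum_of_bool_mult[OF I ij(2)])
qed

lemma all_moments_distr_iff:
  assumes T: "T \<in> M \<rightarrow>\<^sub>M N" and Z: "Z \<in> borel_measurable N"
  shows "all_moments (distr M N T) Z \<longleftrightarrow> all_moments M (\<lambda>x. Z (T x))"
proof -
  have "integrable (distr M N T) (\<lambda>x. \<bar>Z x\<bar> ^ p) \<longleftrightarrow> integrable M (\<lambda>x. \<bar>Z (T x)\<bar> ^ p)" for p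
    using integrable_distr_eq[OF T, of "\<lambda>x. \<bar>Z x\<bar> ^ p"] Z by simp
  then show ?thesis using measurable_compose[OF T Z] Z by (simp add: all_moments_def)
qed

lemma all_moments_cong:
  assumes "\<And>x. x \<in> space M \<Longrightarrow> Z x = Z' x"
  shows "all_moments M Z \<longleftrightarrow> all_moments M Z'"
proof -
  have "Z \<in> borel_measurable M \<longleftrightarrow> Z' \<in> borel_measurable M"
    by (rule measurable_cong) (rule assms)
  moreover have "integrable M (\<lambda>x. \<bar>Z x\<bar> ^ p) \<longleftrightarrow> integrable M (\<lambda>x. \<bar>Z' x\<bar> ^ p)" for p
    by (rule Bochner_Integration.integrable_cong) (simp_all add: assms)
  ultimately show ?thesis by (simp add: all_moments_def)
qed

text \<open>Needed for the Lebesgue measure on pinned fields, which is an image measure.\<close>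

lemma sigma_finite_distr_inverse:
  assumes T: "T \<in> M \<rightarrow>\<^sub>M N" and R: "R \<in> N \<rightarrow>\<^sub>M M" and RT: "\<And>x. x \<in> space M \<Longrightarrow> R (T x) = x"
    and M: "sigma_finite_measure M"
  shows "sigma_finite_measure (distr M N T)"
proof -
  obtain A where A: "countable A" "A \<subseteq> sets M" "\<Union>A = space M" "\<forall>a\<in>A. emeasure M a \<noteq> \<infinity>"
    using sigma_finite_measure.sigma_finite_countable[OF M] by blast
  let ?C = "(\<lambda>a. R -` a \<inter> space N) ` A"
  show ?thesis
  proof
    have "\<Union>?C = space N" using A(3) measurable_space[OF R] by blast
    moreover have "emeasure (distr M N T) (R -` a \<inter> space N) \<noteq> \<infinity>" if a: "a \<in> A" for a
    proof -
      have "a \<in> sets M" using a A(2) by auto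
      then have "R -` a \<inter> space N \<in> sets N" using R by (rule measurable_sets[rotated])
      moreover have "T -` (R -` a \<inter> space N) \<inter> space M = a"
        using RT measurable_space[OF T] sets.sets_into_space[OF \<open>a \<in> sets M\<close>] by auto
      ultimately show ?thesis using A(4) a by (simp add: emeasure_distr[OF T])
    qed
    moreover have "?C \<subseteq> sets (distr M N T)"
      using A(2) R by (auto intro: measurable_sets)
    ultimately show "\<exists>A. countable A \<and> A \<subseteq> sets (distr M N T) \<and> \<Union>A = space (distr M N T) \<and>
        (\<forall>a\<in>A. emeasure (distr M N T) a \<noteq> \<infinity>)"
      using A(1) by (intro exI[of _ ?C]) auto
  qed
qed

text \<open>The vertex set without the reference vertex and the weights on it are parameters of their own, so
  that the wired graphs of all \<open>V n\<close> can share one weight function.\<close>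

locale pinned_graph =
  fixes G :: "'a wgraph" and \<delta> :: 'a and V :: "'a set"
    and W :: "'a \<Rightarrow> 'a \<Rightarrow> real" and \<eta> :: "'a \<Rightarrow> real"
  assumes fin: "finite (verts G)" and \<delta>: "\<delta> \<in> verts G" and V: "V = verts G - {\<delta>}"
    and simple: "simple_graph G" and weights: "symmetric_positive_weights G"
    and W: "\<And>i j. i \<in> V \<Longrightarrow> j \<in> V \<Longrightarrow> weight G i j = W i j"
    and \<eta>: "\<And>i. i \<in> V \<Longrightarrow> weight G i \<delta> = \<eta> i"
    and net: "network V W \<eta>"
begin

lemma verts_eq: "verts G = insert \<delta> V" and \<delta>V: "\<delta> \<notin> V" and finV: "finite V"
  using V \<delta> fin by auto

lemma weight_sym: "i \<in> verts G \<Longrightarrow> j \<in> verts G \<Longrightarrow> weight G i j = weight G j i"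
  using weights unfolding symmetric_positive_weights_def by blast

lemma weight_nonadj:
  assumes "i \<in> verts G" "j \<in> verts G" "\<not> adj G i j"
  shows "weight G i j = 0"
  using weights[unfolded symmetric_positive_weights_def, THEN bspec, OF assms(1), THEN bspec, OF assms(2)]
    assms(3) by simp

lemma not_adj_self: "\<not> adj G i i"
  using simple unfolding simple_graph_def adj_def by (auto simp: doubleton_eq_iff)

lemma weight_self: "i \<in> verts G \<Longrightarrow> weight G i i = 0"
  using weight_nonadj not_adj_self by blast

lemma beta_of_eq:
  assumes "u \<delta> = 0"
  shows "beta_of G \<delta> u = restrict (field_beta V W \<eta> u) V"
proof -
  have "1/2 * (\<Sum>j | j \<in> verts G \<and> adj G i j. weight G i j * exp (u j - u i)) = field_beta V W \<eta> u i"
    if i: "i \<in> V" for i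
  proof -
    have iv: "i \<in> verts G" using i by (simp add: verts_eq)
    have "(\<Sum>j | j \<in> verts G \<and> adj G i j. weight G i j * exp (u j - u i))
       = (\<Sum>j\<in>verts G. weight G i j * exp (u j - u i))"
      using fin weight_nonadj[OF iv] by (intro sum.mono_neutral_left) auto
    also have "\<dots> = weight G i \<delta> * exp (- u i) + (\<Sum>j\<in>V. weight G i j * exp (u j - u i))"
      unfolding verts_eq using finV \<delta>V assms by simp
    also have "(\<Sum>j\<in>V. weight G i j * exp (u j - u i)) = (\<Sum>j\<in>V. W i j * exp (u j)) * exp (- u i)"
      unfolding sum_distrib_right
      by (intro sum.cong refl) (simp add: W i exp_diff exp_minus divide_inverse)
    finally show ?thesis by (simp add: field_beta_def inflow_def \<eta> i algebra_simps)
  qed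
  then show ?thesis by (auto simp: beta_of_def V[symmetric] fun_eq_iff)
qed

text \<open>The value \<open>u \<delta>\<close> may differ from \<open>0\<close> here and in the next lemmas, because a left inverse \<open>f\<close> of
  \<open>u \<mapsto> \<beta> u\<close> may take any value off the range. It only rescales \<open>\<eta>\<close> by a positive factor, so
  measurability and nonnegativity of \<open>green\<close> hold for all arguments.\<close>

lemma A_matrix_eq:
  assumes ij: "i \<in> V" "j \<in> V"
  shows "A_matrix G u i j = exp (u i) * H_matrix V W (\<lambda>i. \<eta> i * exp (u \<delta>)) u i j * exp (u j)"
proof (cases "i = j")
  case False
  then show ?thesis using ij by (simp add: A_matrix_def H_matrix_def W exp_add)
next
  case [simp]: True
  let ?I = "inflow V W (\<lambda>i. \<eta> i * exp (u \<delta>)) u j"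
  have "A_matrix G u i j = weight G j \<delta> * exp (u j + u \<delta>) + (\<Sum>k\<in>V. weight G j k * exp (u j + u k))"
    unfolding A_matrix_def verts_eq using finV \<delta>V by simp
  also have "(\<Sum>k\<in>V. weight G j k * exp (u j + u k)) = exp (u j) * (\<Sum>k\<in>V. W j k * exp (u k))"
    unfolding sum_distrib_left using ij by (intro sum.cong refl) (simp add: W exp_add)
  finally have "A_matrix G u i j = exp (u j) * ?I"
    using ij by (simp add: inflow_def \<eta> exp_add algebra_simps)
  also have "\<dots> = exp (u j) * (?I * exp (- u j)) * exp (u j)"
    by (simp add: exp_minus)
  also have "?I * exp (- u j) = H_matrix V W (\<lambda>i. \<eta> i * exp (u \<delta>)) u j j"
    using W[of j j] weight_self[of j] ij by (simp add: H_matrix_def field_beta_def verts_eq)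
  finally show ?thesis by simp
qed

lemma net_scaled: "network V W (\<lambda>i. \<eta> i * exp c)"
proof -
  have "0 < \<eta> i * exp c \<longleftrightarrow> 0 < \<eta> i" "0 \<le> \<eta> i * exp c \<longleftrightarrow> 0 \<le> \<eta> i" for i
    by (simp_all add: zero_less_mult_iff zero_le_mult_iff)
  then show ?thesis using net unfolding network_def grounded_def by simp
qed

lemma spd_on_A_matrix: "spd_on V (A_matrix G u)"
  by (rule spd_on_congruence[OF _ spd_on_H_matrix[OF net_scaled] A_matrix_eq]) auto

lemma green_eq:
  assumes "i \<in> V" "j \<in> V"
  shows "green G \<delta> u i j = inverse_on V (H_matrix V W (\<lambda>i. \<eta> i * exp (u \<delta>)) u) i j"
  using assms unfolding green_def V[symmetric]
  by (simp add: inverse_on_congruence[OF finV _ spd_on_H_matrix[OF net_scaled] A_matrix_eq])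

lemma edge_factor_eq:
  assumes e: "{i, j} \<in> edges G"
  shows "edge_factor G u {i, j} = exp (- weight G i j * (cosh (u i - u j) - 1))"
proof -
  have ij: "i \<in> verts G" "j \<in> verts G"
    using simple e unfolding simple_graph_def by (auto simp: doubleton_eq_iff)
  have c: "cosh (u j - u i) = cosh (u i - u j)" using cosh_minus[of "u i - u j"] by simp
  show ?thesis unfolding edge_factor_def
  proof (rule the_equality)
    fix r assume "\<exists>a b. {i, j} = {a, b} \<and> r = exp (- weight G a b * (cosh (u a - u b) - 1))"
    then obtain a b where ab: "{i, j} = {a, b}" "r = exp (- weight G a b * (cosh (u a - u b) - 1))" by blast
    then consider "a = i" "b = j" | "a = j" "b = i" by (auto simp: doubleton_eq_iff)
    then show "r = exp (- weight G i j * (cosh (u i - u j) - 1))"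
      using ab(2) weight_sym[OF ij] c by cases simp_all
  qed blast
qed

lemma prod_edge_factor:
  "(\<Prod>e\<in>edges G. edge_factor G u e)
    = exp (- (\<Sum>i\<in>verts G. \<Sum>j\<in>verts G. weight G i j * (cosh (u i - u j) - 1)) / 2)"
proof -
  let ?c = "\<lambda>i j. weight G i j * (cosh (u i - u j) - 1)"
  define g where "g e = - ln (edge_factor G u e)" for e
  have cosh_sym: "cosh (u j - u i) = cosh (u i - u j)" for i j using cosh_minus[of "u i - u j"] by simp
  have edges: "\<exists>i j. e = {i, j} \<and> i \<noteq> j \<and> i \<in> verts G \<and> j \<in> verts G" if "e \<in> edges G" for e
  proof -
    have "e \<in> {{i, j} | i j. i \<in> verts G \<and> j \<in> verts G \<and> i \<noteq> j}"
      using simple that unfolding simple_graph_def by (rule subsetD)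
    then show ?thesis by blast
  qed
  have "edges G \<subseteq> Pow (verts G)" using edges by fastforce
  then have finE: "finite (edges G)" by (rule finite_subset) (simp add: fin)
  define S where "S = {(i, j). i \<in> verts G \<and> j \<in> verts G \<and> adj G i j}"
  have finS: "finite S" by (rule finite_subset[of _ "verts G \<times> verts G"]) (use fin in \<open>auto simp: S_def\<close>)
  have gS: "g {i, j} = ?c i j" if "adj G i j" for i j
    using edge_factor_eq[of i j u] that by (simp add: g_def adj_def)
  have "(\<Sum>i\<in>verts G. \<Sum>j\<in>verts G. ?c i j) = (\<Sum>(i, j)\<in>verts G \<times> verts G. ?c i j)"
    by (rule sum.cartesian_product)
  also have "\<dots> = (\<Sum>(i, j)\<in>S. ?c i j)"
  proof (rule sum.mono_neutral_right)
    show "\<forall>x\<in>verts G \<times> verts G - S. (case x of (i, j) \<Rightarrow> ?c i j) = 0"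
    proof
      fix x assume "x \<in> verts G \<times> verts G - S"
      then obtain i j where x: "x = (i, j)" "i \<in> verts G" "j \<in> verts G" "\<not> adj G i j"
        by (auto simp: S_def)
      show "(case x of (i, j) \<Rightarrow> ?c i j) = 0" unfolding x(1) using weight_nonadj[OF x(2-4)] by simp
    qed
  qed (use fin in \<open>auto simp: S_def\<close>)
  also have "\<dots> = (\<Sum>x\<in>S. g ((\<lambda>(i, j). {i, j}) x))"
  proof (rule sum.cong[OF refl])
    fix x assume "x \<in> S"
    then obtain i j where x: "x = (i, j)" "adj G i j" by (auto simp: S_def)
    show "(case x of (i, j) \<Rightarrow> ?c i j) = g ((\<lambda>(i, j). {i, j}) x)"
      unfolding x(1) using gS[OF x(2)] by simp
  qed
  also have "\<dots> = (\<Sum>e\<in>edges G. \<Sum>x\<in>{x \<in> S. (\<lambda>(i, j). {i, j}) x = e}. g ((\<lambda>(i, j). {i, j}) x))"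
    by (rule sum.group[symmetric]) (use finS finE in \<open>auto simp only: S_def adj_def\<close>)
  also have "\<dots> = (\<Sum>e\<in>edges G. 2 * g e)"
  proof (rule sum.cong[OF refl])
    fix e assume e: "e \<in> edges G"
    then obtain i j where ij: "e = {i, j}" "i \<noteq> j" "i \<in> verts G" "j \<in> verts G" using edges by blast
    have ji: "{j, i} = e" using ij(1) by blast
    have "adj G i j" "adj G j i" unfolding adj_def ji ij(1)[symmetric] by (rule e)+
    then have Sij: "(i, j) \<in> S" "(j, i) \<in> S" using ij(3,4) by (simp_all add: S_def)
    \<comment> \<open>An edge arises from exactly two ordered pairs, which accounts for the factor \<open>1/2\<close>.\<close>
    have "{x \<in> S. (\<lambda>(i, j). {i, j}) x = e} = {(i, j), (j, i)}"
    proof (intro set_eqI iffI)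
      fix x assume "x \<in> {x \<in> S. (\<lambda>(i, j). {i, j}) x = e}"
      then obtain a b where "x = (a, b)" "{a, b} = {i, j}" using ij(1) by (cases x) simp
      then show "x \<in> {(i, j), (j, i)}" unfolding doubleton_eq_iff by blast
    next
      fix x assume "x \<in> {(i, j), (j, i)}"
      then show "x \<in> {x \<in> S. (\<lambda>(i, j). {i, j}) x = e}"
        using Sij ji ij(1) by blast
    qed
    then show "(\<Sum>x\<in>{x \<in> S. (\<lambda>(i, j). {i, j}) x = e}. g ((\<lambda>(i, j). {i, j}) x)) = 2 * g e"
      using ij(2) by (simp add: ji ij(1)[symmetric])
  qed
  finally have s: "(\<Sum>i\<in>verts G. \<Sum>j\<in>verts G. ?c i j) = 2 * (\<Sum>e\<in>edges G. g e)"
    by (simp add: sum_distrib_left)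
  have "edge_factor G u e = exp (- g e)" if e: "e \<in> edges G" for e
  proof -
    obtain i j where ij: "e = {i, j}" using edges[OF e] by blast
    then have "edge_factor G u e > 0" using edge_factor_eq e by simp
    then show ?thesis by (simp add: g_def)
  qed
  then have "(\<Prod>e\<in>edges G. edge_factor G u e) = exp (- (\<Sum>e\<in>edges G. g e))"
    using finE by (simp add: exp_sum sum_negf[symmetric])
  then show ?thesis unfolding s by simp
qed

text \<open>Symmetry of \<open>W\<close> turns \<open>W i j cosh (u i - u j)\<close> into \<open>W i j e\<^bsup>u j - u i\<^esup>\<close> in the double sum.\<close>

lemma energy_eq:
  assumes u: "u \<delta> = 0"
  shows "- (\<Sum>i\<in>verts G. \<Sum>j\<in>verts G. weight G i j * (cosh (u i - u j) - 1)) / 2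
    = - (\<Sum>i\<in>V. field_beta V W \<eta> u i) - (\<Sum>i\<in>V. \<eta> i * exp (u i)) / 2
          + (\<Sum>i\<in>V. \<Sum>j\<in>V. W i j) / 2 + (\<Sum>i\<in>V. \<eta> i)"
proof -
  let ?C = "\<Sum>i\<in>V. \<Sum>j\<in>V. W i j * cosh (u i - u j)" and ?w = "\<Sum>i\<in>V. \<Sum>j\<in>V. W i j"
  let ?c = "\<Sum>i\<in>V. \<eta> i * cosh (u i)" and ?e = "\<Sum>i\<in>V. \<eta> i"
  have sd: "weight G \<delta> j = \<eta> j" if "j \<in> V" for j
    using weight_sym[of \<delta> j] \<eta>[OF that] that by (simp add: verts_eq)
  have d1: "(\<Sum>j\<in>V. weight G \<delta> j * (cosh (u \<delta> - u j) - 1)) = ?c - ?e"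
    unfolding sum_subtractf[symmetric] by (intro sum.cong refl) (simp add: sd u algebra_simps)
  have d2: "(\<Sum>i\<in>V. weight G i \<delta> * (cosh (u i - u \<delta>) - 1)) = ?c - ?e"
    unfolding sum_subtractf[symmetric] by (intro sum.cong refl) (simp add: \<eta> u algebra_simps)
  have d3: "(\<Sum>i\<in>V. \<Sum>j\<in>V. weight G i j * (cosh (u i - u j) - 1)) = ?C - ?w"
    unfolding sum_subtractf[symmetric] by (intro sum.cong refl) (simp add: W algebra_simps)
  have total: "(\<Sum>i\<in>verts G. \<Sum>j\<in>verts G. weight G i j * (cosh (u i - u j) - 1)) = 2 * (?c - ?e) + (?C - ?w)"
    unfolding verts_eq using finV \<delta>V by (simp add: sum.distrib d1 d2 d3)
  let ?D = "\<Sum>i\<in>V. \<Sum>j\<in>V. W i j * exp (u j - u i)"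
  have "(\<Sum>i\<in>V. \<Sum>j\<in>V. W i j * exp (u i - u j)) = ?D"
    by (subst sum.swap) (intro sum.cong refl, simp add: networkD(2)[OF net])
  moreover have "?C = ((\<Sum>i\<in>V. \<Sum>j\<in>V. W i j * exp (u i - u j)) + ?D) / 2"
    unfolding sum.distrib[symmetric] sum_divide_distrib
    by (intro sum.cong refl) (simp add: cosh_def field_simps)
  ultimately have C: "?C = ?D" by simp
  have c: "?c = (\<Sum>i\<in>V. \<eta> i * exp (u i)) / 2 + (\<Sum>i\<in>V. \<eta> i * exp (- u i)) / 2"
    unfolding sum.distrib[symmetric] sum_divide_distrib
    by (intro sum.cong refl) (simp add: cosh_def field_simps)
  have "2 * (\<Sum>i\<in>V. field_beta V W \<eta> u i) = ?D + (\<Sum>i\<in>V. \<eta> i * exp (- u i))"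
    unfolding sum_distrib_left sum.distrib[symmetric]
  proof (rule sum.cong[OF refl])
    fix i
    have "2 * field_beta V W \<eta> u i = (\<Sum>j\<in>V. W i j * exp (u j)) * exp (- u i) + \<eta> i * exp (- u i)"
      by (simp add: field_beta_def inflow_def distrib_right)
    also have "(\<Sum>j\<in>V. W i j * exp (u j)) * exp (- u i) = (\<Sum>j\<in>V. W i j * exp (u j - u i))"
      unfolding sum_distrib_right mult.assoc exp_add[symmetric] by simp
    finally show "2 * field_beta V W \<eta> u i = (\<Sum>j\<in>V. W i j * exp (u j - u i)) + \<eta> i * exp (- u i)" .
  qed
  then show ?thesis unfolding total C c by (simp add: field_simps)
qed

abbreviation L where "L \<equiv> pinned_lebesgue G \<delta>"

lemma space_L: "space L = pinned G \<delta>"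
  by (auto simp: pinned_lebesgue_def space_restrict_space space_PiM pinned_def)

lemma measurable_pin:
  "(\<lambda>u. u(\<delta> := 0)) \<in> field_space V \<rightarrow>\<^sub>M restrict_space (Pi\<^sub>M (verts G) (\<lambda>_. borel)) (pinned G \<delta>)"
proof (rule measurable_restrict_space2)
  show "(\<lambda>u. u(\<delta> := 0)) \<in> space (field_space V) \<rightarrow> pinned G \<delta>"
    by (auto simp: space_PiM pinned_def verts_eq PiE_def extensional_def)
  show "(\<lambda>u. u(\<delta> := 0)) \<in> field_space V \<rightarrow>\<^sub>M Pi\<^sub>M (verts G) (\<lambda>_. borel)"
  proof (rule measurable_fun_upd[where J=V])
    show "verts G = V \<union> {\<delta>}" by (simp add: verts_eq)
    have "sets (field_space V) = sets (Pi\<^sub>M V (\<lambda>_. borel))"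
      by (rule sets_PiM_cong) auto
    then show "(\<lambda>u. u) \<in> field_space V \<rightarrow>\<^sub>M Pi\<^sub>M V (\<lambda>_. borel :: real measure)"
      by (rule measurable_ident_sets)
  qed simp
qed

lemma measurable_component_L:
  "i \<in> verts G \<Longrightarrow> (\<lambda>u. u i) \<in> borel_measurable L"
  unfolding pinned_lebesgue_def measurable_distr_eq1
  by (intro measurable_restrict_space1 measurable_component_singleton)

lemma sigma_finite_L: "sigma_finite_measure L"
  unfolding pinned_lebesgue_def V[symmetric]
proof (rule sigma_finite_distr_inverse[OF measurable_pin])
  interpret product_sigma_finite "\<lambda>_::'a. lborel :: real measure" ..
  show "sigma_finite_measure (field_space V)" by (rule sigma_finite[OF finV])
  have s: "sets (field_space V) = sets (Pi\<^sub>M V (\<lambda>_. borel))"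
    by (rule sets_PiM_cong) auto
  have "(\<lambda>u. restrict u V) \<in> Pi\<^sub>M (verts G) (\<lambda>_. borel) \<rightarrow>\<^sub>M Pi\<^sub>M V (\<lambda>_. borel :: real measure)"
    by (rule measurable_restrict_subset) (auto simp: verts_eq)
  then show "(\<lambda>u. restrict u V) \<in> restrict_space (Pi\<^sub>M (verts G) (\<lambda>_. borel)) (pinned G \<delta>) \<rightarrow>\<^sub>M field_space V"
    unfolding measurable_cong_sets[OF refl s] by (rule measurable_restrict_space1)
  fix u assume "u \<in> space (field_space V)"
  then show "restrict (u(\<delta> := 0)) V = u"
    using \<delta>V by (auto simp: space_PiM PiE_def extensional_def fun_eq_iff)
qed

lemma nn_integral_L:
  assumes "F \<in> borel_measurable L"
  shows "(\<integral>\<^sup>+u. F u \<partial>L) = (\<integral>\<^sup>+u. F (u(\<delta> := 0)) \<partial>field_space V)"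
  using assms unfolding pinned_lebesgue_def V[symmetric]
  by (subst nn_integral_distr[OF measurable_pin]) simp_all

lemma measurable_h22_density:
  "(\<lambda>(u, s). ennreal (h22_density G \<delta> u s)) \<in> borel_measurable (L \<Otimes>\<^sub>M L)"
proof -
  note [measurable] = measurable_component_L
  have A [measurable]: "(\<lambda>u. A_matrix G u i j) \<in> borel_measurable L" if "i \<in> verts G" "j \<in> verts G" for i j
    using that unfolding A_matrix_def by (cases "i = j") simp_all
  have [measurable]: "(\<lambda>u. det_on (verts G - {\<delta>}) (A_matrix G u)) \<in> borel_measurable L"
    by (rule borel_measurable_det_on) (auto intro: A)
  have [measurable]: "(\<lambda>u. \<Prod>e\<in>edges G. edge_factor G u e) \<in> borel_measurable L"
    unfolding prod_edge_factor cosh_field_def by measurable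
  show ?thesis unfolding h22_density_def by measurable
qed

text \<open>The Gaussian integral over \<open>s\<close> turns \<open>det A\<close> into \<open>sqrt (det A) = sqrt (det H) \<Prod>e\<^sup>u\<close>, and the
  factors \<open>e\<^bsup>- u i\<^esup>\<close> cancel.\<close>

lemma nn_integral_h22_density:
  assumes u: "u \<in> pinned G \<delta>"
  shows "(\<integral>\<^sup>+s. ennreal (h22_density G \<delta> u s) \<partial>L) = ennreal (field_density V W \<eta> u)"
proof -
  have u\<delta>: "u \<delta> = 0" using u by (simp add: pinned_def)
  note det_pos = det_on_pos[OF finV spd_on_A_matrix, of u]
  let ?D = "det_on V (A_matrix G u)" and ?E = "\<Prod>e\<in>edges G. edge_factor G u e"
  let ?P = "\<Prod>i\<in>V. exp (- u i) / (2 * pi)"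
  have E: "?E > 0" by (simp add: prod_edge_factor)
  have P: "?P > 0" by (intro prod_pos) simp
  have c: "?D * ?E * ?P \<ge> 0" using det_pos E P by simp
  have meas: "(\<lambda>s. ennreal (h22_density G \<delta> u s)) \<in> borel_measurable L"
    using measurable_compose[OF measurable_Pair1'[OF u[folded space_L]] measurable_h22_density] by simp
  have "(\<integral>\<^sup>+s. ennreal (h22_density G \<delta> u s) \<partial>L)
     = (\<integral>\<^sup>+s. ennreal (?D * ?E * ?P) * ennreal (exp (- 1/2 * (\<Sum>i\<in>V. \<Sum>j\<in>V. s i * A_matrix G u i j * s j)))
         \<partial>field_space V)"
    unfolding nn_integral_L[OF meas]
  proof (rule nn_integral_cong)
    fix s :: "'a \<Rightarrow> real"
    let ?s = "s(\<delta> := 0)"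
    have "(\<Sum>i\<in>verts G. \<Sum>j\<in>verts G. ?s i * A_matrix G u i j * ?s j)
       = (\<Sum>i\<in>V. \<Sum>j\<in>V. ?s i * A_matrix G u i j * ?s j)"
      unfolding verts_eq using finV \<delta>V by simp
    also have "\<dots> = (\<Sum>i\<in>V. \<Sum>j\<in>V. s i * A_matrix G u i j * s j)"
      using \<delta>V by (intro sum.cong refl) auto
    finally show "ennreal (h22_density G \<delta> u ?s) = ennreal (?D * ?E * ?P) *
       ennreal (exp (- 1/2 * (\<Sum>i\<in>V. \<Sum>j\<in>V. s i * A_matrix G u i j * s j)))"
      unfolding h22_density_def V[symmetric] ennreal_mult'[OF c, symmetric] by (simp add: mult_ac)
  qed
  also have "\<dots> = ennreal (?D * ?E * ?P) * ennreal (sqrt (2 * pi) ^ card V / sqrt ?D)"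
    by (subst nn_integral_cmult) (measurable, simp only: nn_integral_gaussian_PiM[OF finV spd_on_A_matrix])
  also have "\<dots> = ennreal (?D * ?E * ?P * (sqrt (2 * pi) ^ card V / sqrt ?D))"
    by (rule ennreal_mult'[OF c, symmetric])
  also have "?D * ?E * ?P * (sqrt (2 * pi) ^ card V / sqrt ?D) = field_density V W \<eta> u"
  proof -
    have hd: "?D = (\<Prod>i\<in>V. exp (u i))\<^sup>2 * det_on V (H_matrix V W \<eta> u)"
      by (rule det_on_congruence) (use A_matrix_eq[of _ _ u] u\<delta> in simp)
    have e: "(\<Prod>i\<in>V. exp (u i)) > 0" by (intro prod_pos) simp
    have "?D * (1 / sqrt ?D) = sqrt ?D" using det_pos by (simp add: real_div_sqrt)
    also have "\<dots> = (\<Prod>i\<in>V. exp (u i)) * sqrt (det_on V (H_matrix V W \<eta> u))"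
      unfolding hd using e by (simp add: real_sqrt_mult)
    finally have s: "?D * (1 / sqrt ?D) = \<dots>" .
    have p: "?P * sqrt (2 * pi) ^ card V = 1 / (\<Prod>i\<in>V. exp (u i)) / sqrt (2 * pi) ^ card V"
    proof -
      have "sqrt (2 * pi) ^ card V * sqrt (2 * pi) ^ card V = (2 * pi) ^ card V"
        unfolding power_mult_distrib[symmetric] by simp
      moreover have "(\<Prod>i\<in>V. exp (- u i)) * (\<Prod>i\<in>V. exp (u i)) = 1"
        unfolding prod.distrib[symmetric] exp_add[symmetric] by simp
      then have "(\<Prod>i\<in>V. exp (- u i)) = 1 / (\<Prod>i\<in>V. exp (u i))" using e by (simp add: eq_divide_eq)
      then have "?P = 1 / (\<Prod>i\<in>V. exp (u i)) / (2 * pi) ^ card V"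
        unfolding prod_dividef by simp
      moreover have "a / b\<^sup>2 * b = a / b" if "b > 0" for a b :: real
        using that by (simp add: power2_eq_square)
      from this[of "sqrt (2 * pi) ^ card V"]
      have "a / (sqrt (2 * pi) ^ card V * sqrt (2 * pi) ^ card V) * sqrt (2 * pi) ^ card V = a / sqrt (2 *
          pi) ^ card V" for a
        by (simp add: power2_eq_square)
      ultimately show ?thesis by metis
    qed
    have "?D * ?E * ?P * (sqrt (2 * pi) ^ card V / sqrt ?D) = ?E * (?D * (1 / sqrt ?D)) * (?P * sqrt (2 *
        pi) ^ card V)"
      by simp
    also have "\<dots> = ?E * sqrt (det_on V (H_matrix V W \<eta> u)) / sqrt (2 * pi) ^ card V"
      unfolding s p using e by simp
    finally show ?thesis unfolding field_density_def prod_edge_factor energy_eq[of u, OF u\<delta>] .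
  qed
  finally show ?thesis .
qed

text \<open>Integrating out \<open>s\<close> leaves the network field as the law of \<open>u\<close>.\<close>

theorem h22_beta_law:
  "distr (h22_measure G \<delta>) (Pi\<^sub>M V (\<lambda>_. borel)) (\<lambda>(u, s). beta_of G \<delta> u)
   = distr (network_field V W \<eta>) (Pi\<^sub>M V (\<lambda>_. borel)) (\<lambda>u. restrict (field_beta V W \<eta> u) V)"
proof (rule measure_eqI)
  fix B assume "B \<in> sets (distr (h22_measure G \<delta>) (Pi\<^sub>M V (\<lambda>_. borel)) (\<lambda>(u, s). beta_of G \<delta> u))"
  then have B [measurable]: "B \<in> sets (Pi\<^sub>M V (\<lambda>_. borel))" by simp
  interpret L: sigma_finite_measure L by (rule sigma_finite_L)
  let ?dens = "\<lambda>x. case x of (u, s) \<Rightarrow> ennreal (h22_density G \<delta> u s)"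
  note dens [measurable] = measurable_h22_density
  have beta [measurable]: "beta_of G \<delta> \<in> L \<rightarrow>\<^sub>M Pi\<^sub>M V (\<lambda>_. borel)"
    unfolding beta_of_def V[symmetric]
  proof (rule measurable_restrict)
    fix i assume i: "i \<in> V"
    note [measurable] = measurable_component_L
    have "i \<in> verts G" using i by (simp add: verts_eq)
    then show "(\<lambda>u. 1 / 2 * (\<Sum>j | j \<in> verts G \<and> adj G i j. weight G i j * exp (u j - u i))) \<in>
        borel_measurable L"
      by measurable
  qed
  have v: "(\<lambda>u. restrict (field_beta V W \<eta> u) V) \<in> field_space V \<rightarrow>\<^sub>M Pi\<^sub>M V (\<lambda>_. borel)"
    by (rule measurable_restrict_field_beta) simp
  note [measurable] = v
  have "emeasure (distr (h22_measure G \<delta>) (Pi\<^sub>M V (\<lambda>_. borel)) (\<lambda>(u, s). beta_of G \<delta> u)) B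
     = (\<integral>\<^sup>+x. indicator B x \<partial>distr (h22_measure G \<delta>) (Pi\<^sub>M V (\<lambda>_. borel)) (\<lambda>(u, s). beta_of G \<delta> u))"
    by (simp add: nn_integral_indicator)
  also have "\<dots> = (\<integral>\<^sup>+x. indicator B (beta_of G \<delta> (fst x)) \<partial>h22_measure G \<delta>)"
    unfolding h22_measure_def by (subst nn_integral_distr) (simp_all add: split_beta')
  also have "\<dots> = (\<integral>\<^sup>+x. ?dens x * indicator B (beta_of G \<delta> (fst x)) \<partial>(L \<Otimes>\<^sub>M L))"
    unfolding h22_measure_def by (rule nn_integral_density) measurable
  also have "\<dots> = (\<integral>\<^sup>+u. (\<integral>\<^sup>+s. ennreal (h22_density G \<delta> u s) * indicator B (beta_of G \<delta> u) \<partial>L) \<partial>L)"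
  proof -
    have "(\<lambda>u. indicator B (beta_of G \<delta> u) :: ennreal) \<in> borel_measurable L"
      using measurable_compose[OF beta borel_measurable_indicator[OF B]] .
    from measurable_compose[OF measurable_fst this]
    have "(\<lambda>x. ?dens x * indicator B (beta_of G \<delta> (fst x))) \<in> borel_measurable (L \<Otimes>\<^sub>M L)"
      by (intro borel_measurable_times_ennreal dens)
    from L.nn_integral_fst[OF this] show ?thesis by simp
  qed
  also have "\<dots> = (\<integral>\<^sup>+u. ennreal (field_density V W \<eta> u) * indicator B (beta_of G \<delta> u) \<partial>L)"
  proof (rule nn_integral_cong)
    fix u assume u: "u \<in> space L"
    have "(\<lambda>s. ennreal (h22_density G \<delta> u s)) \<in> borel_measurable L"
      using measurable_compose[OF measurable_Pair1'[OF u] dens] by simp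
    then show "(\<integral>\<^sup>+s. ennreal (h22_density G \<delta> u s) * indicator B (beta_of G \<delta> u) \<partial>L)
        = ennreal (field_density V W \<eta> u) * indicator B (beta_of G \<delta> u)"
      using nn_integral_h22_density u by (simp add: nn_integral_multc space_L)
  qed
  also have "\<dots> = (\<integral>\<^sup>+u. ennreal (field_density V W \<eta> (u(\<delta> := 0))) * indicator B (beta_of G \<delta> (u(\<delta> := 0)))
      \<partial>field_space V)"
  proof (rule nn_integral_L)
    have "(\<lambda>u. restrict u V) \<in> L \<rightarrow>\<^sub>M field_space V"
      by (rule measurable_restrict) (auto simp: verts_eq intro: measurable_component_L)
    from measurable_compose[OF this borel_measurable_field_density]
    have "(\<lambda>u. field_density V W \<eta> (restrict u V)) \<in> borel_measurable L" .
    moreover have "field_density V W \<eta> (restrict u V) = field_density V W \<eta> u" for u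
      by (rule field_density_cong) auto
    ultimately have [measurable]: "field_density V W \<eta> \<in> borel_measurable L" by simp
    show "(\<lambda>u. ennreal (field_density V W \<eta> u) * indicator B (beta_of G \<delta> u)) \<in> borel_measurable L" by
        measurable
  qed
  also have "\<dots> = (\<integral>\<^sup>+u. indicator B (restrict (field_beta V W \<eta> u) V) * ennreal (field_density V W \<eta> u)
      \<partial>field_space V)"
  proof (rule nn_integral_cong)
    fix u :: "'a \<Rightarrow> real"
    have "field_density V W \<eta> (u(\<delta> := 0)) = field_density V W \<eta> u"
      using \<delta>V by (intro field_density_cong) auto
    moreover have "beta_of G \<delta> (u(\<delta> := 0)) = restrict (field_beta V W \<eta> u) V"
      using \<delta>V by (subst beta_of_eq) (auto intro!: restrict_ext field_beta_cong)
    ultimately show "ennreal (field_density V W \<eta> (u(\<delta> := 0))) * indicator B (beta_of G \<delta> (u(\<delta> := 0)))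
       = indicator B (restrict (field_beta V W \<eta> u) V) * ennreal (field_density V W \<eta> u)"
      by (simp add: mult.commute)
  qed
  also have "\<dots> = (\<integral>\<^sup>+u. indicator B (restrict (field_beta V W \<eta> u) V) \<partial>network_field V W \<eta>)"
    by (subst nn_integral_network_field) (measurable, simp add: field_integral_def)
  also have "\<dots> = (\<integral>\<^sup>+x. indicator B x \<partial>distr (network_field V W \<eta>) (Pi\<^sub>M V (\<lambda>_. borel)) (\<lambda>u. restrict
      (field_beta V W \<eta> u) V))"
    by (subst nn_integral_distr) (use v in simp_all)
  also have "\<dots> = emeasure (distr (network_field V W \<eta>) (Pi\<^sub>M V (\<lambda>_. borel)) (\<lambda>u. restrict (field_beta V W \<eta>
      u) V)) B"
    by (simp add: nn_integral_indicator)
  finally show "emeasure (distr (h22_measure G \<delta>) (Pi\<^sub>M V (\<lambda>_. borel)) (\<lambda>(u, s). beta_of G \<delta> u)) B = \<dots>" .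
qed simp

lemma green_nonneg: "green G \<delta> u i j \<ge> 0"
proof (cases "i \<in> V \<and> j \<in> V")
  case True
  then show ?thesis using inverse_on_H_matrix_nonneg[OF net_scaled] by (simp add: green_eq)
qed (auto simp: green_def V)

lemma green_sym: "green G \<delta> u i j = green G \<delta> u j i"
proof (cases "i \<in> V \<and> j \<in> V")
  case True
  then show ?thesis using inverse_on_spec(4)[OF finV spd_on_H_matrix[OF net_scaled]] by (simp add: green_eq)
qed (auto simp: green_def V)

lemma green_pinned:
  assumes "i \<in> V" "j \<in> V"
  shows "green G \<delta> (u(\<delta> := 0)) i j = inverse_on V (H_matrix V W \<eta> u) i j"
proof -
  have "inverse_on V (H_matrix V W (\<lambda>i. \<eta> i * exp ((u(\<delta> := 0)) \<delta>)) (u(\<delta> := 0))) = inverse_on V (H_matrix V W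
      \<eta> u)"
    by (intro inverse_on_cong H_matrix_cong) (use \<delta>V in auto)
  then show ?thesis by (simp add: green_eq[OF assms])
qed

lemma borel_measurable_green: "(\<lambda>u. green G \<delta> u i j) \<in> borel_measurable (Pi\<^sub>M (verts G) (\<lambda>_. borel))"
proof (cases "i \<in> V \<and> j \<in> V")
  case True
  have A: "(\<lambda>u. A_matrix G u k l) \<in> borel_measurable (Pi\<^sub>M (verts G) (\<lambda>_. borel))"
    if "k \<in> verts G" "l \<in> verts G" for k l
    using that unfolding A_matrix_def by (cases "k = l") simp_all
  have "(\<lambda>u. inverse_on V (A_matrix G u) i j) \<in> borel_measurable (Pi\<^sub>M (verts G) (\<lambda>_. borel))"
    by (rule borel_measurable_inverse_on[OF finV spd_on_A_matrix]) (rule A, simp_all add: verts_eq)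
  moreover have "i \<in> verts G" "j \<in> verts G" using True by (auto simp: verts_eq)
  ultimately show ?thesis using True unfolding green_def V[symmetric] by simp
next
  case False
  then have "green G \<delta> u i j = 0" for u by (auto simp: green_def V)
  then show ?thesis by simp
qed

lemma recovers_u_field_beta:
  assumes f: "recovers_u G \<delta> f" and u: "u \<in> space (field_space V)"
  shows "f (restrict (field_beta V W \<eta> u) V) = u(\<delta> := 0)"
proof -
  have "u(\<delta> := 0) \<in> pinned G \<delta>"
    using u by (auto simp: space_PiM pinned_def verts_eq PiE_def extensional_def)
  then have "f (beta_of G \<delta> (u(\<delta> := 0))) = u(\<delta> := 0)" using f by (simp add: recovers_u_def)
  moreover have "beta_of G \<delta> (u(\<delta> := 0)) = restrict (field_beta V W \<eta> u) V"
    using \<delta>V by (subst beta_of_eq) (auto intro!: restrict_ext field_beta_cong)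
  ultimately show ?thesis by simp
qed

end

section \<open>The infinite graph\<close>

lemma connected_graph_cut:
  assumes "connected_graph G" "simple_graph G" "S \<subseteq> verts G" "S \<noteq> {}" "S \<noteq> verts G"
  shows "\<exists>i\<in>S. \<exists>j\<in>verts G - S. adj G i j"
proof -
  obtain a b where ab: "a \<in> S" "b \<in> verts G" "b \<notin> S" using assms(3-5) by blast
  then have "(a, b) \<in> {(x, y). adj G x y}\<^sup>*"
    using assms(1,3) unfolding connected_graph_def by blast
  then show ?thesis using ab
  proof (induction rule: converse_rtrancl_induct)
    case (step x y)
    have "adj G x y" using step.hyps(1) by simp
    then have "y \<in> verts G"
      using assms(2) unfolding simple_graph_def adj_def by (auto simp: doubleton_eq_iff)
    then show ?case using step \<open>adj G x y\<close> by (cases "y \<in> S") auto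
  qed simp
qed

text \<open>The random field \<open>\<beta>\<close> on the infinite graph, together with the finite-volume data: \<open>f n\<close> recovers the
  field \<open>u\<close> on the wired graph of \<open>V n\<close> from \<open>\<beta>\<close>.\<close>

locale vrjp_field =
  fixes G :: "'v wgraph"
    and V :: "nat \<Rightarrow> 'v set"
    and M :: "'w measure"
    and \<beta> :: "'v \<Rightarrow> 'w \<Rightarrow> real"
    and f :: "nat \<Rightarrow> ('v option \<Rightarrow> real) \<Rightarrow> ('v option \<Rightarrow> real)"
  assumes infinite_G: "infinite (verts G)"
    and simple_G: "simple_graph G"
    and connected_G: "connected_graph G"
    and locally_finite_G: "locally_finite_graph G"
    and weights_G: "symmetric_positive_weights G"
    and finite_V: "\<And>n. finite (V n)" and incseq_V: "incseq V" and Union_V: "(\<Union>n. V n) = verts G"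
    and prob_M: "prob_space M"
    and meas_\<beta>: "\<And>i. i \<in> verts G \<Longrightarrow> \<beta> i \<in> borel_measurable M"
    and law_\<beta>: "\<And>n. distr M (Pi\<^sub>M (Some ` V n) (\<lambda>_. borel)) (beta_restr (V n) \<beta>)
           = distr (h22_measure (wired G (V n)) None) (Pi\<^sub>M (Some ` V n) (\<lambda>_. borel))
                   (\<lambda>(u, s). beta_of (wired G (V n)) None u)"
    and recovers_f: "\<And>n. recovers_u (wired G (V n)) None (f n)"
begin

text \<open>The wired graph has the vertices \<open>Some i\<close> for \<open>i \<in> V n\<close>, and \<open>None\<close> is the reference vertex. The
  weights between the former do not depend on \<open>n\<close>; only the pinning does. \<open>B n\<close> is the restriction of
  \<open>\<beta>\<close> to \<open>V n\<close>, a random element of \<open>P n\<close>.\<close>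

definition "wired_weight x y = weight G (the x) (the y)"
definition "wired_pinning n x = (\<Sum>j | j \<in> verts G - V n \<and> adj G (the x) j. weight G (the x) j)"
abbreviation "S n \<equiv> Some ` V n"
abbreviation "P n \<equiv> Pi\<^sub>M (S n) (\<lambda>_. borel :: real measure)"
abbreviation "B n \<equiv> beta_restr (V n) \<beta>"

lemma V_sub: "V n \<subseteq> verts G" using Union_V by blast

lemma weight_G_sym: "i \<in> verts G \<Longrightarrow> j \<in> verts G \<Longrightarrow> weight G i j = weight G j i"
  using weights_G unfolding symmetric_positive_weights_def by blast

lemma weight_G_cases:
  assumes "i \<in> verts G" "j \<in> verts G"
  shows "if adj G i j then weight G i j > 0 else weight G i j = 0"
  using weights_G[unfolded symmetric_positive_weights_def, THEN bspec, OF assms(1), THEN bspec, OF assms(2)]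
  by blast

lemma adj_G_sym: "adj G i j = adj G j i"
  by (simp add: adj_def insert_commute)

lemma not_adj_G_self: "\<not> adj G i i"
  using simple_G unfolding simple_graph_def adj_def by (auto simp: doubleton_eq_iff)

lemma finite_neighbours: "i \<in> verts G \<Longrightarrow> finite {j. j \<in> verts G - A \<and> adj G i j}"
  by (rule finite_subset[of _ "{j \<in> verts G. adj G i j}"])
     (use locally_finite_G in \<open>auto simp: locally_finite_graph_def\<close>)

lemma wired_pinning_nonneg:
  assumes "x \<in> S n"
  shows "wired_pinning n x \<ge> 0"
  unfolding wired_pinning_def
proof (rule sum_nonneg)
  fix j assume j: "j \<in> {j. j \<in> verts G - V n \<and> adj G (the x) j}"
  then show "0 \<le> weight G (the x) j"
    using weight_G_cases[of "the x" j] V_sub assms by force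
qed

lemma wired_pinning_pos:
  assumes "i \<in> V n" "j \<in> verts G - V n" "adj G i j"
  shows "wired_pinning n (Some i) > 0"
  unfolding wired_pinning_def
proof (rule sum_pos2[of _ j])
  have i: "i \<in> verts G" using assms V_sub by blast
  then show "finite {j. j \<in> verts G - V n \<and> adj G (the (Some i)) j}" using finite_neighbours by simp
  show "j \<in> {j. j \<in> verts G - V n \<and> adj G (the (Some i)) j}" using assms by simp
  show "0 < weight G (the (Some i)) j" using weight_G_cases[OF i, of j] assms by simp
  show "0 \<le> weight G (the (Some i)) l" if "l \<in> {j. j \<in> verts G - V n \<and> adj G (the (Some i)) j}" for l
    using weight_G_cases[OF i, of l] that by simp
qed

text \<open>A finite nonempty subset of the infinite connected graph has an edge leaving it; it ends in \<open>V n\<close> or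
  contributes to the pinning.\<close>

lemma network_wired: "network (S n) wired_weight (wired_pinning n)"
proof -
  have nn: "wired_weight x y \<ge> 0" and sym: "wired_weight x y = wired_weight y x" if xy: "x \<in> S n" "y \<in> S n"
      for x y
  proof -
    obtain i j where x: "x = Some i" "y = Some j" and ij: "i \<in> verts G" "j \<in> verts G"
      using xy V_sub by blast
    show "wired_weight x y \<ge> 0" using weight_G_cases[OF ij] unfolding x wired_weight_def by (auto split:
        if_splits)
    show "wired_weight x y = wired_weight y x" using weight_G_sym[OF ij] unfolding x wired_weight_def by simp
  qed
  have "grounded (S n) wired_weight (wired_pinning n)"
    unfolding grounded_def
  proof (intro allI impI)
    fix A assume A: "A \<subseteq> S n" "A \<noteq> {}"
    define A' where "A' = the ` A"
    have A': "A = Some ` A'" "A' \<subseteq> V n" using A by (force simp: A'_def image_iff)+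
    have "finite A'" using A'(2) finite_V finite_subset by blast
    then have "A' \<noteq> verts G" using infinite_G by blast
    moreover have "A' \<subseteq> verts G" "A' \<noteq> {}" using A' A V_sub by auto
    ultimately obtain i j where ij: "i \<in> A'" "j \<in> verts G - A'" "adj G i j"
      using connected_graph_cut[OF connected_G simple_G] by blast
    have iV: "i \<in> V n" using ij A' by blast
    have "wired_pinning n (Some i) > 0 \<or> (\<exists>y\<in>S n - A. wired_weight (Some i) y > 0)"
    proof (cases "j \<in> V n")
      case True
      have "wired_weight (Some i) (Some j) > 0"
        using weight_G_cases[of i j] ij iV V_sub by (auto simp: wired_weight_def)
      moreover have "Some j \<in> S n - A" using True ij A' by auto
      ultimately show ?thesis by blast
    next
      case False
      then show ?thesis using wired_pinning_pos[OF iV, of j] ij by simp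
    qed
    then show "\<exists>x\<in>A. wired_pinning n x > 0 \<or> (\<exists>y\<in>S n - A. wired_weight x y > 0)" using ij A' by blast
  qed
  then show ?thesis using finite_V nn sym wired_pinning_nonneg unfolding network_def by blast
qed

lemma adj_wired:
  assumes "i \<in> V n"
  shows "j \<in> V n \<Longrightarrow> adj (wired G (V n)) (Some i) (Some j) = adj G i j"
    and "adj (wired G (V n)) (Some i) None = (\<exists>j\<in>verts G - V n. adj G i j)"
    and "adj (wired G (V n)) None (Some i) = (\<exists>j\<in>verts G - V n. adj G i j)"
proof -
  have e: "edges (wired G (V n)) = {{Some i, Some j} | i j. i \<in> V n \<and> j \<in> V n \<and> adj G i j}
           \<union> {{Some i, None} | i. i \<in> V n \<and> (\<exists>j\<in>verts G - V n. adj G i j)}"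
    by (simp add: wired_def)
  show "j \<in> V n \<Longrightarrow> adj (wired G (V n)) (Some i) (Some j) = adj G i j"
    unfolding adj_def[of "wired G (V n)"] e using assms adj_G_sym[of i j] by (auto simp: doubleton_eq_iff)
  show "adj (wired G (V n)) (Some i) None = (\<exists>j\<in>verts G - V n. adj G i j)"
    "adj (wired G (V n)) None (Some i) = (\<exists>j\<in>verts G - V n. adj G i j)"
    unfolding adj_def[of "wired G (V n)"] e using assms by (auto simp: doubleton_eq_iff)
qed

lemma verts_wired: "verts (wired G (V n)) = insert None (S n)"
  by (simp add: wired_def)

lemma weight_wired:
  "weight (wired G (V n)) (Some i) (Some j) = weight G i j"
  "weight (wired G (V n)) (Some i) None = wired_pinning n (Some i)"
  "weight (wired G (V n)) None (Some i) = wired_pinning n (Some i)"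
  "weight (wired G (V n)) None None = 0"
  by (simp_all add: wired_def wired_pinning_def)

lemma wired_pinning_zero: "\<not> (\<exists>j\<in>verts G - V n. adj G i j) \<Longrightarrow> wired_pinning n (Some i) = 0"
  unfolding wired_pinning_def by (rule sum.neutral) auto

lemma weights_wired: "symmetric_positive_weights (wired G (V n))"
proof -
  have "weight (wired G (V n)) x y = weight (wired G (V n)) y x \<and>
      (if adj (wired G (V n)) x y then weight (wired G (V n)) x y > 0 else weight (wired G (V n)) x y = 0)"
    if xy: "x \<in> insert None (S n)" "y \<in> insert None (S n)" for x y
  proof -
    have wired_pinning: "if \<exists>j\<in>verts G - V n. adj G i j then wired_pinning n (Some i) > 0 else wired_pinning
        n (Some i) = 0" if "i \<in> V n" for i
      using wired_pinning_pos[OF that] wired_pinning_zero by auto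
    show ?thesis
    proof (cases x)
      case x: None
      show ?thesis
      proof (cases y)
        case None
        have "\<not> adj (wired G (V n)) None None" by (auto simp: adj_def wired_def)
        then show ?thesis by (simp add: x None weight_wired)
      next
        case (Some j)
        then have "j \<in> V n" using xy by auto
        then show ?thesis using wired_pinning[of j] by (simp add: x Some weight_wired adj_wired)
      qed
    next
      case x: (Some i)
      then have i: "i \<in> V n" using xy by auto
      show ?thesis
      proof (cases y)
        case None
        then show ?thesis using wired_pinning[OF i] i by (simp add: x weight_wired adj_wired)
      next
        case (Some j)
        then have j: "j \<in> V n" using xy by auto
        then have ij: "i \<in> verts G" "j \<in> verts G" using i V_sub by auto
        show ?thesis using weight_G_cases[OF ij] weight_G_sym[OF ij]
          unfolding x Some weight_wired adj_wired(1)[OF i j] by blast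
      qed
    qed
  qed
  then show ?thesis unfolding symmetric_positive_weights_def verts_wired by blast
qed

lemma simple_wired: "simple_graph (wired G (V n))"
  unfolding simple_graph_def
proof
  fix e assume "e \<in> edges (wired G (V n))"
  then consider i j where "e = {Some i, Some j}" "i \<in> V n" "j \<in> V n" "adj G i j"
    | i where "e = {Some i, None}" "i \<in> V n" by (auto simp: wired_def)
  then show "e \<in> {{i, j} |i j. i \<in> verts (wired G (V n)) \<and> j \<in> verts (wired G (V n)) \<and> i \<noteq> j}"
  proof cases
    case 1
    then have "i \<noteq> j" using not_adj_G_self by blast
    then have "Some i \<noteq> Some j" by simp
    with 1 show ?thesis unfolding verts_wired by blast
  next
    case 2
    then show ?thesis unfolding verts_wired by blast
  qed
qed

sublocale Gn: pinned_graph "wired G (V n)" None "S n" wired_weight "wired_pinning n" for n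
proof
  show "S n = verts (wired G (V n)) - {None}" by (auto simp: verts_wired)
  show "weight (wired G (V n)) i j = wired_weight i j" if "i \<in> S n" "j \<in> S n" for i j
    using that by (auto simp: wired_weight_def weight_wired)
  show "weight (wired G (V n)) i None = wired_pinning n i" if "i \<in> S n" for i
    using that by (auto simp: weight_wired)
qed (simp_all add: verts_wired finite_V simple_wired weights_wired network_wired)

text \<open>\<open>Q n\<close> is the law of \<open>u\<close> at level \<open>n\<close>, and \<open>T n\<close> maps \<open>u\<close> to \<open>\<beta>\<close>.\<close>

abbreviation "Q n \<equiv> network_field (S n) wired_weight (wired_pinning n)"
abbreviation "T n u \<equiv> restrict (field_beta (S n) wired_weight (wired_pinning n) u) (S n)"

lemma measurable_T: "T n \<in> field_space (S n) \<rightarrow>\<^sub>M P n"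
  by (rule measurable_restrict_field_beta) simp

lemma measurable_B: "B n \<in> M \<rightarrow>\<^sub>M P n"
  unfolding beta_restr_def
proof (rule measurable_restrict)
  fix x assume "x \<in> S n"
  then have "the x \<in> verts G" using V_sub[of n] by auto
  then show "(\<lambda>\<omega>. \<beta> (the x) \<omega>) \<in> borel_measurable M" by (rule meas_\<beta>)
qed

lemma law_B: "distr M (P n) (B n) = distr (Q n) (P n) (T n)"
  unfolding law_\<beta> by (rule Gn.h22_beta_law)

lemma nn_integral_B:
  assumes "F \<in> borel_measurable (P n)"
  shows "(\<integral>\<^sup>+\<omega>. F (B n \<omega>) \<partial>M) = field_integral (S n) wired_weight (wired_pinning n) (\<lambda>u. F (T n u))"
proof -
  have "(\<integral>\<^sup>+\<omega>. F (B n \<omega>) \<partial>M) = (\<integral>\<^sup>+b. F b \<partial>distr M (P n) (B n))"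
    using assms measurable_B by (simp add: nn_integral_distr)
  also have "\<dots> = (\<integral>\<^sup>+u. F (T n u) \<partial>Q n)"
    unfolding law_B using assms measurable_T by (subst nn_integral_distr) simp_all
  also have "\<dots> = field_integral (S n) wired_weight (wired_pinning n) (\<lambda>u. F (T n u))"
    by (rule nn_integral_network_field) (rule measurable_compose[OF measurable_T assms])
  finally show ?thesis .
qed

lemma all_moments_B:
  assumes Z: "Z \<in> borel_measurable (P n)" and m: "all_moments (Q n) (\<lambda>u. Z (T n u))"
  shows "all_moments M (\<lambda>\<omega>. Z (B n \<omega>))"
proof -
  have "all_moments (distr M (P n) (B n)) Z"
    unfolding law_B using m measurable_T Z by (subst all_moments_distr_iff) simp_all
  then show ?thesis using all_moments_distr_iff[OF measurable_B Z] by simp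
qed

text \<open>The field \<open>e\<^sup>u\<close> and the Green's function at level \<open>n\<close> as functions of \<open>b = B n \<omega>\<close>, with their values
  \<open>1\<close> and \<open>0\<close> outside \<open>V n\<close>.\<close>

definition "\<psi> n b v = (if v \<in> V n then exp (f n b (Some v)) else 1)"
definition "\<Gamma> n b v w = (if v \<in> V n \<and> w \<in> V n then green (wired G (V n)) None (f n b) (Some v) (Some w) else 0)"

lemma measurable_f: "f n \<in> P n \<rightarrow>\<^sub>M Pi\<^sub>M (verts (wired G (V n))) (\<lambda>_. borel)"
  using recovers_f[of n] by (simp add: recovers_u_def verts_wired image_def)

lemma f_T: "u \<in> space (field_space (S n)) \<Longrightarrow> f n (T n u) = u(None := 0)"
  by (rule Gn.recovers_u_field_beta[OF recovers_f])

lemma borel_measurable_\<psi>: "(\<lambda>b. \<psi> n b v) \<in> borel_measurable (P n)"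
proof (cases "v \<in> V n")
  case True
  then have "Some v \<in> verts (wired G (V n))" by (simp add: verts_wired)
  from measurable_compose[OF measurable_f measurable_component_singleton[OF this]]
  have "(\<lambda>b. f n b (Some v)) \<in> borel_measurable (P n)" .
  then show ?thesis using True by (simp add: \<psi>_def)
qed (simp add: \<psi>_def)

lemma borel_measurable_\<Gamma>: "(\<lambda>b. \<Gamma> n b v w) \<in> borel_measurable (P n)"
  using measurable_compose[OF measurable_f Gn.borel_measurable_green]
  by (cases "v \<in> V n \<and> w \<in> V n") (simp_all add: \<Gamma>_def)

lemma \<psi>_T:
  assumes "u \<in> space (field_space (S n))"
  shows "\<psi> n (T n u) v = (if v \<in> V n then exp (u (Some v)) else 1)"
  by (simp add: \<psi>_def f_T[OF assms])

lemma \<Gamma>_T: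
  assumes "u \<in> space (field_space (S n))"
  shows "\<Gamma> n (T n u) v w = (if v \<in> V n \<and> w \<in> V n
    then inverse_on (S n) (H_matrix (S n) wired_weight (wired_pinning n) u) (Some v) (Some w) else 0)"
  by (simp add: \<Gamma>_def f_T[OF assms] Gn.green_pinned)

lemma prob_Q: "prob_space (Q n)"
  by (rule prob_space_network_field[OF network_wired])

lemma space_Q: "space (Q n) = space (field_space (S n))"
  by (simp add: network_field_def)

lemma all_moments_\<psi>: "all_moments M (\<lambda>\<omega>. \<psi> n (B n \<omega>) v)"
proof (rule all_moments_B[OF borel_measurable_\<psi>])
  interpret Q: prob_space "Q n" by (rule prob_Q)
  have "all_moments (Q n) (\<lambda>u. if v \<in> V n then exp (u (Some v)) else 1)"
    using all_moments_exp[OF network_wired, of "Some v" n] Q.finite_measure_axioms by (cases "v \<in> V n") simp_all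
  then show "all_moments (Q n) (\<lambda>u. \<psi> n (T n u) v)"
    by (rule all_moments_cong[THEN iffD1, rotated]) (simp add: \<psi>_T space_Q)
qed

lemma all_moments_\<Gamma>: "all_moments M (\<lambda>\<omega>. \<Gamma> n (B n \<omega>) v w)"
proof (rule all_moments_B[OF borel_measurable_\<Gamma>])
  interpret Q: prob_space "Q n" by (rule prob_Q)
  have "all_moments (Q n) (\<lambda>u. if v \<in> V n \<and> w \<in> V n
    then inverse_on (S n) (H_matrix (S n) wired_weight (wired_pinning n) u) (Some v) (Some w) else 0)"
    using all_moments_inverse_on_H_matrix[OF network_wired, of "Some v" n "Some w"] Q.finite_measure_axioms
    by (cases "v \<in> V n \<and> w \<in> V n") (simp_all, auto)
  then show "all_moments (Q n) (\<lambda>u. \<Gamma> n (T n u) v w)"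
    by (rule all_moments_cong[THEN iffD1, rotated]) (simp add: \<Gamma>_T space_Q)
qed

lemma gauss_pair_B: "gauss_pair M (\<lambda>\<omega> k. \<psi> n (B n \<omega>) (i k)) (\<lambda>\<omega> k l. \<Gamma> n (B n \<omega>) (i k) (i l))"
proof -
  have "\<psi> n b v \<ge> 0" "\<Gamma> n b v w \<ge> 0" for b v w
    by (simp_all add: \<psi>_def \<Gamma>_def Gn.green_nonneg)
  moreover have "\<Gamma> n b v w = \<Gamma> n b w v" for b v w
    by (auto simp: \<Gamma>_def intro: Gn.green_sym)
  ultimately show ?thesis unfolding gauss_pair_def using all_moments_\<psi> all_moments_\<Gamma> by blast
qed

section \<open>The martingale property\<close>

text \<open>For \<open>\<theta> = load A t i\<close> and a function \<open>g\<close> on \<open>S n\<close>, the sum \<open>\<langle>\<theta>, g\<rangle>\<close> is \<open>\<Sum>\<^sub>k t k g (i k)\<close> over the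
  indices with \<open>i k \<in> V n\<close>. Repeated vertices \<open>i k = i l\<close> are allowed; their parameters add up.\<close>

definition load :: "nat set \<Rightarrow> (nat \<Rightarrow> real) \<Rightarrow> (nat \<Rightarrow> 'v) \<Rightarrow> 'v option \<Rightarrow> real" where
  "load A t i x = (\<Sum>k\<in>A. t k * of_bool (Some (i k) = x))"

lemma sum_load:
  "(\<Sum>x\<in>S n. load A t i x * g x) = (\<Sum>k\<in>A. t k * (if i k \<in> V n then g (Some (i k)) else 0))"
proof -
  have "(\<Sum>x\<in>S n. load A t i x * g x) = (\<Sum>k\<in>A. \<Sum>x\<in>S n. t k * (of_bool (Some (i k) = x) * g x))"
    unfolding load_def sum_distrib_right by (subst sum.swap) (simp add: mult.assoc)
  also have "\<dots> = (\<Sum>k\<in>A. t k * (\<Sum>x\<in>S n. of_bool (Some (i k) = x) * g x))"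
    by (simp add: sum_distrib_left)
  also have "\<dots> = (\<Sum>k\<in>A. t k * (if i k \<in> V n then g (Some (i k)) else 0))"
  proof (rule sum.cong[OF refl])
    fix k
    show "t k * (\<Sum>x\<in>S n. of_bool (Some (i k) = x) * g x) = t k * (if i k \<in> V n then g (Some (i k)) else 0)"
    proof (cases "i k \<in> V n")
      case True
      then show ?thesis using finite_V by (simp add: sum_of_bool_mult)
    next
      case False
      then have "(\<Sum>x\<in>S n. of_bool (Some (i k) = x) * g x) = 0" by (intro sum.neutral) auto
      then show ?thesis using False by simp
    qed
  qed
  finally show ?thesis .
qed

text \<open>Tilting at level \<open>n\<close>. The prefactor does not depend on \<open>n\<close>: an index \<open>k\<close> with \<open>i k\<close> outside \<open>V n\<close>
  contributes \<open>e\<^bsup>- t k\<^esup>\<close> because \<open>e\<^sup>u = 1\<close> and \<open>G = 0\<close> there, and an index inside contributes it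
  through tilting.\<close>

lemma generating_function:
  fixes A :: "nat set" and t :: "nat \<Rightarrow> real" and i :: "nat \<Rightarrow> 'v"
  assumes t: "\<And>k. t k \<ge> 0" and \<Phi>: "\<Phi> \<in> borel_measurable (P n)"
  defines "\<theta> \<equiv> load A t i"
  shows "(\<integral>\<^sup>+\<omega>. ennreal (gauss_exp A t (\<lambda>k. \<psi> n (B n \<omega>) (i k)) (\<lambda>k l. \<Gamma> n (B n \<omega>) (i k) (i l))) * \<Phi> (B n \<omega>) \<partial>M)
    = ennreal (exp (- (\<Sum>k\<in>A. t k))) *
      field_integral (S n) wired_weight (\<lambda>x. wired_pinning n x + \<theta> x) (\<lambda>u. \<Phi> (restrict (field_beta (S n)
          wired_weight (\<lambda>x. wired_pinning n x + \<theta> x) u) (S n)))"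
proof -
  let ?g = "\<lambda>b. gauss_exp A t (\<lambda>k. \<psi> n b (i k)) (\<lambda>k l. \<Gamma> n b (i k) (i l))"
  let ?H = "\<lambda>u. H_matrix (S n) wired_weight (wired_pinning n) u"
  define c where "c = (\<Sum>k\<in>A. t k * of_bool (i k \<notin> V n))"
  let ?E = "\<lambda>u. ennreal (exp (- (\<Sum>x\<in>S n. \<theta> x * exp (u x)) - inverse_form (S n) (?H u) \<theta> / 2)) * \<Phi> (T n u)"
  note [measurable] = borel_measurable_\<psi> borel_measurable_\<Gamma> \<Phi> measurable_T
    borel_measurable_inverse_form_H_matrix[OF network_wired]
  have g [measurable]: "?g \<in> borel_measurable (P n)" unfolding gauss_exp_def by measurable
  have E: "?E \<in> borel_measurable (field_space (S n))" by measurable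
  have \<theta>: "\<theta> x \<ge> 0" for x unfolding \<theta>_def load_def using t by (intro sum_nonneg) simp
  have "(\<integral>\<^sup>+\<omega>. ennreal (?g (B n \<omega>)) * \<Phi> (B n \<omega>) \<partial>M)
      = field_integral (S n) wired_weight (wired_pinning n) (\<lambda>u. ennreal (?g (T n u)) * \<Phi> (T n u))"
    by (rule nn_integral_B[where F="\<lambda>b. ennreal (?g b) * \<Phi> b"]) measurable
  also have "\<dots> = field_integral (S n) wired_weight (wired_pinning n) (\<lambda>u. ennreal (exp (- c)) * ?E u)"
  proof (rule field_integral_cong)
    fix u assume u: "u \<in> space (field_space (S n))"
    let ?G = "inverse_on (S n) (?H u)"
    have "(\<Sum>k\<in>A. t k * \<psi> n (T n u) (i k))
       = (\<Sum>k\<in>A. t k * (if i k \<in> V n then exp (u (Some (i k))) else 0)) + c"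
      unfolding c_def sum.distrib[symmetric] by (intro sum.cong refl) (simp add: \<psi>_T[OF u])
    also have "\<dots> = (\<Sum>x\<in>S n. \<theta> x * exp (u x)) + c"
      unfolding \<theta>_def by (simp only: sum_load)
    finally have 1: "(\<Sum>k\<in>A. t k * \<psi> n (T n u) (i k)) = (\<Sum>x\<in>S n. \<theta> x * exp (u x)) + c" .
    have "inverse_form (S n) (?H u) \<theta> = (\<Sum>x\<in>S n. \<theta> x * (\<Sum>y\<in>S n. \<theta> y * ?G x y))"
      unfolding inverse_form_def sum_distrib_left by (intro sum.cong refl) simp
    also have "\<dots> = (\<Sum>k\<in>A. \<Sum>l\<in>A. t k * t l * \<Gamma> n (T n u) (i k) (i l))"
      unfolding \<theta>_def sum_load
      by (rule sum.cong[OF refl]) (simp add: \<Gamma>_T[OF u] sum_distrib_left mult.assoc)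
    finally have 2: "(\<Sum>k\<in>A. \<Sum>l\<in>A. t k * t l * \<Gamma> n (T n u) (i k) (i l)) = inverse_form (S n) (?H u) \<theta>" ..
    have "?g (T n u) = exp (- c) * exp (- (\<Sum>x\<in>S n. \<theta> x * exp (u x)) - inverse_form (S n) (?H u) \<theta> / 2)"
      unfolding gauss_exp_def 1 2 exp_add[symmetric] by simp
    then show "ennreal (?g (T n u)) * \<Phi> (T n u) = ennreal (exp (- c)) * ?E u"
      by (simp add: ennreal_mult' mult.assoc)
  qed
  also have "\<dots> = ennreal (exp (- c)) * field_integral (S n) wired_weight (wired_pinning n) ?E" by (rule
      field_integral_cmult[OF E])
  also have "field_integral (S n) wired_weight (wired_pinning n) ?E = field_integral (S n) wired_weight (\<lambda>x.
      wired_pinning n x + \<theta> x)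
      (\<lambda>u. ennreal (exp (- (\<Sum>x\<in>S n. \<theta> x))) * \<Phi> (restrict (field_beta (S n) wired_weight (\<lambda>x. wired_pinning n
          x + \<theta> x) u) (S n)))"
    by (rule field_integral_tilt[OF network_wired \<theta> \<Phi>])
  also have "\<dots> = ennreal (exp (- (\<Sum>x\<in>S n. \<theta> x))) * field_integral (S n) wired_weight (\<lambda>x. wired_pinning n x
      + \<theta> x)
      (\<lambda>u. \<Phi> (restrict (field_beta (S n) wired_weight (\<lambda>x. wired_pinning n x + \<theta> x) u) (S n)))"
    by (rule field_integral_cmult) (rule measurable_compose[OF measurable_restrict_field_beta[OF order_refl] \<Phi>])
  also have "ennreal (exp (- c)) * (ennreal (exp (- (\<Sum>x\<in>S n. \<theta> x))) * r) = ennreal (exp (- (\<Sum>k\<in>A. t k))) *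
      r" for r
  proof -
    have "(\<Sum>x\<in>S n. \<theta> x) = (\<Sum>k\<in>A. t k * (if i k \<in> V n then 1 else 0))"
      using sum_load[where n=n and A=A and t=t and i=i and g="\<lambda>_. 1"] by (simp add: \<theta>_def)
    then have "c + (\<Sum>x\<in>S n. \<theta> x) = (\<Sum>k\<in>A. t k)"
      unfolding c_def by (simp only: sum.distrib[symmetric]) (intro sum.cong refl, simp)
    then have "exp (- c) * exp (- (\<Sum>x\<in>S n. \<theta> x)) = exp (- (\<Sum>k\<in>A. t k))"
      unfolding exp_add[symmetric] by simp
    then show ?thesis by (metis ennreal_mult' exp_ge_zero mult.assoc)
  qed
  finally show ?thesis .
qed

lemma V_mono: "m \<le> n \<Longrightarrow> V m \<subseteq> V n"
  using incseq_V by (rule incseqD)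

text \<open>Passing from \<open>V n\<close> to \<open>V m\<close> moves the weights towards \<open>V n - V m\<close> into the pinning, in agreement
  with the marginal law of the field.\<close>

lemma wired_pinning_marginal:
  assumes mn: "m \<le> n" and x: "x \<in> S m"
  shows "wired_pinning m x = wired_pinning n x + (\<Sum>l\<in>Some ` (V n - V m). wired_weight x l)"
proof -
  obtain i where i: "x = Some i" "i \<in> verts G" using x V_sub by blast
  let ?N = "\<lambda>A. {j. j \<in> verts G - A \<and> adj G i j}"
  have "?N (V m) = ?N (V n) \<union> {j \<in> V n - V m. adj G i j}" using V_mono[OF mn] V_sub by blast
  then have "wired_pinning m x = (\<Sum>j\<in>?N (V n) \<union> {j \<in> V n - V m. adj G i j}. weight G i j)"
    by (simp add: wired_pinning_def i)
  also have "\<dots> = (\<Sum>j\<in>?N (V n). weight G i j) + (\<Sum>j | j \<in> V n - V m \<and> adj G i j. weight G i j)"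
    by (rule sum.union_disjoint) (use finite_neighbours[OF i(2)] finite_V in auto)
  also have "(\<Sum>j | j \<in> V n - V m \<and> adj G i j. weight G i j) = (\<Sum>j\<in>V n - V m. weight G i j)"
  proof (rule sum.mono_neutral_left)
    show "\<forall>j\<in>V n - V m - {j \<in> V n - V m. adj G i j}. weight G i j = 0"
    proof
      fix j assume j: "j \<in> V n - V m - {j \<in> V n - V m. adj G i j}"
      then have "j \<in> verts G" "\<not> adj G i j" using V_sub by auto
      then show "weight G i j = 0" using weight_G_cases[OF i(2)] by simp
    qed
  qed (use finite_V in auto)
  also have "\<dots> = (\<Sum>l\<in>Some ` (V n - V m). wired_weight x l)"
    by (subst sum.reindex) (simp_all add: wired_weight_def i)
  finally show ?thesis by (simp add: wired_pinning_def i)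
qed

lemma field_integral_wired_marginal:
  assumes mn: "m \<le> n" and \<theta>: "\<And>x. \<theta> x \<ge> 0" and \<Phi>: "\<Phi> \<in> borel_measurable (P m)"
  shows "field_integral (S n) wired_weight (\<lambda>x. wired_pinning n x + \<theta> x) (\<lambda>u. \<Phi> (restrict (field_beta (S n)
      wired_weight (\<lambda>x. wired_pinning n x + \<theta> x) u) (S m)))
    = field_integral (S m) wired_weight (\<lambda>x. wired_pinning m x + \<theta> x) (\<lambda>u. \<Phi> (restrict (field_beta (S m)
        wired_weight (\<lambda>x. wired_pinning m x + \<theta> x) u) (S m)))"
proof -
  let ?U = "Some ` (V n - V m)"
  let ?e = "\<lambda>x. wired_pinning n x + \<theta> x + (\<Sum>l\<in>?U. wired_weight x l)" and ?e' = "\<lambda>x. wired_pinning m x + \<theta> x"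
  have Sn: "S n = S m \<union> ?U" using V_mono[OF mn] by auto
  have e: "?e x = ?e' x" if "x \<in> S m" for x using wired_pinning_marginal[OF mn that] by simp
  have "network (S m \<union> ?U) wired_weight (\<lambda>x. wired_pinning n x + \<theta> x)"
    unfolding Sn[symmetric] by (rule network_mono_pinning[OF network_wired \<theta>])
  from field_integral_marginal[OF this _ \<Phi>]
  have "field_integral (S n) wired_weight (\<lambda>x. wired_pinning n x + \<theta> x) (\<lambda>u. \<Phi> (restrict (field_beta (S n)
      wired_weight (\<lambda>x. wired_pinning n x + \<theta> x) u) (S m)))
      = field_integral (S m) wired_weight ?e (\<lambda>u. \<Phi> (restrict (field_beta (S m) wired_weight ?e u) (S m)))"
    unfolding Sn by auto
  also have "\<dots> = field_integral (S m) wired_weight ?e' (\<lambda>u. \<Phi> (restrict (field_beta (S m) wired_weight ?e u)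
      (S m)))"
    by (rule field_integral_pinning_cong) (rule e)
  also have "\<dots> = field_integral (S m) wired_weight ?e' (\<lambda>u. \<Phi> (restrict (field_beta (S m) wired_weight ?e'
      u) (S m)))"
  proof (rule field_integral_cong)
    fix u
    have "restrict (field_beta (S m) wired_weight ?e u) (S m) = restrict (field_beta (S m) wired_weight ?e'
        u) (S m)"
      by (rule restrict_ext, rule field_beta_cong) (rule refl, erule e, assumption)
    then show "\<Phi> (restrict (field_beta (S m) wired_weight ?e u) (S m)) = \<Phi> (restrict (field_beta (S m)
        wired_weight ?e' u) (S m))"
      by (rule arg_cong)
  qed
  finally show ?thesis .
qed

lemma restrict_B: "m \<le> n \<Longrightarrow> restrict (B n \<omega>) (S m) = B m \<omega>"
  using V_mono[of m n] by (auto simp: beta_restr_def fun_eq_iff)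

text \<open>Both sides equal the quantity \<open>C\<close>, in which only level \<open>m\<close> occurs.\<close>

lemma generating_function_eq:
  fixes A :: "nat set" and t :: "nat \<Rightarrow> real" and i :: "nat \<Rightarrow> 'v"
  assumes mn: "m \<le> n" and D: "D \<in> sets (P m)" and t: "\<And>k. t k \<ge> 0"
  defines "g \<equiv> \<lambda>n \<omega>. gauss_exp A t (\<lambda>k. \<psi> n (B n \<omega>) (i k)) (\<lambda>k l. \<Gamma> n (B n \<omega>) (i k) (i l))"
  shows "(\<integral>\<omega>. indicator (B m -` D \<inter> space M) \<omega> * g n \<omega> \<partial>M) = (\<integral>\<omega>. indicator (B m -` D \<inter> space M) \<omega> * g m \<omega> \<partial>M)"
proof -
  define C where "C = ennreal (exp (- (\<Sum>k\<in>A. t k))) * field_integral (S m) wired_weight (\<lambda>x. wired_pinning m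
      x + load A t i x)
     (\<lambda>u. indicator D (restrict (field_beta (S m) wired_weight (\<lambda>x. wired_pinning m x + load A t i x) u) (S
         m)))"
  have load: "load A t i x \<ge> 0" for x unfolding load_def using t by (intro sum_nonneg) simp
  have "(\<integral>\<omega>. indicator (B m -` D \<inter> space M) \<omega> * g q \<omega> \<partial>M) = enn2real C" if q: "m \<le> q" for q
  proof -
    let ?\<Phi> = "\<lambda>b. indicator D (restrict b (S m)) :: ennreal"
    have sub: "S m \<subseteq> S q" using V_mono[OF q] by auto
    have "(\<lambda>b. restrict b (S m)) \<in> P q \<rightarrow>\<^sub>M P m" using sub by (rule measurable_restrict_subset)
    from measurable_compose[OF this borel_measurable_indicator[OF D]]
    have \<Phi>: "?\<Phi> \<in> borel_measurable (P q)" .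
    note [measurable] = measurable_compose[OF measurable_B borel_measurable_\<psi>]
      measurable_compose[OF measurable_B borel_measurable_\<Gamma>] measurable_sets[OF measurable_B D]
    have "(\<integral>\<omega>. indicator (B m -` D \<inter> space M) \<omega> * g q \<omega> \<partial>M)
      = enn2real (\<integral>\<^sup>+\<omega>. ennreal (indicator (B m -` D \<inter> space M) \<omega> * g q \<omega>) \<partial>M)"
    proof (rule integral_eq_nn_integral)
      show "(\<lambda>\<omega>. indicator (B m -` D \<inter> space M) \<omega> * g q \<omega>) \<in> borel_measurable M"
        unfolding g_def gauss_exp_def by measurable
      show "AE \<omega> in M. 0 \<le> indicator (B m -` D \<inter> space M) \<omega> * g q \<omega>"
        by (simp add: g_def gauss_exp_def)
    qed
    also have "(\<integral>\<^sup>+\<omega>. ennreal (indicator (B m -` D \<inter> space M) \<omega> * g q \<omega>) \<partial>M)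
      = (\<integral>\<^sup>+\<omega>. ennreal (g q \<omega>) * ?\<Phi> (B q \<omega>) \<partial>M)"
      by (rule nn_integral_cong) (auto simp: restrict_B[OF q] indicator_def)
    also have "\<dots> = ennreal (exp (- (\<Sum>k\<in>A. t k))) * field_integral (S q) wired_weight (\<lambda>x. wired_pinning q x
        + load A t i x)
       (\<lambda>u. ?\<Phi> (restrict (field_beta (S q) wired_weight (\<lambda>x. wired_pinning q x + load A t i x) u) (S q)))"
      unfolding g_def by (rule generating_function[OF t \<Phi>])
    also have "\<dots> = C"
    proof -
      have "restrict (restrict h (S q)) (S m) = restrict h (S m)" for h :: "'v option \<Rightarrow> real"
        using sub by (auto simp: fun_eq_iff)
      then show ?thesis unfolding C_def
        by (simp add: field_integral_wired_marginal[OF q load borel_measurable_indicator[OF D]])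
    qed
    finally show ?thesis .
  qed
  from this[OF mn] this[OF order_refl] show ?thesis by simp
qed

lemma space_beta_algebra: "space (beta_algebra M (V n) \<beta>) = space M"
  by (simp add: beta_algebra_def)

lemma B_space: "B n \<in> space M \<rightarrow> space (P n)"
  using measurable_space[OF measurable_B] by auto

lemma sets_beta_algebra: "sets (beta_algebra M (V n) \<beta>) = {B n -` D \<inter> space M | D. D \<in> sets (P n)}"
  unfolding beta_algebra_def by (rule sets_vimage_algebra2[OF B_space])

lemma measurable_B_beta_algebra: "B n \<in> beta_algebra M (V n) \<beta> \<rightarrow>\<^sub>M P n"
  unfolding beta_algebra_def by (rule measurable_vimage_algebra1[OF B_space])

lemma subalgebra_beta: "subalgebra M (beta_algebra M (V n) \<beta>)"
  unfolding subalgebra_def space_beta_algebra sets_beta_algebra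
  using measurable_sets[OF measurable_B] by auto

lemma filtration_beta: "filtration (space M) (\<lambda>n. beta_algebra M (V n) \<beta>)"
proof
  fix m n :: nat assume mn: "m \<le> n"
  show "sets (beta_algebra M (V m) \<beta>) \<subseteq> sets (beta_algebra M (V n) \<beta>)"
  proof
    fix E assume "E \<in> sets (beta_algebra M (V m) \<beta>)"
    then obtain D where D: "D \<in> sets (P m)" "E = B m -` D \<inter> space M" by (auto simp: sets_beta_algebra)
    have "S m \<subseteq> S n" using V_mono[OF mn] by auto
    then have "(\<lambda>b. restrict b (S m)) \<in> P n \<rightarrow>\<^sub>M P m" by (rule measurable_restrict_subset)
    from measurable_sets[OF measurable_compose[OF measurable_B_beta_algebra this] D(1)]
    show "E \<in> sets (beta_algebra M (V n) \<beta>)"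
      by (simp add: D(2) restrict_B[OF mn] space_beta_algebra)
  qed
qed (rule space_beta_algebra)

text \<open>The events of the filtration at time \<open>m\<close> are those determined by \<open>B m\<close>, so equality of the integrals
  over them identifies the conditional expectation.\<close>

theorem martingale_wick:
  assumes A: "finite A"
  shows "martingale M (\<lambda>n. beta_algebra M (V n) \<beta>)
    (\<lambda>n \<omega>. wick A (\<lambda>k. exp (u_field (V n) (f n) \<beta> \<omega> (i k)))
       (\<lambda>k l. green_field G (V n) (f n) \<beta> \<omega> (i k) (i l)))"
proof -
  let ?Z = "\<lambda>n \<omega>. wick A (\<lambda>k. \<psi> n (B n \<omega>) (i k)) (\<lambda>k l. \<Gamma> n (B n \<omega>) (i k) (i l))"
  let ?F = "\<lambda>n. beta_algebra M (V n) \<beta>"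
  interpret prob_space M by (rule prob_M)
  have Z: "(\<lambda>k. exp (u_field (V n) (f n) \<beta> \<omega> (i k))) = (\<lambda>k. \<psi> n (B n \<omega>) (i k))"
    "(\<lambda>k l. green_field G (V n) (f n) \<beta> \<omega> (i k) (i l)) = (\<lambda>k l. \<Gamma> n (B n \<omega>) (i k) (i l))" for n \<omega>
    by (auto simp: u_field_def \<psi>_def green_field_def \<Gamma>_def fun_eq_iff)
  have Zm: "?Z n \<in> borel_measurable (?F n)" for n
  proof -
    note [measurable] = measurable_compose[OF measurable_B_beta_algebra borel_measurable_\<psi>]
      measurable_compose[OF measurable_B_beta_algebra borel_measurable_\<Gamma>]
    show ?thesis unfolding wick_def by measurable
  qed
  have Zint: "integrable M (?Z n)" for n
    by (intro all_moments_integrable all_moments_wick finite_measure_axioms all_moments_\<psi> all_moments_\<Gamma>)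
  have ce: "AE \<omega> in M. real_cond_exp M (?F m) (?Z n) \<omega> = ?Z m \<omega>" if mn: "m \<le> n" for m n
  proof -
    interpret finite_measure_subalgebra M "?F m" by unfold_locales (rule subalgebra_beta)
    show ?thesis
    proof (rule real_cond_exp_charact)
      fix E assume "E \<in> sets (?F m)"
      then obtain D where D: "D \<in> sets (P m)" "E = B m -` D \<inter> space M" by (auto simp: sets_beta_algebra)
      have E: "E \<in> sets M" using measurable_sets[OF measurable_B D(1)] D(2) by simp
      have "(\<integral>\<omega>. indicator E \<omega> * ?Z n \<omega> \<partial>M) = (\<integral>\<omega>. indicator E \<omega> * ?Z m \<omega> \<partial>M)"
        by (rule wick_integral_eq[OF finite_measure_axioms gauss_pair_B gauss_pair_B E A])
           (unfold D(2), rule generating_function_eq[OF mn D(1)])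
      then show "(\<integral>\<omega>\<in>E. ?Z n \<omega> \<partial>M) = (\<integral>\<omega>\<in>E. ?Z m \<omega> \<partial>M)"
        by (simp add: set_lebesgue_integral_def)
    qed (rule Zint Zm)+
  qed
  show ?thesis unfolding martingale_def Z
    using filtration_beta subalgebra_beta Zm Zint ce by blast
qed

end

lemma wick_eq_sum_pairings:
  assumes "finite A"
  shows "wick A X Y = (\<Sum>I | I \<subseteq> A \<and> even (card I). \<Sum>P\<in>pairings I.
     (-1) ^ (card I div 2) * (\<Prod>k\<in>A - I. X k) * (\<Prod>p\<in>P. Y (Min p) (Max p)))"
  unfolding sum_pairings_eq_sum_matchings[OF assms] wick_def
  by (intro sum.cong refl) (simp add: card_Union_matching[OF assms])

lemma wick_1: "wick {1} X Y = X 1"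
  and wick_2: "wick {1, 2} X Y = X 1 * X 2 - Y 1 2"
  and wick_3: "wick {1, 2, 3} X Y = X 1 * X 2 * X 3 - X 1 * Y 2 3 - X 2 * Y 1 3 - X 3 * Y 1 2"
  if sym: "\<And>k l. Y k l = Y l k"
proof -
  have single: "wick {k} X Y = X k" for k
    using wick_insert[of "{}" k Y X] sym by simp
  have pair: "wick {k, l} X Y = X k * X l - Y k l" if "k \<noteq> l" for k l
    using wick_insert[of "{l}" k Y X] sym that by (simp add: single)
  show "wick {1} X Y = X 1" by (rule single)
  show "wick {1, 2} X Y = X 1 * X 2 - Y 1 2" by (simp add: pair)
  have "{2, 3} - {2} = {3 :: nat}" "{2, 3} - {3} = {2 :: nat}" by auto
  then show "wick {1, 2, 3} X Y = X 1 * X 2 * X 3 - X 1 * Y 2 3 - X 2 * Y 1 3 - X 3 * Y 1 2"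
    using wick_insert[of "{2, 3}" 1 Y X] sym by (simp add: single pair algebra_simps)
qed

theorem corollary2p7:
  fixes G :: "'v wgraph"
    and V :: "nat \<Rightarrow> 'v set"
    and M :: "'w measure"
    and \<beta> :: "'v \<Rightarrow> 'w \<Rightarrow> real"
    and f :: "nat \<Rightarrow> ('v option \<Rightarrow> real) \<Rightarrow> ('v option \<Rightarrow> real)"
    and F :: "nat \<Rightarrow> 'w measure"
    and u :: "nat \<Rightarrow> 'w \<Rightarrow> 'v \<Rightarrow> real"
    and Gr :: "nat \<Rightarrow> 'w \<Rightarrow> 'v \<Rightarrow> 'v \<Rightarrow> real"
  assumes "infinite (verts G)"
    and "simple_graph G"
    and "connected_graph G"
    and "locally_finite_graph G"
    and "symmetric_positive_weights G"
    and "\<And>n. finite (V n)" and "incseq V" and "(\<Union>n. V n) = verts G"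
    and "prob_space M"
    and "\<And>i. i \<in> verts G \<Longrightarrow> \<beta> i \<in> borel_measurable M"
    and "\<And>n. distr M (Pi\<^sub>M (Some ` V n) (\<lambda>_. borel)) (beta_restr (V n) \<beta>)
           = distr (h22_measure (wired G (V n)) None) (Pi\<^sub>M (Some ` V n) (\<lambda>_. borel))
                   (\<lambda>(u, s). beta_of (wired G (V n)) None u)"
    and "\<And>n. recovers_u (wired G (V n)) None (f n)"
  defines "F \<equiv> \<lambda>n. beta_algebra M (V n) \<beta>"
    and "u \<equiv> \<lambda>n. u_field (V n) (f n) \<beta>"
    and "Gr \<equiv> \<lambda>n. green_field G (V n) (f n) \<beta>"
  shows "(\<forall>j\<in>verts G. martingale M F (\<lambda>n \<omega>. exp (u n \<omega> j)))
    \<and> (\<forall>j\<in>verts G. \<forall>k\<in>verts G.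
           martingale M F (\<lambda>n \<omega>. exp (u n \<omega> j + u n \<omega> k) - Gr n \<omega> j k))
    \<and> (\<forall>j\<in>verts G. \<forall>k\<in>verts G. \<forall>l\<in>verts G.
           martingale M F (\<lambda>n \<omega>. exp (u n \<omega> j + u n \<omega> k + u n \<omega> l)
             - exp (u n \<omega> j) * Gr n \<omega> k l
             - exp (u n \<omega> k) * Gr n \<omega> j l
             - exp (u n \<omega> l) * Gr n \<omega> j k))
    \<and> (\<forall>(m::nat) (i::nat \<Rightarrow> 'v). (\<forall>k\<in>{1..m}. i k \<in> verts G) \<longrightarrow>
           martingale M F (\<lambda>n \<omega>.
             \<Sum>I | I \<subseteq> {1..m} \<and> even (card I). \<Sum>P\<in>pairings I.
               (-1) ^ (card I div 2)
               * (\<Prod>k\<in>{1..m} - I. exp (u n \<omega> (i k)))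
               * (\<Prod>p\<in>P. Gr n \<omega> (i (Min p)) (i (Max p)))))"
proof -
  interpret vrjp_field G V M \<beta> f
    by (rule vrjp_field.intro) (fact assms)+
  have sym: "Gr n \<omega> v w = Gr n \<omega> w v" for n \<omega> v w
    by (auto simp: Gr_def green_field_def intro: Gn.green_sym)
  have wick: "martingale M F (\<lambda>n \<omega>. wick A (\<lambda>k. exp (u n \<omega> (i k))) (\<lambda>k l. Gr n \<omega> (i k) (i l)))"
    if "finite A" for A i
    unfolding F_def u_def Gr_def by (rule martingale_wick[OF that])
  have 1: "martingale M F (\<lambda>n \<omega>. exp (u n \<omega> j))" for j
    using wick[of "{1}" "\<lambda>_. j"] by (simp add: wick_1 sym del: One_nat_def)
  have 2: "martingale M F (\<lambda>n \<omega>. exp (u n \<omega> j + u n \<omega> k) - Gr n \<omega> j k)" for j k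
    using wick[of "{1, 2}" "\<lambda>n. if n = 1 then j else k"] by (simp add: wick_2 sym exp_add del: One_nat_def)
  have 3: "martingale M F (\<lambda>n \<omega>. exp (u n \<omega> j + u n \<omega> k + u n \<omega> l)
             - exp (u n \<omega> j) * Gr n \<omega> k l
             - exp (u n \<omega> k) * Gr n \<omega> j l
             - exp (u n \<omega> l) * Gr n \<omega> j k)" for j k l
    using wick[of "{1, 2, 3}" "\<lambda>n. if n = 1 then j else if n = 2 then k else l"]
    by (simp add: wick_3 sym exp_add del: One_nat_def)
  have 4: "martingale M F (\<lambda>n \<omega>.
             \<Sum>I | I \<subseteq> {1..m} \<and> even (card I). \<Sum>P\<in>pairings I.
               (-1) ^ (card I div 2)
               * (\<Prod>k\<in>{1..m} - I. exp (u n \<omega> (i k)))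
               * (\<Prod>p\<in>P. Gr n \<omega> (i (Min p)) (i (Max p))))" for m :: nat and i
    using wick[of "{1..m}" i] by (simp add: wick_eq_sum_pairings)
  show ?thesis using 1 2 3 4 by blast
qed

end
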